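(* Let $V=\mathbb{C}^n$, let $G$ be a finite subgroup of $GL(V)$, let $\alpha:G\times G\to\mathbb{C}^\times$ be a normalized two-cocycle, and let $t$ be an indeterminate. Up to isomorphism of $\mathbb{C}[t]$-algebras, the twisted graded Hecke algebras (for $G$ and $\alpha$) are precisely the deformations of $S(V)\#_\alpha G$ over $\mathbb{C}[t]$ for which $\deg\mu_i=-2i$ for all $i\geq1$. That is, every twisted graded Hecke algebra is isomorphic to such a deformation, and every such deformation is isomorphic to a twisted graded Hecke algebra.
   Context: All algebras and vector spaces are over $\mathbb{C}$. A two-cocycle is a function $\alpha:G\times G\to\mathbb{C}^\times$ with $\alpha(g,h)\alpha(gh,k)=\alpha(h,k)\alpha(g,hk)$ for all $g,h,k\in G$; it is normalized if $\alpha(1,g)=\alpha(g,1)=1$ for all $g\in G$. If $S$ is an associative $\mathbb{C}$-algebra with an action of $G$ by algebra automorphisms, the crossed product algebra $S\#_{\alpha}G$ is the vector space $S\otimes\mathbb{C}G$ with multiplication $(r\otimes g)(s\otimes h)=\alpha(g,h)\,r(g\cdot s)\otimes gh$ for $r,s\in S$, $g,h\in G$; write $s\overline{g}$ for $s\otimes g$. The action of $G$ on $V$ induces actions on the tensor algebra $T(V)$ and the symmetric algebra $S(V)$. Write $S\#_\alpha G[t]=\mathbb{C}[t]\otimes(S\#_\alpha G)$. Given skew-symmetric bilinear forms $a_g:V\times V\to\mathbb{C}$ (one for each $g\in G$, possibly $0$), let $A$ be the quotient of $T(V)\#_\alpha G[t]$ by the two-sided ideal generated by all elements $$vw-wv-\sum_{g\in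 G}a_g(v,w)\,t\,\overline{g}\qquad (v,w\in V).$$ A choice of linear section $S(V)\hookrightarrow T(V)$ of the canonical projection $T(V)\to S(V)$ that preserves the grading (for example, writing monomials in the order $v_1^{i_1}\cdots v_n^{i_n}$ for a basis $v_1,\dots,v_n$ of $V$) induces a surjective $\mathbb{C}[t]$-linear map $S(V)\#_\alpha G[t]\to A$. One says $A$ is a twisted graded Hecke algebra (for $G$ and $\alpha$, defined by the forms $\{a_g\}_{g\in G}$) if this map is an isomorphism of $\mathbb{C}[t]$-modules. Equivalently, giving elements of $V$ degree 1 and elements of $G$ (and $t$) degree 0, $A$ is a filtered algebra over $\mathbb{C}[t]$, and it is a twisted graded Hecke algebra when the canonical surjection $S(V)\#_\alpha G[t]\to\operatorname{gr}A$ is an isomorphism. For an associative $\mathbb{C}$-algebra $R$, a deformation of $R$ over $\mathbb{C}[t]$ is an associative $\mathbb{C}[t]$-algebra with underlying vector space $R[t]=\mathbb{C}[t]\otimes R$ and multiplication of the form $$r*s=rs+\mu_1(r,s)t+\mu_2(r,s)t^2+\cdots+\mu_p(r,s)t^p$$ for all $r,s\in R$, where $rs$ is the product in $R$, the $\mu_i:R\times R\to R$ are $\mathbb{C}$-bilinear maps extended to be $\mathbb{C}[t]$-bilinear, and $p$ depends on $r,s$. $R=S(V)\#_\alpha G$ is graded, $R=\bigoplus_{m\ge0}R_m$, with elements of $V$ in degree 1 and elements of $G$ in degree 0. The condition $\deg\mu_i=-2i$ means that $\mu_i$ is homogeneous of degree $-2i$ (the zero map being allowed): $\mu_i(R_m,R_k)\subseteq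 R_{m+k-2i}$ for all $m,k\ge 0$, where $R_j=0$ for $j<0$. *)

theory Defs
  imports
    "HOL-Analysis.Cartesian_Space"
    "HOL-Computational_Algebra.Polynomial"
    "HOL-Algebra.UnivPoly"
    "HOL-Algebra.QuotRing"
    "HOL-Library.Poly_Mapping"
begin

section \<open>The group and the cocycle\<close>

definition GL :: "(complex^'n^'n) monoid" where
  "GL = \<lparr>carrier = {A. invertible A}, mult = (**), one = mat 1\<rparr>"

definition normalized_cocycle :: "('g, 'm) monoid_scheme \<Rightarrow> ('g \<Rightarrow> 'g \<Rightarrow> complex) \<Rightarrow> bool" where
  "normalized_cocycle \<Gamma> \<alpha> \<longleftrightarrow>
     (\<forall>g\<in>carrier \<Gamma>. \<forall>h\<in>carrier \<Gamma>. \<alpha> g h \<noteq> 0) \<and>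
     (\<forall>g\<in>carrier \<Gamma>. \<forall>h\<in>carrier \<Gamma>. \<forall>k\<in>carrier \<Gamma>.
        \<alpha> g h * \<alpha> (g \<otimes>\<^bsub>\<Gamma>\<^esub> h) k = \<alpha> h k * \<alpha> g (h \<otimes>\<^bsub>\<Gamma>\<^esub> k)) \<and>
     (\<forall>g\<in>carrier \<Gamma>. \<alpha> \<one>\<^bsub>\<Gamma>\<^esub> g = 1 \<and> \<alpha> g \<one>\<^bsub>\<Gamma>\<^esub> = 1)"


section \<open>Tensor algebra and symmetric algebra of \<open>V\<close>\<close>

text \<open>
  With respect to the standard basis of \<open>V = \<complex>\<^sup>n\<close>, the tensor algebra has the words in the index
  type \<open>'n\<close> as a basis (the word \<open>i j \<dots> l\<close> standing for \<open>e\<^sub>i \<otimes> e\<^sub>j \<otimes> \<dots> \<otimes> e\<^sub>l\<close>) and the symmetric algebra has the monomials,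
  i.e. exponent vectors, as a basis. Both products are the convolution
  product that the library provides on \<open>'m \<Rightarrow>\<^sub>0 complex\<close> for a monoid \<open>'m\<close>, written additively;
  for words this requires concatenation as the addition. The scalar \<open>c\<close> is \<open>single 0 c\<close>.
\<close>

datatype 'n free_word = Word (letters: "'n list")

instantiation free_word :: (type) monoid_add
begin

definition zero_free_word :: "'a free_word" where
  "0 = Word []"

definition plus_free_word :: "'a free_word \<Rightarrow> 'a free_word \<Rightarrow> 'a free_word" where
  "u + w = Word (letters u @ letters w)"

instance
  by standard (simp_all add: zero_free_word_def plus_free_word_def)

end

type_synonym 'n tens = "'n free_word \<Rightarrow>\<^sub>0 complex"
type_synonym 'n symm = "('n \<Rightarrow>\<^sub>0 nat) \<Rightarrow>\<^sub>0 complex"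

definition tens_vec :: "complex^'n \<Rightarrow> 'n tens" where
  "tens_vec v = (\<Sum>i\<in>UNIV. Poly_Mapping.single (Word [i]) (v $ i))"

definition symm_vec :: "complex^'n \<Rightarrow> 'n symm" where
  "symm_vec v = (\<Sum>i\<in>UNIV. Poly_Mapping.single (Poly_Mapping.single i 1) (v $ i))"

text \<open>The algebra homomorphisms extending \<open>e\<^sub>i \<mapsto> f i\<close>.\<close>

definition tens_eval :: "('n \<Rightarrow> ('m::monoid_add \<Rightarrow>\<^sub>0 complex)) \<Rightarrow> 'n tens \<Rightarrow> ('m \<Rightarrow>\<^sub>0 complex)" where
  "tens_eval f p =
     (\<Sum>w\<in>Poly_Mapping.keys p.
        Poly_Mapping.single 0 (Poly_Mapping.lookup p w) * prod_list (map f (letters w)))"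

definition symm_eval ::
  "('n::finite \<Rightarrow> ('m::comm_monoid_add \<Rightarrow>\<^sub>0 complex)) \<Rightarrow> 'n symm \<Rightarrow> ('m \<Rightarrow>\<^sub>0 complex)" where
  "symm_eval f p =
     (\<Sum>k\<in>Poly_Mapping.keys p.
        Poly_Mapping.single 0 (Poly_Mapping.lookup p k) *
        (\<Prod>i\<in>UNIV. f i ^ Poly_Mapping.lookup k i))"

definition tens_act :: "complex^'n^'n \<Rightarrow> 'n tens \<Rightarrow> 'n tens" where
  "tens_act g = tens_eval (\<lambda>i. tens_vec (g *v axis i 1))"

definition symm_act :: "complex^'n^'n \<Rightarrow> 'n symm \<Rightarrow> 'n symm" where
  "symm_act g = symm_eval (\<lambda>i. symm_vec (g *v axis i 1))"

definition tens_to_symm :: "('n::finite) tens \<Rightarrow> 'n symm" where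
  "tens_to_symm = tens_eval (\<lambda>i. symm_vec (axis i 1))"

definition word_degree :: "'n free_word \<Rightarrow> nat" where
  "word_degree w = length (letters w)"

definition mono_degree :: "('n::finite \<Rightarrow>\<^sub>0 nat) \<Rightarrow> nat" where
  "mono_degree k = (\<Sum>i\<in>UNIV. Poly_Mapping.lookup k i)"

definition graded_section :: "(('n::finite) symm \<Rightarrow> 'n tens) \<Rightarrow> bool" where
  "graded_section \<sigma> \<longleftrightarrow>
     (\<forall>p q. \<sigma> (p + q) = \<sigma> p + \<sigma> q) \<and>
     (\<forall>c p. \<sigma> (Poly_Mapping.single 0 c * p) = Poly_Mapping.single 0 c * \<sigma> p) \<and>
     (\<forall>p. tens_to_symm (\<sigma> p) = p) \<and>
     (\<forall>m p. (\<forall>k\<in>Poly_Mapping.keys p. mono_degree k = m) \<longrightarrow>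
            (\<forall>w\<in>Poly_Mapping.keys (\<sigma> p). word_degree w = m))"


section \<open>Crossed products\<close>

text \<open>
  An algebra over \<open>K\<close> is represented by a record of type \<open>(K, _) module\<close>, which extends \<open>ring\<close> by a
  scalar multiplication; the scalars here are \<open>complex\<close> or \<open>complex poly\<close>. (The library's locale
  \<open>algebra\<close> is for commutative algebras only.)

  The element \<open>\<Sum>\<^sub>g s\<^sub>g \<otimes> g\<close> of \<open>S #\<^sub>\<alpha> \<Gamma>\<close> is the finitely supported map \<open>g \<mapsto> s\<^sub>g\<close>.
\<close>

definition crossed_product ::
  "('g, 'c) monoid_scheme \<Rightarrow> ('g \<Rightarrow> 'g \<Rightarrow> complex) \<Rightarrow>
   ('g \<Rightarrow> ('m::monoid_add \<Rightarrow>\<^sub>0 complex) \<Rightarrow> ('m \<Rightarrow>\<^sub>0 complex)) \<Rightarrow>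
   (complex, 'g \<Rightarrow>\<^sub>0 ('m \<Rightarrow>\<^sub>0 complex)) module" where
  "crossed_product \<Gamma> \<alpha> act =
     \<lparr>carrier = {x. Poly_Mapping.keys x \<subseteq> carrier \<Gamma>},
      mult = (\<lambda>x y. \<Sum>g\<in>Poly_Mapping.keys x. \<Sum>h\<in>Poly_Mapping.keys y.
        Poly_Mapping.single (g \<otimes>\<^bsub>\<Gamma>\<^esub> h)
          (Poly_Mapping.single 0 (\<alpha> g h) *
           (Poly_Mapping.lookup x g * act g (Poly_Mapping.lookup y h)))),
      one = Poly_Mapping.single \<one>\<^bsub>\<Gamma>\<^esub> 1,
      zero = 0,
      add = (+),
      smult = (\<lambda>c. Poly_Mapping.map (\<lambda>s. Poly_Mapping.single 0 c * s))\<rparr>"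

definition tens_crossed ::
  "(complex^'n^'n) set \<Rightarrow> (complex^'n^'n \<Rightarrow> complex^'n^'n \<Rightarrow> complex) \<Rightarrow>
   (complex, complex^'n^'n \<Rightarrow>\<^sub>0 'n tens) module" where
  "tens_crossed G \<alpha> = crossed_product (GL\<lparr>carrier := G\<rparr>) \<alpha> tens_act"

definition symm_crossed ::
  "(complex^'n^'n) set \<Rightarrow> (complex^'n^'n \<Rightarrow> complex^'n^'n \<Rightarrow> complex) \<Rightarrow>
   (complex, complex^'n^'n \<Rightarrow>\<^sub>0 'n symm) module" where
  "symm_crossed G \<alpha> = crossed_product (GL\<lparr>carrier := G\<rparr>) \<alpha> symm_act"

text \<open>
  The homogeneous component of degree \<open>j\<close> of \<open>S(V) #\<^sub>\<alpha> G\<close>; it is \<open>{0}\<close> for \<open>j < 0\<close>.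
\<close>

definition symm_crossed_component ::
  "(complex^'n^'n) set \<Rightarrow> int \<Rightarrow> (complex^'n^'n \<Rightarrow>\<^sub>0 'n symm) set" where
  "symm_crossed_component G j =
     {x. Poly_Mapping.keys x \<subseteq> G \<and>
         (\<forall>g. \<forall>k\<in>Poly_Mapping.keys (Poly_Mapping.lookup x g). int (mono_degree k) = j)}"


section \<open>Algebras over \<open>\<complex>[t]\<close>\<close>

text \<open>
  \<open>R[t] = \<complex>[t] \<otimes> R\<close>: the library's polynomial ring \<open>UP R\<close> (coefficient sequences, central
  indeterminate), with scalars \<open>\<complex>[t]\<close> in place of \<open>R\<close>.
\<close>

definition poly_ext :: "(complex, 'a) module \<Rightarrow> (complex poly, nat \<Rightarrow> 'a) module" where
  "poly_ext R =
     \<lparr>carrier = carrier (UP R), mult = mult (UP R), one = one (UP R),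
      zero = zero (UP R), add = add (UP R),
      smult = (\<lambda>p f n. \<Oplus>\<^bsub>R\<^esub>i\<in>{..n}. Polynomial.coeff p i \<odot>\<^bsub>R\<^esub> f (n - i))\<rparr>"

definition quot_alg :: "('k, 'a) module \<Rightarrow> 'a set \<Rightarrow> ('k, 'a set) module" where
  "quot_alg P I =
     \<lparr>carrier = carrier (P Quot I), mult = mult (P Quot I), one = one (P Quot I),
      zero = zero (P Quot I), add = add (P Quot I),
      smult = (\<lambda>c X. \<Union>x\<in>X. I +>\<^bsub>P\<^esub> (c \<odot>\<^bsub>P\<^esub> x))\<rparr>"

text \<open>The scalars below are all of the type \<open>'k\<close>.\<close>

definition mod_iso :: "('k, 'a) module \<Rightarrow> ('k, 'b) module \<Rightarrow> ('a \<Rightarrow> 'b) set" where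
  "mod_iso M N =
     {h. bij_betw h (carrier M) (carrier N) \<and>
         (\<forall>x\<in>carrier M. \<forall>y\<in>carrier M. h (x \<oplus>\<^bsub>M\<^esub> y) = h x \<oplus>\<^bsub>N\<^esub> h y) \<and>
         (\<forall>c. \<forall>x\<in>carrier M. h (c \<odot>\<^bsub>M\<^esub> x) = c \<odot>\<^bsub>N\<^esub> h x)}"

definition alg_isomorphic :: "('k, 'a) module \<Rightarrow> ('k, 'b) module \<Rightarrow> bool" where
  "alg_isomorphic A B \<longleftrightarrow>
     (\<exists>h\<in>ring_iso A B. \<forall>c. \<forall>x\<in>carrier A. h (c \<odot>\<^bsub>A\<^esub> x) = c \<odot>\<^bsub>B\<^esub> h x)"


section \<open>Twisted graded Hecke algebras\<close>

definition skew_bilinear :: "(complex^'n \<Rightarrow> complex^'n \<Rightarrow> complex) \<Rightarrow> bool" where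
  "skew_bilinear b \<longleftrightarrow>
     (\<forall>w. Vector_Spaces.linear (*s) (*) (\<lambda>v. b v w)) \<and>
     (\<forall>v. Vector_Spaces.linear (*s) (*) (b v)) \<and>
     (\<forall>v w. b v w = - b w v)"

definition hecke_relation ::
  "(complex^'n^'n) set \<Rightarrow> (complex^'n^'n \<Rightarrow> complex^'n^'n \<Rightarrow> complex) \<Rightarrow>
   (complex^'n^'n \<Rightarrow> complex^'n \<Rightarrow> complex^'n \<Rightarrow> complex) \<Rightarrow>
   complex^'n \<Rightarrow> complex^'n \<Rightarrow> nat \<Rightarrow> (complex^'n^'n \<Rightarrow>\<^sub>0 'n tens)" where
  "hecke_relation G \<alpha> a v w =
     (let P = UP (tens_crossed G \<alpha>);
          x = (\<lambda>u. monom P (Poly_Mapping.single (mat 1) (tens_vec u)) 0)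
      in (x v \<otimes>\<^bsub>P\<^esub> x w \<ominus>\<^bsub>P\<^esub> x w \<otimes>\<^bsub>P\<^esub> x v) \<ominus>\<^bsub>P\<^esub>
         (\<Oplus>\<^bsub>P\<^esub>g\<in>G. monom P (Poly_Mapping.single g (Poly_Mapping.single 0 (a g v w))) 1))"

definition hecke_ideal ::
  "(complex^'n^'n) set \<Rightarrow> (complex^'n^'n \<Rightarrow> complex^'n^'n \<Rightarrow> complex) \<Rightarrow>
   (complex^'n^'n \<Rightarrow> complex^'n \<Rightarrow> complex^'n \<Rightarrow> complex) \<Rightarrow>
   (nat \<Rightarrow> (complex^'n^'n \<Rightarrow>\<^sub>0 'n tens)) set" where
  "hecke_ideal G \<alpha> a =
     genideal (poly_ext (tens_crossed G \<alpha>)) {hecke_relation G \<alpha> a v w | v w. True}"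

definition hecke_quotient ::
  "(complex^'n^'n) set \<Rightarrow> (complex^'n^'n \<Rightarrow> complex^'n^'n \<Rightarrow> complex) \<Rightarrow>
   (complex^'n^'n \<Rightarrow> complex^'n \<Rightarrow> complex^'n \<Rightarrow> complex) \<Rightarrow>
   (complex poly, (nat \<Rightarrow> (complex^'n^'n \<Rightarrow>\<^sub>0 'n tens)) set) module" where
  "hecke_quotient G \<alpha> a =
     quot_alg (poly_ext (tens_crossed G \<alpha>)) (hecke_ideal G \<alpha> a)"

definition section_map ::
  "(complex^'n^'n) set \<Rightarrow> (complex^'n^'n \<Rightarrow> complex^'n^'n \<Rightarrow> complex) \<Rightarrow>
   (complex^'n^'n \<Rightarrow> complex^'n \<Rightarrow> complex^'n \<Rightarrow> complex) \<Rightarrow>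
   ('n symm \<Rightarrow> 'n tens) \<Rightarrow>
   (nat \<Rightarrow> (complex^'n^'n \<Rightarrow>\<^sub>0 'n symm)) \<Rightarrow> (nat \<Rightarrow> (complex^'n^'n \<Rightarrow>\<^sub>0 'n tens)) set" where
  "section_map G \<alpha> a \<sigma> f =
     hecke_ideal G \<alpha> a +>\<^bsub>poly_ext (tens_crossed G \<alpha>)\<^esub> (\<lambda>i. Poly_Mapping.map \<sigma> (f i))"

text \<open>
  The existential quantifier expresses the choice of a section; whether the induced map is an
  isomorphism does not depend on it.
\<close>

definition twisted_graded_Hecke ::
  "(complex^'n^'n) set \<Rightarrow> (complex^'n^'n \<Rightarrow> complex^'n^'n \<Rightarrow> complex) \<Rightarrow>
   (complex^'n^'n \<Rightarrow> complex^'n \<Rightarrow> complex^'n \<Rightarrow> complex) \<Rightarrow> bool" where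
  "twisted_graded_Hecke G \<alpha> a \<longleftrightarrow>
     (\<forall>g\<in>G. skew_bilinear (a g)) \<and>
     (\<exists>\<sigma>. graded_section \<sigma> \<and>
        section_map G \<alpha> a \<sigma> \<in> mod_iso (poly_ext (symm_crossed G \<alpha>)) (hecke_quotient G \<alpha> a))"


section \<open>Deformations over \<open>\<complex>[t]\<close>\<close>

text \<open>
  \<open>R[t]\<close> with the product \<open>r * s = \<Sum>\<^sub>i \<mu> i r s t\<^sup>i\<close> on \<open>R\<close>, extended \<open>\<complex>[t]\<close>-bilinearly.
\<close>

definition deformed_algebra ::
  "(complex, 'a) module \<Rightarrow> (nat \<Rightarrow> 'a \<Rightarrow> 'a \<Rightarrow> 'a) \<Rightarrow> (complex poly, nat \<Rightarrow> 'a) module" where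
  "deformed_algebra R \<mu> =
     (poly_ext R)\<lparr>mult := (\<lambda>f g n.
        \<Oplus>\<^bsub>R\<^esub>i\<in>{..n}. \<Oplus>\<^bsub>R\<^esub>j\<in>{..n-i}. \<mu> i (f j) (g (n - i - j)))\<rparr>"

definition alg_bilinear :: "(complex, 'a) module \<Rightarrow> ('a \<Rightarrow> 'a \<Rightarrow> 'a) \<Rightarrow> bool" where
  "alg_bilinear R b \<longleftrightarrow>
     (\<forall>r\<in>carrier R. \<forall>s\<in>carrier R. b r s \<in> carrier R) \<and>
     (\<forall>r\<in>carrier R. \<forall>r'\<in>carrier R. \<forall>s\<in>carrier R.
        b (r \<oplus>\<^bsub>R\<^esub> r') s = b r s \<oplus>\<^bsub>R\<^esub> b r' s \<and> b s (r \<oplus>\<^bsub>R\<^esub> r') = b s r \<oplus>\<^bsub>R\<^esub> b s r') \<and>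
     (\<forall>c. \<forall>r\<in>carrier R. \<forall>s\<in>carrier R.
        b (c \<odot>\<^bsub>R\<^esub> r) s = c \<odot>\<^bsub>R\<^esub> b r s \<and> b r (c \<odot>\<^bsub>R\<^esub> s) = c \<odot>\<^bsub>R\<^esub> b r s)"

text \<open>
  The index \<open>0\<close> stands for the product of \<open>R\<close>. That \<open>1\<close> is a unit for the deformed product is not
  required here; it is part of any isomorphism of rings with a unital algebra.
\<close>

definition is_deformation ::
  "(complex, 'a) module \<Rightarrow> (nat \<Rightarrow> 'a \<Rightarrow> 'a \<Rightarrow> 'a) \<Rightarrow> bool" where
  "is_deformation R \<mu> \<longleftrightarrow>
     (\<forall>r\<in>carrier R. \<forall>s\<in>carrier R. \<mu> 0 r s = r \<otimes>\<^bsub>R\<^esub> s) \<and>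
     (\<forall>i\<ge>1. alg_bilinear R (\<mu> i)) \<and>
     (\<forall>r\<in>carrier R. \<forall>s\<in>carrier R. \<exists>p. \<forall>i>p. \<mu> i r s = \<zero>\<^bsub>R\<^esub>) \<and>
     (\<forall>f\<in>carrier (deformed_algebra R \<mu>). \<forall>g\<in>carrier (deformed_algebra R \<mu>).
      \<forall>h\<in>carrier (deformed_algebra R \<mu>).
        (f \<otimes>\<^bsub>deformed_algebra R \<mu>\<^esub> g) \<otimes>\<^bsub>deformed_algebra R \<mu>\<^esub> h =
        f \<otimes>\<^bsub>deformed_algebra R \<mu>\<^esub> (g \<otimes>\<^bsub>deformed_algebra R \<mu>\<^esub> h))"

definition deg_neg_two ::
  "(int \<Rightarrow> 'a set) \<Rightarrow> (nat \<Rightarrow> 'a \<Rightarrow> 'a \<Rightarrow> 'a) \<Rightarrow> bool" where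
  "deg_neg_two Rc \<mu> \<longleftrightarrow>
     (\<forall>i\<ge>1. \<forall>m k. \<forall>r\<in>Rc (int m). \<forall>s\<in>Rc (int k). \<mu> i r s \<in> Rc (int m + int k - 2 * int i))"

end

theory Submission
  imports Defs "HOL-Library.Function_Algebras"
begin

text \<open>
  Write \<open>R = S(V) #\<^sub>\<alpha> G\<close>, and give \<open>t\<close> degree \<open>2\<close>; then the Hecke relations are homogeneous.

  In the Hecke quotient \<open>A\<close>, exchanging two adjacent letters of a word costs \<open>t\<close> times an element of
  degree two less. Hence an element \<open>x\<close> of degree \<open>m\<close> of \<open>T(V) #\<^sub>\<alpha> G\<close> is congruent to the section of
  some \<open>y = y\<^sub>0 + y\<^sub>1 t + \<dots>\<close> with \<open>y\<^sub>i\<close> of degree \<open>m - 2i\<close> and \<open>y\<^sub>0\<close> the image of \<open>x\<close> in \<open>R\<close>. If the section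
  map \<open>R[t] \<rightarrow> A\<close> is bijective, this says that the product of \<open>A\<close>, transported to \<open>R[t]\<close>, has \<open>\<mu>\<^sub>0\<close> the
  product of \<open>R\<close> and \<open>\<mu>\<^sub>i\<close> of degree \<open>-2i\<close>.

  Conversely, in a deformation the elements of \<open>G\<close> multiply with each other and with \<open>V\<close> as in \<open>R\<close>, because
  \<open>\<mu>\<^sub>i\<close> would land in negative degree, and \<open>v * w - w * v = (\<mu>\<^sub>1(v,w) - \<mu>\<^sub>1(w,v)) t\<close> with coefficient in the
  group algebra, which defines the forms \<open>a\<^sub>g\<close>. So the inclusions of \<open>V\<close> and \<open>G\<close> extend to a homomorphism
  \<open>\<phi>\<close> from \<open>A\<close> to the deformed algebra. Composed with the section map, \<open>\<phi>\<close> is the identity modulo \<open>t\<close>, so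
  the section map is injective and \<open>\<phi>\<close> is an isomorphism.
\<close>

text \<open>Being the identity modulo t settles injectivity, by a look at the lowest power of t.
  Over C[t], unlike over power series, it does not settle surjectivity: multiplication by 1 + t is
  the identity modulo t and is not onto. The grading takes the place of completeness. With t in
  degree 2, each correction by a power of t lowers the degree in V, and negative degrees vanish, so
  successive approximation stops after finitely many steps. This descent occurs twice: for
  representatives modulo the Hecke ideal, and for the surjectivity of \<phi>.

  The first descent shows that the section map is onto for every family of forms, so that being a
  twisted graded Hecke algebra comes down to injectivity. Once that is known, each class modulo the
  ideal has exactly one representative of the form "section of y". This normal form carries the
  product of A over to R[t], and it also shows that the kernel of \<phi> is no larger than the
  ideal.\<close>

section \<open>Monoid algebras over the complex numbers\<close>

lemma sum_apply: "(\<Sum>a\<in>A. f a) x = (\<Sum>a\<in>A. f a x)" for f :: "'a \<Rightarrow> 'b \<Rightarrow> 'c::comm_monoid_add"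
  by (induction A rule: infinite_finite_induct) auto

lemma poly_mapping_sum_single:
  fixes p :: "'a \<Rightarrow>\<^sub>0 'b::comm_monoid_add"
  assumes "finite A" "Poly_Mapping.keys p \<subseteq> A"
  shows "(\<Sum>k\<in>A. Poly_Mapping.single k (Poly_Mapping.lookup p k)) = p"
proof (rule poly_mapping_eqI)
  fix k
  have "Poly_Mapping.lookup (\<Sum>k\<in>A. Poly_Mapping.single k (Poly_Mapping.lookup p k)) k
      = (\<Sum>j\<in>A. if j = k then Poly_Mapping.lookup p k else 0)"
    by (auto simp: lookup_sum lookup_single when_def intro!: sum.cong)
  also have "\<dots> = Poly_Mapping.lookup p k"
    using assms by (auto simp: sum.delta in_keys_iff)
  finally show "Poly_Mapping.lookup (\<Sum>k\<in>A. Poly_Mapping.single k (Poly_Mapping.lookup p k)) k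
      = Poly_Mapping.lookup p k" .
qed

text \<open>The set \<open>K\<close> confines the supports, so that a statement about homogeneous
  elements can be proved by induction over sums whose terms are again homogeneous.\<close>

lemma poly_mapping_single_induct [consumes 1, case_names zero add single]:
  fixes p :: "'a \<Rightarrow>\<^sub>0 'b::comm_monoid_add"
  assumes "Poly_Mapping.keys p \<subseteq> K"
    and "Q 0"
    and "\<And>p q. Poly_Mapping.keys p \<subseteq> K \<Longrightarrow> Poly_Mapping.keys q \<subseteq> K \<Longrightarrow> Q p \<Longrightarrow> Q q \<Longrightarrow> Q (p + q)"
    and "\<And>k c. k \<in> K \<Longrightarrow> Q (Poly_Mapping.single k c)"
  shows "Q p"
proof -
  have "Poly_Mapping.keys (\<Sum>k\<in>A. Poly_Mapping.single k (Poly_Mapping.lookup p k)) \<subseteq> K \<and>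
      Q (\<Sum>k\<in>A. Poly_Mapping.single k (Poly_Mapping.lookup p k))"
    if "finite A" "A \<subseteq> K" for A
    using that
  proof (induction A rule: finite_induct)
    case (insert a A)
    have "Poly_Mapping.keys (Poly_Mapping.single a (Poly_Mapping.lookup p a)) \<subseteq> K"
      using insert by (simp split: if_splits)
    then show ?case
      using insert assms(3)[of "Poly_Mapping.single a (Poly_Mapping.lookup p a)"] assms(4)[of a]
      by (auto dest!: subsetD[OF keys_add])
  qed (use assms in auto)
  from this[of "Poly_Mapping.keys p"] show ?thesis
    using assms(1) by (simp add: poly_mapping_sum_single)
qed

lemmas poly_mapping_single_induct_UNIV =
  poly_mapping_single_induct[OF subset_UNIV, case_names zero add single]

lemma lookup_const_mult [simp]:
  "Poly_Mapping.lookup (Poly_Mapping.single 0 c * p) k = c * Poly_Mapping.lookup p k"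
  for c :: "'a::semiring_0"
  by (simp add: Poly_Mapping.map.rep_eq when_def flip: mult_map_scale_conv_mult)

lemma const_mult_single:
  "Poly_Mapping.single (0::'m::monoid_add) c * Poly_Mapping.single k d = Poly_Mapping.single k (c * d)"
  for c :: "'a::semiring_0"
  by (simp add: mult_single)

text \<open>0 is neutral on both sides of the monoid, so only the commuting of complex numbers is at
  stake. For words this is what makes T(V) an algebra over C.\<close>

lemma const_central:
  fixes p :: "'m::monoid_add \<Rightarrow>\<^sub>0 complex"
  shows "p * Poly_Mapping.single 0 c = Poly_Mapping.single 0 c * p"
  by (induction p rule: poly_mapping_single_induct_UNIV)
    (simp_all add: distrib_left distrib_right mult_single mult.commute)

lemma const_left_commute:
  fixes p :: "'m::monoid_add \<Rightarrow>\<^sub>0 complex"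
  shows "p * (Poly_Mapping.single 0 c * q) = Poly_Mapping.single 0 c * (p * q)"
  by (metis const_central mult.assoc)

lemma const_mult_const:
  "Poly_Mapping.single 0 c * (Poly_Mapping.single 0 d * p) =
    Poly_Mapping.single 0 (c * d) * (p :: 'm::monoid_add \<Rightarrow>\<^sub>0 complex)"
  by (simp add: mult_single flip: mult.assoc)

lemma const_mult_mult:
  fixes p :: "'m::monoid_add \<Rightarrow>\<^sub>0 complex"
  shows "(Poly_Mapping.single 0 c * p) * (Poly_Mapping.single 0 d * q) =
    Poly_Mapping.single 0 (c * d) * (p * q)"
proof -
  have "(Poly_Mapping.single 0 c * p) * (Poly_Mapping.single 0 d * q) =
      Poly_Mapping.single 0 c * (p * (Poly_Mapping.single 0 d * q))"
    by (rule mult.assoc)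
  then show ?thesis
    by (simp add: const_left_commute[of p d] const_mult_const)
qed

lemma keys_const_mult: "Poly_Mapping.keys (Poly_Mapping.single 0 c * p) \<subseteq> Poly_Mapping.keys p"
  for c :: "'a::semiring_0"
  by (auto simp: in_keys_iff)

text \<open>Fixing the constants contains unitality (c = 1) and, together with multiplicativity,
  C-linearity, since scalars act as products with constants.\<close>

definition alg_map :: "(('m::monoid_add \<Rightarrow>\<^sub>0 complex) \<Rightarrow> ('l::monoid_add \<Rightarrow>\<^sub>0 complex)) \<Rightarrow> bool" where
  "alg_map F \<longleftrightarrow> (\<forall>p q. F (p + q) = F p + F q) \<and> (\<forall>p q. F (p * q) = F p * F q) \<and>
     (\<forall>c. F (Poly_Mapping.single 0 c) = Poly_Mapping.single 0 c)"

lemma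
  assumes "alg_map F"
  shows alg_map_add: "F (p + q) = F p + F q"
    and alg_map_mult: "F (p * q) = F p * F q"
    and alg_map_const: "F (Poly_Mapping.single 0 c) = Poly_Mapping.single 0 c"
    and alg_map_zero: "F 0 = 0"
    and alg_map_one: "F 1 = 1"
    and alg_map_sum: "F (\<Sum>a\<in>A. f a) = (\<Sum>a\<in>A. F (f a))"
proof -
  show *: "F (p + q) = F p + F q" for p q using assms by (simp add: alg_map_def)
  show "F (p * q) = F p * F q" using assms by (simp add: alg_map_def)
  show c: "F (Poly_Mapping.single 0 c) = Poly_Mapping.single 0 c" for c
    using assms by (simp add: alg_map_def)
  show 0: "F 0 = 0" using c[of 0] by simp
  show "F 1 = 1" using c[of 1] by simp
  show "F (\<Sum>a\<in>A. f a) = (\<Sum>a\<in>A. F (f a))"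
    by (induction A rule: infinite_finite_induct) (simp_all add: * 0)
qed

lemma alg_map_comp: "alg_map F \<Longrightarrow> alg_map H \<Longrightarrow> alg_map (\<lambda>p. F (H p))"
  by (simp add: alg_map_def)

lemma alg_map_id: "alg_map (\<lambda>p. p)"
  by (simp add: alg_map_def)

section \<open>Tensor and symmetric algebra\<close>

abbreviation gen :: "'n \<Rightarrow> 'n tens" where
  "gen i \<equiv> Poly_Mapping.single (Word [i]) 1"

lemma letters_simps [simp]: "letters 0 = []" "letters (u + w) = letters u @ letters w"
  by (simp_all add: zero_free_word_def plus_free_word_def)

lemma tens_eval_single [simp]:
  "tens_eval f (Poly_Mapping.single w c) = Poly_Mapping.single 0 c * prod_list (map f (letters w))"
  by (simp add: tens_eval_def)

lemma tens_eval_add: "tens_eval f (p + q) = tens_eval f p + tens_eval f q"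
  unfolding tens_eval_def
  by (rule setsum_keys_plus_distrib) (simp_all add: single_add distrib_right)

lemma tens_eval_0 [simp]: "tens_eval f 0 = 0"
  by (simp add: tens_eval_def)

lemma alg_map_tens_eval: "alg_map (tens_eval f)"
proof -
  have *: "tens_eval f (Poly_Mapping.single w c * q) = tens_eval f (Poly_Mapping.single w c) * tens_eval f q" for w c q
    by (induction q rule: poly_mapping_single_induct_UNIV)
      (simp_all add: distrib_left tens_eval_add mult_single const_mult_mult)
  have "tens_eval f (p * q) = tens_eval f p * tens_eval f q" for p q
    by (induction p rule: poly_mapping_single_induct_UNIV)
      (simp_all add: distrib_right tens_eval_add * del: tens_eval_single)
  then show ?thesis
    by (simp add: alg_map_def tens_eval_add)
qed

lemma single_Word_Cons:
  "Poly_Mapping.single (Word (i # xs)) c = gen i * Poly_Mapping.single (Word xs) c"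
  by (simp add: mult_single plus_free_word_def)

lemma single_Word_Nil: "Poly_Mapping.single (Word []) c = Poly_Mapping.single 0 c"
  by (simp add: zero_free_word_def)

text \<open>Letters and constants generate the tensor algebra. This uniqueness half of its universal
  property reduces identities for the action of G to basis vectors.\<close>

lemma alg_map_tens_eqI:
  assumes F: "alg_map F" and H: "alg_map H" and gen: "\<And>i. F (gen i) = H (gen i)"
  shows "F p = H p"
proof (induction p rule: poly_mapping_single_induct_UNIV)
  case (single w c)
  have "F (Poly_Mapping.single (Word xs) c) = H (Poly_Mapping.single (Word xs) c)" for xs
  proof (induction xs)
    case Nil
    then show ?case by (simp add: single_Word_Nil alg_map_const[OF F] alg_map_const[OF H])
  next
    case (Cons i xs)
    then show ?case
      by (simp only: single_Word_Cons[of i xs] alg_map_mult[OF F] alg_map_mult[OF H] gen)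
  qed
  from this[of "letters w"] show ?case by simp
qed (simp_all add: alg_map_zero[OF F] alg_map_zero[OF H] alg_map_add[OF F] alg_map_add[OF H])

lemma alg_map_tens_act: "alg_map (tens_act g)"
  by (simp add: tens_act_def alg_map_tens_eval)

lemma tens_act_gen: "tens_act g (gen i) = tens_vec (g *v axis i 1)"
  by (simp add: tens_act_def)

lemma tens_vec_axis: "tens_vec (axis i 1) = gen i"
proof -
  have "tens_vec (axis i 1) = (\<Sum>j\<in>UNIV. if j = i then gen i else 0)"
    unfolding tens_vec_def by (rule sum.cong) (auto simp: axis_def)
  then show ?thesis by simp
qed

lemma single_sum: "Poly_Mapping.single k (\<Sum>a\<in>A. f a) = (\<Sum>a\<in>A. Poly_Mapping.single k (f a))"
  by (induction A rule: infinite_finite_induct) (simp_all add: single_add)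

text \<open>Linearity of \<open>g\<close>, written with constants so that it matches an algebra map
  applied termwise. \<open>tens_act\<close> is prescribed on letters only, and this identifies its
  value on every vector.\<close>

lemma tens_vec_mult:
  "tens_vec (g *v v) = (\<Sum>i\<in>UNIV. Poly_Mapping.single 0 (v $ i) * tens_vec (g *v axis i 1))"
proof -
  have entry: "(g *v axis i 1) $ j = g $ j $ i" for i j
    by (simp add: matrix_vector_mult_def axis_def if_distrib cong: if_cong)
  have "tens_vec (g *v v) = (\<Sum>j\<in>UNIV. \<Sum>i\<in>UNIV. Poly_Mapping.single (Word [j]) (v $ i * g $ j $ i))"
    by (simp add: tens_vec_def matrix_vector_mult_def single_sum mult.commute)
  also have "\<dots> = (\<Sum>i\<in>UNIV. \<Sum>j\<in>UNIV. Poly_Mapping.single (Word [j]) (v $ i * g $ j $ i))"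
    by (rule sum.swap)
  also have "\<dots> = (\<Sum>i\<in>UNIV. Poly_Mapping.single 0 (v $ i) * tens_vec (g *v axis i 1))"
    by (simp add: tens_vec_def sum_distrib_left const_mult_single entry)
  finally show ?thesis .
qed

lemma tens_vec_expand: "tens_vec v = (\<Sum>i\<in>UNIV. Poly_Mapping.single 0 (v $ i) * gen i)"
  by (simp add: tens_vec_def const_mult_single)

lemma tens_act_vec: "tens_act g (tens_vec v) = tens_vec (g *v v)"
  by (simp only: tens_vec_expand[of v] alg_map_sum[OF alg_map_tens_act] alg_map_mult[OF alg_map_tens_act]
      alg_map_const[OF alg_map_tens_act] tens_act_gen tens_vec_mult[of g v])

lemma tens_act_mult: "tens_act (g ** h) p = tens_act g (tens_act h p)"
  by (rule alg_map_tens_eqI)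
    (simp_all add: alg_map_tens_act alg_map_comp tens_act_gen tens_act_vec matrix_vector_mul_assoc)

lemma tens_act_one: "tens_act (mat 1) p = p"
  by (rule alg_map_tens_eqI) (simp_all add: alg_map_tens_act alg_map_id tens_act_gen tens_vec_axis)

section \<open>The symmetric algebra and its action of G\<close>

lemma symm_eval_single [simp]:
  "symm_eval f (Poly_Mapping.single k c) =
    Poly_Mapping.single 0 c * (\<Prod>i\<in>UNIV. f i ^ Poly_Mapping.lookup k i)"
  by (simp add: symm_eval_def)

lemma symm_eval_add: "symm_eval f (p + q) = symm_eval f p + symm_eval f q"
  unfolding symm_eval_def
  by (rule setsum_keys_plus_distrib) (simp_all add: single_add distrib_right)

lemma symm_eval_0 [simp]: "symm_eval f 0 = 0"
  by (simp add: symm_eval_def)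

text \<open>Collecting the powers of \<open>f i\<close> index by index uses that the target algebra
  is commutative.\<close>

lemma alg_map_symm_eval:
  "alg_map (symm_eval (f :: 'n::finite \<Rightarrow> ('m::comm_monoid_add \<Rightarrow>\<^sub>0 complex)))"
proof -
  have s: "symm_eval f (Poly_Mapping.single k c * Poly_Mapping.single l d) =
      symm_eval f (Poly_Mapping.single k c) * symm_eval f (Poly_Mapping.single l d)" for k c l d
    by (simp add: mult_single lookup_add power_add prod.distrib const_mult_mult)
  have *: "symm_eval f (Poly_Mapping.single w c * q) = symm_eval f (Poly_Mapping.single w c) * symm_eval f q" for w c q
    by (induction q rule: poly_mapping_single_induct_UNIV)
      (simp_all add: distrib_left symm_eval_add s del: symm_eval_single)
  have "symm_eval f (p * q) = symm_eval f p * symm_eval f q" for p q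
    by (induction p rule: poly_mapping_single_induct_UNIV)
      (simp_all add: distrib_right symm_eval_add * del: symm_eval_single)
  then show ?thesis
    by (simp add: alg_map_def symm_eval_add)
qed

lemma alg_map_symm_act: "alg_map (symm_act g)"
  by (simp add: symm_act_def alg_map_symm_eval)

abbreviation sgen :: "'n \<Rightarrow> 'n symm" where
  "sgen i \<equiv> Poly_Mapping.single (Poly_Mapping.single i 1) 1"

lemma symm_act_gen: "symm_act g (sgen i) = symm_vec (g *v axis i 1)"
proof -
  have "(\<Prod>j\<in>UNIV. f j ^ Poly_Mapping.lookup (Poly_Mapping.single i 1) j) = f i" for f :: "'a \<Rightarrow> 'a symm"
  proof -
    have "(\<Prod>j\<in>UNIV. f j ^ Poly_Mapping.lookup (Poly_Mapping.single i 1) j) = (\<Prod>j\<in>UNIV. if j = i then f i else 1)"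
      by (rule prod.cong) (auto simp: lookup_single)
    then show ?thesis by simp
  qed
  then show ?thesis by (simp add: symm_act_def)
qed

lemma symm_vec_axis: "symm_vec (axis i 1) = sgen i"
proof -
  have "symm_vec (axis i 1) = (\<Sum>j\<in>UNIV. if j = i then sgen i else 0)"
    unfolding symm_vec_def by (rule sum.cong) (auto simp: axis_def)
  then show ?thesis by simp
qed

lemma symm_vec_expand: "symm_vec v = (\<Sum>i\<in>UNIV. Poly_Mapping.single 0 (v $ i) * sgen i)"
  by (simp add: symm_vec_def const_mult_single)

lemma alg_map_tens_to_symm: "alg_map tens_to_symm"
  by (simp add: tens_to_symm_def alg_map_tens_eval)

lemma tens_to_symm_gen: "tens_to_symm (gen i) = sgen i"
  by (simp add: tens_to_symm_def symm_vec_axis)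

lemma tens_to_symm_vec: "tens_to_symm (tens_vec v) = symm_vec v"
  by (simp only: tens_vec_expand symm_vec_expand alg_map_sum[OF alg_map_tens_to_symm]
      alg_map_mult[OF alg_map_tens_to_symm] alg_map_const[OF alg_map_tens_to_symm] tens_to_symm_gen)

lemma tens_to_symm_act: "tens_to_symm (tens_act g p) = symm_act g (tens_to_symm p)"
proof (rule alg_map_tens_eqI)
  show "alg_map (\<lambda>p. tens_to_symm (tens_act g p))" "alg_map (\<lambda>p. symm_act g (tens_to_symm p))"
    using alg_map_comp[OF alg_map_tens_to_symm alg_map_tens_act]
      alg_map_comp[OF alg_map_symm_act alg_map_tens_to_symm] .
qed (simp add: tens_act_gen tens_to_symm_gen symm_act_gen tens_to_symm_vec del: One_nat_def)

section \<open>Words, monomials and a graded section\<close>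

definition mono_of_word :: "'n free_word \<Rightarrow> ('n \<Rightarrow>\<^sub>0 nat)" where
  "mono_of_word w = sum_list (map (\<lambda>i. Poly_Mapping.single i 1) (letters w))"

lemma tens_to_symm_single [simp]:
  "tens_to_symm (Poly_Mapping.single w c) = Poly_Mapping.single (mono_of_word w) c"
proof -
  have "prod_list (map sgen xs) = Poly_Mapping.single (sum_list (map (\<lambda>i. Poly_Mapping.single i 1) xs)) 1"
    for xs :: "'a list"
    by (induction xs) (simp_all add: mult_single)
  then show ?thesis
    by (simp add: tens_to_symm_def symm_vec_axis mono_of_word_def const_mult_single)
qed

lemma lookup_mono_of_word: "Poly_Mapping.lookup (mono_of_word w) i = count (mset (letters w)) i"
proof -
  have "Poly_Mapping.lookup (sum_list (map (\<lambda>i. Poly_Mapping.single i 1) xs)) i = count (mset xs) i"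
    for xs :: "'a list"
    by (induction xs) (auto simp: lookup_add lookup_single when_def)
  then show ?thesis by (simp add: mono_of_word_def)
qed

text \<open>The exponent of a letter is its multiplicity, so the words over one monomial are the
  rearrangements of each other. This links the projection to S(V) with the exchange of
  letters.\<close>

lemma mono_of_word_eq_iff: "mono_of_word u = mono_of_word w \<longleftrightarrow> mset (letters u) = mset (letters w)"
  by (simp add: poly_mapping_eq_iff fun_eq_iff multiset_eq_iff lookup_mono_of_word)

lemma mono_degree_mono_of_word: "mono_degree (mono_of_word w) = word_degree w"
proof -
  have "size M = (\<Sum>i\<in>UNIV. count M i)" for M :: "'a multiset"
    unfolding size_multiset_overloaded_eq by (rule sum.mono_neutral_left) (auto simp: not_in_iff)
  from this[of "mset (letters w)"] show ?thesis
    by (simp add: mono_degree_def word_degree_def lookup_mono_of_word)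
qed

text \<open>An arbitrary word is chosen for each monomial: the index type carries no order, and any
  two words with the same exponents are related by swaps of adjacent letters.\<close>

definition word_of_mono :: "('n \<Rightarrow>\<^sub>0 nat) \<Rightarrow> 'n free_word" where
  "word_of_mono k = (SOME w. mono_of_word w = k)"

lemma mono_of_word_of_mono [simp]: "mono_of_word (word_of_mono k) = k"
proof -
  have "\<exists>w. mono_of_word w = k"
  proof (induction k rule: poly_mapping_single_induct_UNIV)
    case zero
    show ?case by (rule exI[of _ "Word []"]) (simp add: mono_of_word_def)
  next
    case (add p q)
    then obtain u w where "mono_of_word u = p" "mono_of_word w = q" by blast
    then have "mono_of_word (u + w) = p + q" by (simp add: mono_of_word_def)
    then show ?case ..
  next
    case (single i n)
    have "mono_of_word (Word (replicate n i)) = Poly_Mapping.single i n"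
      by (rule poly_mapping_eqI) (simp add: lookup_mono_of_word lookup_single when_def)
    then show ?case ..
  qed
  then show ?thesis unfolding word_of_mono_def by (rule someI_ex)
qed

definition ordered_section :: "'n symm \<Rightarrow> 'n tens" where
  "ordered_section p =
    (\<Sum>k\<in>Poly_Mapping.keys p. Poly_Mapping.single (word_of_mono k) (Poly_Mapping.lookup p k))"

lemma ordered_section_single [simp]:
  "ordered_section (Poly_Mapping.single k c) = Poly_Mapping.single (word_of_mono k) c"
  by (simp add: ordered_section_def)

lemma ordered_section_add: "ordered_section (p + q) = ordered_section p + ordered_section q"
  unfolding ordered_section_def
  by (rule setsum_keys_plus_distrib) (simp_all add: single_add)

lemma ordered_section_0 [simp]: "ordered_section 0 = 0"
  by (simp add: ordered_section_def)

lemma graded_section_ordered_section: "graded_section ordered_section"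
  unfolding graded_section_def
proof (intro conjI allI impI ballI)
  show "ordered_section (Poly_Mapping.single 0 c * p) = Poly_Mapping.single 0 c * ordered_section p" for c and p :: "'a symm"
    by (induction p rule: poly_mapping_single_induct_UNIV)
      (simp_all add: distrib_left ordered_section_add const_mult_single)
  show "tens_to_symm (ordered_section p) = p" for p :: "'a symm"
    by (induction p rule: poly_mapping_single_induct_UNIV)
      (simp_all add: alg_map_add[OF alg_map_tens_to_symm] alg_map_zero[OF alg_map_tens_to_symm] ordered_section_add)
next
  fix m :: nat and p :: "'a symm" and w
  assume *: "\<forall>k\<in>Poly_Mapping.keys p. mono_degree k = m" "w \<in> Poly_Mapping.keys (ordered_section p)"
  then obtain k where "k \<in> Poly_Mapping.keys p" "w = word_of_mono k"
    unfolding ordered_section_def by (auto dest!: subsetD[OF keys_sum] split: if_splits)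
  then show "word_degree w = m"
    using * by (metis mono_degree_mono_of_word mono_of_word_of_mono)
qed (simp add: ordered_section_add)

lemma tens_to_symm_surj: "\<exists>q. tens_to_symm q = p"
  using graded_section_ordered_section by (auto simp: graded_section_def)

text \<open>Inherited from T(V), because \<open>tens_to_symm\<close> is onto and commutes with the
  action.\<close>

lemma symm_act_mult: "symm_act (g ** h) p = symm_act g (symm_act h p)"
  using tens_to_symm_surj[of p] tens_to_symm_act tens_act_mult by metis

lemma symm_act_one: "symm_act (mat 1) p = p"
  using tens_to_symm_surj[of p] tens_to_symm_act tens_act_one by metis

section \<open>Homogeneous tensors\<close>

definition tens_homogeneous :: "int \<Rightarrow> 'n tens \<Rightarrow> bool" where
  "tens_homogeneous m p \<longleftrightarrow> (\<forall>w\<in>Poly_Mapping.keys p. int (word_degree w) = m)"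

lemma tens_homogeneous_single: "int (word_degree w) = m \<Longrightarrow> tens_homogeneous m (Poly_Mapping.single w c)"
  by (simp add: tens_homogeneous_def)

lemma tens_homogeneous_mult:
  "tens_homogeneous m p \<Longrightarrow> tens_homogeneous k q \<Longrightarrow> tens_homogeneous (m + k) (p * q)"
  unfolding tens_homogeneous_def
  by (force dest!: subsetD[OF keys_mult] simp: word_degree_def)

lemma tens_homogeneous_add:
  "tens_homogeneous m p \<Longrightarrow> tens_homogeneous m q \<Longrightarrow> tens_homogeneous m (p + q)"
  unfolding tens_homogeneous_def by (auto dest!: subsetD[OF keys_add])

lemma tens_homogeneous_0 [simp]: "tens_homogeneous m 0"
  by (simp add: tens_homogeneous_def)

lemma tens_homogeneous_sum:
  "(\<And>a. a \<in> A \<Longrightarrow> tens_homogeneous m (f a)) \<Longrightarrow> tens_homogeneous m (\<Sum>a\<in>A. f a)"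
  by (induction A rule: infinite_finite_induct) (simp_all add: tens_homogeneous_add)

lemma tens_homogeneous_const: "tens_homogeneous 0 (Poly_Mapping.single 0 c)"
  by (simp add: tens_homogeneous_def word_degree_def)

lemma tens_homogeneous_const_mult:
  "tens_homogeneous m p \<Longrightarrow> tens_homogeneous m (Poly_Mapping.single 0 c * p)"
  using tens_homogeneous_mult[OF tens_homogeneous_const] by fastforce

text \<open>Substituting a vector, which has degree 1, for each letter keeps the length of every
  word.\<close>

lemma tens_homogeneous_act:
  assumes "tens_homogeneous m p"
  shows "tens_homogeneous m (tens_act g p)"
proof -
  have *: "tens_homogeneous (int (length xs)) (prod_list (map (\<lambda>i. tens_vec (g *v axis i 1)) xs))" for xs
  proof (induction xs)
    case Nil
    show ?case using tens_homogeneous_const[of 1] by simp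
  next
    case (Cons i xs)
    have "tens_homogeneous 1 (tens_vec v)" for v :: "complex^'a"
      unfolding tens_vec_def
      by (intro tens_homogeneous_sum tens_homogeneous_single) (simp add: word_degree_def)
    from tens_homogeneous_mult[OF this Cons] show ?case by simp
  qed
  from assms have "Poly_Mapping.keys p \<subseteq> {w. int (word_degree w) = m}"
    by (auto simp: tens_homogeneous_def)
  then show ?thesis
  proof (induction p rule: poly_mapping_single_induct)
    case (single w c)
    then show ?case
      using *[of "letters w"]
      by (simp add: tens_act_def tens_homogeneous_const_mult word_degree_def)
  qed (simp_all add: alg_map_add[OF alg_map_tens_act] alg_map_zero[OF alg_map_tens_act] tens_homogeneous_add)
qed

(* Goals produced by rule and induction are eta-expanded, where these rules rewrite
   the zero function to a lambda term before rules about 0 apply. *)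
declare plus_fun_apply [simp del] zero_fun_apply [simp del] times_fun_apply [simp del]
  minus_apply [simp del] uminus_apply [simp del]

lemmas pointwise = fun_eq_iff plus_fun_apply zero_fun_apply minus_apply uminus_apply

section \<open>Polynomials in \<open>t\<close>\<close>

text \<open>Polynomials in t as coefficient sequences: \<open>mon i x\<close> is x t^i,
  \<open>tshift k\<close> is multiplication by t^k, and \<open>pset C\<close> consists of the
  polynomials with coefficients in the set \<open>C\<close>.\<close>

definition mon :: "nat \<Rightarrow> 'x::zero \<Rightarrow> nat \<Rightarrow> 'x" where
  "mon i x = (\<lambda>n. if n = i then x else 0)"

definition tshift :: "nat \<Rightarrow> (nat \<Rightarrow> 'x::zero) \<Rightarrow> nat \<Rightarrow> 'x" where
  "tshift k f = (\<lambda>n. if n < k then 0 else f (n - k))"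

definition pset :: "'x::zero set \<Rightarrow> (nat \<Rightarrow> 'x) set" where
  "pset C = {f. (\<forall>i. f i \<in> C) \<and> (\<exists>N. \<forall>i>N. f i = 0)}"

lemma mon_apply [simp]: "mon i x i = x"
  by (simp add: mon_def)

lemma mon_zero [simp]: "mon i 0 = 0"
  by (auto simp: mon_def pointwise)

lemma mon_add: "mon i (x + y) = mon i x + mon i (y :: 'x::monoid_add)"
  by (auto simp: mon_def pointwise)

lemma mon_diff: "mon i (x - y) = mon i x - mon i (y :: 'x::group_add)"
  by (auto simp: mon_def pointwise)

lemma mon_sum: "mon i (\<Sum>a\<in>A. f a) = (\<Sum>a\<in>A. mon i (f a))" for f :: "_ \<Rightarrow> 'x::comm_monoid_add"
  by (induction A rule: infinite_finite_induct) (auto simp: mon_add)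

lemma tshift_0 [simp]: "tshift 0 f = f"
  by (simp add: tshift_def)

lemma tshift_zero [simp]: "tshift k 0 = 0"
  by (auto simp: tshift_def pointwise)

lemma tshift_tshift: "tshift j (tshift k f) = tshift (j + k) f"
  by (auto simp: tshift_def fun_eq_iff diff_diff_left add.commute)

lemma tshift_mon [simp]: "tshift k (mon i x) = mon (k + i) x"
  by (auto simp: tshift_def mon_def fun_eq_iff)

lemma tshift_add: "tshift k (f + g) = tshift k f + tshift k (g :: nat \<Rightarrow> 'x::monoid_add)"
  by (auto simp: tshift_def pointwise)

lemma tshift_diff: "tshift k (f - g) = tshift k f - tshift k (g :: nat \<Rightarrow> 'x::group_add)"
  by (auto simp: tshift_def pointwise)

lemma pset_zero: "0 \<in> C \<Longrightarrow> 0 \<in> pset C"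
  by (simp add: pset_def pointwise)

lemma pset_mon: "0 \<in> C \<Longrightarrow> x \<in> C \<Longrightarrow> mon i x \<in> pset C"
  by (auto simp: pset_def mon_def intro: exI[of _ i])

lemma pset_tshift:
  assumes "0 \<in> C" "f \<in> pset C"
  shows "tshift k f \<in> pset C"
proof -
  from assms obtain N where "\<forall>i>N. f i = 0" "\<forall>i. f i \<in> C" by (auto simp: pset_def)
  then have "\<forall>i>N+k. tshift k f i = 0" "\<forall>i. tshift k f i \<in> C"
    using assms by (auto simp: tshift_def pointwise)
  then show ?thesis unfolding pset_def by blast
qed

lemma pset_add:
  fixes f g :: "nat \<Rightarrow> 'x::monoid_add"
  assumes "\<And>x y. x \<in> C \<Longrightarrow> y \<in> C \<Longrightarrow> x + y \<in> C" "f \<in> pset C" "g \<in> pset C"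
  shows "f + g \<in> pset C"
proof -
  from assms obtain N M where "\<forall>i>N. f i = 0" "\<forall>i>M. g i = 0" by (auto simp: pset_def)
  then have "\<forall>i>max N M. (f + g) i = 0" by (auto simp: pointwise)
  then show ?thesis using assms unfolding pset_def by (auto simp: pointwise intro!: exI[of _ "max N M"])
qed

lemma pset_induct [consumes 2, case_names zero add mon]:
  fixes f :: "nat \<Rightarrow> 'x::comm_monoid_add"
  assumes "f \<in> pset C" "0 \<in> C" "Q 0"
    and add: "\<And>f g. f \<in> pset C \<Longrightarrow> g \<in> pset C \<Longrightarrow> Q f \<Longrightarrow> Q g \<Longrightarrow> Q (f + g)"
    and mon: "\<And>i x. x \<in> C \<Longrightarrow> Q (mon i x)"
  shows "Q f"
proof -
  from assms(1) obtain N where N: "\<forall>i>N. f i = 0" and C: "\<forall>i. f i \<in> C" by (auto simp: pset_def)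
  \<comment> \<open>The truncations of \<open>f\<close> below degree k; k = N + 1 gives back
    \<open>f\<close>.\<close>
  have "(\<lambda>i. if i < k then f i else 0) \<in> pset C \<and> Q (\<lambda>i. if i < k then f i else 0)" for k
  proof (induction k)
    case 0
    have "(\<lambda>i. if i < 0 then f i else 0) = 0" by (simp add: pointwise)
    then show ?case using assms by (simp add: pset_zero)
  next
    case (Suc k)
    have eq: "(\<lambda>i. if i < Suc k then f i else 0) = (\<lambda>i. if i < k then f i else 0) + mon k (f k)"
      by (auto simp: mon_def less_Suc_eq pointwise)
    have "(\<lambda>i. if i < Suc k then f i else 0) \<in> pset C"
      using C assms(2) by (auto simp: pset_def intro: exI[of _ "Suc k"])
    moreover have "Q ((\<lambda>i. if i < k then f i else 0) + mon k (f k))"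
      using Suc C assms(2) by (intro add mon pset_mon) auto
    ultimately show ?case by (simp add: eq)
  qed
  moreover have "(\<lambda>i. if i < Suc N then f i else 0) = f"
    using N by (auto simp: fun_eq_iff)
  ultimately show ?thesis by metis
qed

section \<open>Scalar multiplication by C and by C[t]\<close>

type_synonym ('g, 'm) crossed = "'g \<Rightarrow>\<^sub>0 ('m \<Rightarrow>\<^sub>0 complex)"

definition csmult :: "complex \<Rightarrow> ('g, 'm::monoid_add) crossed \<Rightarrow> ('g, 'm) crossed" where
  "csmult c = Poly_Mapping.map (\<lambda>s. Poly_Mapping.single 0 c * s)"

lemma lookup_csmult [simp]:
  "Poly_Mapping.lookup (csmult c x) g = Poly_Mapping.single 0 c * Poly_Mapping.lookup x g"
  by (simp add: csmult_def Poly_Mapping.map.rep_eq when_def)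

lemma csmult_add: "csmult c (x + y) = csmult c x + csmult c y"
  by (rule poly_mapping_eqI) (simp add: lookup_add distrib_left)

lemma csmult_add_left: "csmult (c + d) x = csmult c x + csmult d x"
  by (rule poly_mapping_eqI) (simp add: lookup_add distrib_right single_add)

lemma csmult_zero [simp]: "csmult c 0 = 0" "csmult 0 x = 0"
  by (rule poly_mapping_eqI, simp)+

lemma csmult_one [simp]: "csmult 1 x = x"
  by (rule poly_mapping_eqI) simp

lemma csmult_minus_one: "csmult (- 1) x = - x"
  by (rule poly_mapping_eqI) (simp add: single_uminus)

lemma csmult_csmult: "csmult c (csmult d x) = csmult (c * d) x"
  by (rule poly_mapping_eqI) (simp add: const_mult_const)

lemma csmult_sum: "csmult c (\<Sum>a\<in>A. f a) = (\<Sum>a\<in>A. csmult c (f a))"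
  by (induction A rule: infinite_finite_induct) (simp_all add: csmult_add)

lemma csmult_single [simp]:
  "csmult c (Poly_Mapping.single g s) = Poly_Mapping.single g (Poly_Mapping.single 0 c * s)"
  by (rule poly_mapping_eqI) (simp add: lookup_single when_def)

lemma keys_csmult: "Poly_Mapping.keys (csmult c x) \<subseteq> Poly_Mapping.keys x"
  by (auto simp: in_keys_iff)

definition psc :: "complex \<Rightarrow> (nat \<Rightarrow> ('g, 'm::monoid_add) crossed) \<Rightarrow> nat \<Rightarrow> ('g, 'm) crossed" where
  "psc c f = (\<lambda>n. csmult c (f n))"

lemma psc_add: "psc c (f + g) = psc c f + psc c g"
  by (auto simp: psc_def csmult_add pointwise)

lemma psc_add_left: "psc (c + d) f = psc c f + psc d f"
  by (auto simp: psc_def csmult_add_left pointwise)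

lemma psc_zero [simp]: "psc c 0 = 0" "psc 0 f = 0"
  by (auto simp: psc_def pointwise)

lemma psc_one [simp]: "psc 1 f = f"
  by (simp add: psc_def)

lemma psc_psc: "psc c (psc d f) = psc (c * d) f"
  by (simp add: psc_def csmult_csmult)

lemma psc_mon [simp]: "psc c (mon i x) = mon i (csmult c x)"
  by (auto simp: psc_def mon_def pointwise)

lemma psc_tshift: "psc c (tshift k f) = tshift k (psc c f)"
  by (auto simp: psc_def tshift_def pointwise)

lemma psc_sum: "psc c (\<Sum>a\<in>A. f a) = (\<Sum>a\<in>A. psc c (f a))"
  by (induction A rule: infinite_finite_induct) (simp_all add: psc_add)

definition psmult :: "complex poly \<Rightarrow> (nat \<Rightarrow> ('g, 'm::monoid_add) crossed) \<Rightarrow> nat \<Rightarrow> ('g, 'm) crossed" where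
  "psmult p f = (\<lambda>n. \<Sum>i\<le>n. csmult (Polynomial.coeff p i) (f (n - i)))"

lemma psmult_0 [simp]: "psmult 0 f = 0"
  by (auto simp: psmult_def pointwise)

text \<open>Horner's scheme: multiplication by a polynomial is built from complex scalars and
  multiplication by t, so C[t]-linearity of an additive map need only be checked on these
  two.\<close>

lemma psmult_pCons: "psmult (pCons c p) f = psc c f + tshift (Suc 0) (psmult p f)"
proof
  fix n
  show "psmult (pCons c p) f n = (psc c f + tshift (Suc 0) (psmult p f)) n"
    by (cases n) (auto simp: pointwise psmult_def psc_def tshift_def coeff_pCons sum.atMost_Suc_shift simp del: sum.atMost_Suc)
qed

lemma psmult_closed:
  assumes "0 \<in> J" "f \<in> J" "\<And>f g. f \<in> J \<Longrightarrow> g \<in> J \<Longrightarrow> f + g \<in> J"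
    and "\<And>c f. f \<in> J \<Longrightarrow> psc c f \<in> J" "\<And>f. f \<in> J \<Longrightarrow> tshift (Suc 0) f \<in> J"
  shows "psmult p f \<in> J"
  by (induction p) (simp_all add: psmult_pCons assms)

text \<open>Horner's scheme stays inside \<open>J\<close>, so linearity of \<open>h\<close> is
  demanded only there. \<open>J\<close> will be the carrier of an algebra over C[t].\<close>

lemma psmult_commute:
  assumes "f \<in> J" "0 \<in> J" "\<And>f g. f \<in> J \<Longrightarrow> g \<in> J \<Longrightarrow> f + g \<in> J"
    and "\<And>c f. f \<in> J \<Longrightarrow> psc c f \<in> J" "\<And>f. f \<in> J \<Longrightarrow> tshift (Suc 0) f \<in> J"
    and "h 0 = 0" "\<And>f g. f \<in> J \<Longrightarrow> g \<in> J \<Longrightarrow> h (f + g) = h f + h g"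
    and "\<And>c f. f \<in> J \<Longrightarrow> h (psc c f) = psc c (h f)" "\<And>f. f \<in> J \<Longrightarrow> h (tshift (Suc 0) f) = tshift (Suc 0) (h f)"
  shows "h (psmult p f) = psmult p (h f)"
proof (induction p)
  case (pCons c p)
  have "psmult p f \<in> J" using assms by (intro psmult_closed) auto
  then show ?case using assms pCons by (simp only: psmult_pCons)
qed (simp add: assms)

section \<open>Crossed products\<close>

text \<open>T(V) and S(V) share this locale, so that crossed products, polynomials over them and
  quotients are treated once. The instances are \<open>tens_act\<close> and
  \<open>symm_act\<close>.\<close>

locale twisted_action = group \<Gamma> for \<Gamma> :: "('g, 'c) monoid_scheme" (structure) +
  fixes \<alpha> :: "'g \<Rightarrow> 'g \<Rightarrow> complex"
    and act :: "'g \<Rightarrow> ('m::monoid_add \<Rightarrow>\<^sub>0 complex) \<Rightarrow> ('m \<Rightarrow>\<^sub>0 complex)"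
  assumes finite_carrier: "finite (carrier \<Gamma>)"
    and cocycle: "normalized_cocycle \<Gamma> \<alpha>"
    and alg_map_act: "\<And>g. g \<in> carrier \<Gamma> \<Longrightarrow> alg_map (act g)"
    and act_mult: "\<And>g h p. g \<in> carrier \<Gamma> \<Longrightarrow> h \<in> carrier \<Gamma> \<Longrightarrow> act (g \<otimes> h) p = act g (act h p)"
    and act_one: "act \<one> p = p"
begin

abbreviation R :: "(complex, ('g, 'm) crossed) module" where
  "R \<equiv> crossed_product \<Gamma> \<alpha> act"

definition C :: "('g, 'm) crossed set" where
  "C = {x. Poly_Mapping.keys x \<subseteq> carrier \<Gamma>}"

text \<open>Summing over the whole group instead of the supports of \<open>x\<close> and
  \<open>y\<close> makes additivity in each argument a termwise matter. On the carrier it is the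
  product of the record, by \<open>crossed_mult\<close>.\<close>

definition cmul :: "('g, 'm) crossed \<Rightarrow> ('g, 'm) crossed \<Rightarrow> ('g, 'm) crossed" where
  "cmul x y = (\<Sum>g\<in>carrier \<Gamma>. \<Sum>h\<in>carrier \<Gamma>. Poly_Mapping.single (g \<otimes> h)
     (Poly_Mapping.single 0 (\<alpha> g h) * (Poly_Mapping.lookup x g * act g (Poly_Mapping.lookup y h))))"

lemma act_zero [simp]: "g \<in> carrier \<Gamma> \<Longrightarrow> act g 0 = 0"
  by (rule alg_map_zero[OF alg_map_act])

lemma act_add: "g \<in> carrier \<Gamma> \<Longrightarrow> act g (p + q) = act g p + act g q"
  by (rule alg_map_add[OF alg_map_act])

lemma C_zero [simp]: "0 \<in> C"
  by (simp add: C_def)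

lemma C_add: "x \<in> C \<Longrightarrow> y \<in> C \<Longrightarrow> x + y \<in> C"
  using keys_add by (fastforce simp: C_def)

lemma C_minus: "x \<in> C \<Longrightarrow> - x \<in> C"
  by (auto simp: C_def in_keys_iff)

lemma C_sum: "(\<And>a. a \<in> A \<Longrightarrow> f a \<in> C) \<Longrightarrow> (\<Sum>a\<in>A. f a) \<in> C"
  by (induction A rule: infinite_finite_induct) (simp_all add: C_add)

lemma C_single: "g \<in> carrier \<Gamma> \<Longrightarrow> Poly_Mapping.single g s \<in> C"
  by (simp add: C_def)

lemma C_csmult: "x \<in> C \<Longrightarrow> csmult c x \<in> C"
  using keys_csmult by (fastforce simp: C_def)

lemma C_induct [consumes 1, case_names zero add single]:
  assumes "x \<in> C" "Q 0"
    and "\<And>x y. x \<in> C \<Longrightarrow> y \<in> C \<Longrightarrow> Q x \<Longrightarrow> Q y \<Longrightarrow> Q (x + y)"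
    and "\<And>g k c. g \<in> carrier \<Gamma> \<Longrightarrow> Q (Poly_Mapping.single g (Poly_Mapping.single k c))"
  shows "Q x"
proof -
  from assms(1) have "Poly_Mapping.keys x \<subseteq> carrier \<Gamma>" by (simp add: C_def)
  then show ?thesis
  proof (induction x rule: poly_mapping_single_induct)
    case (single g p)
    show ?case
      by (induction p rule: poly_mapping_single_induct_UNIV)
        (use assms single C_single in \<open>simp_all add: single_add\<close>)
  qed (use assms in \<open>simp_all add: C_def\<close>)
qed

lemma cmul_closed: "cmul x y \<in> C"
  unfolding cmul_def by (intro C_sum C_single) auto

lemma cmul_add_left: "cmul (x + y) z = cmul x z + cmul y z"
  by (simp add: cmul_def lookup_add distrib_left distrib_right single_add sum.distrib)

lemma cmul_add_right: "cmul x (y + z) = cmul x y + cmul x z"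
  by (simp add: cmul_def lookup_add distrib_left distrib_right single_add sum.distrib act_add)

lemma cmul_zero [simp]: "cmul 0 x = 0" "cmul x 0 = 0"
  by (simp_all add: cmul_def)

lemma cmul_single:
  assumes "g \<in> carrier \<Gamma>" "h \<in> carrier \<Gamma>"
  shows "cmul (Poly_Mapping.single g p) (Poly_Mapping.single h q) =
    Poly_Mapping.single (g \<otimes> h) (Poly_Mapping.single 0 (\<alpha> g h) * (p * act g q))"
proof -
  have "cmul (Poly_Mapping.single g p) (Poly_Mapping.single h q) =
      (\<Sum>g'\<in>carrier \<Gamma>. if g' = g then (\<Sum>h'\<in>carrier \<Gamma>. if h' = h then
        Poly_Mapping.single (g \<otimes> h) (Poly_Mapping.single 0 (\<alpha> g h) * (p * act g q)) else 0) else 0)"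
    unfolding cmul_def by (intro sum.cong refl) (auto simp: lookup_single when_def intro!: sum.neutral sum.cong)
  then show ?thesis using assms finite_carrier by simp
qed

lemma crossed_mult: "x \<in> C \<Longrightarrow> y \<in> C \<Longrightarrow> x \<otimes>\<^bsub>R\<^esub> y = cmul x y"
proof -
  assume *: "x \<in> C" "y \<in> C"
  have "(\<Sum>g\<in>Poly_Mapping.keys x. \<Sum>h\<in>Poly_Mapping.keys y. Poly_Mapping.single (g \<otimes> h)
     (Poly_Mapping.single 0 (\<alpha> g h) * (Poly_Mapping.lookup x g * act g (Poly_Mapping.lookup y h)))) =
     (\<Sum>g\<in>carrier \<Gamma>. \<Sum>h\<in>Poly_Mapping.keys y. Poly_Mapping.single (g \<otimes> h)
     (Poly_Mapping.single 0 (\<alpha> g h) * (Poly_Mapping.lookup x g * act g (Poly_Mapping.lookup y h))))"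
    using * finite_carrier by (intro sum.mono_neutral_left) (auto simp: C_def in_keys_iff)
  also have "\<dots> = cmul x y"
    unfolding cmul_def using * finite_carrier
    by (intro sum.cong refl sum.mono_neutral_left) (auto simp: C_def in_keys_iff)
  finally show ?thesis by (simp add: crossed_product_def)
qed

lemma crossed_simps [simp]:
  "carrier R = C" "\<zero>\<^bsub>R\<^esub> = 0" "\<one>\<^bsub>R\<^esub> = Poly_Mapping.single \<one> 1" "x \<oplus>\<^bsub>R\<^esub> y = x + y"
  "c \<odot>\<^bsub>R\<^esub> x = csmult c x"
  by (simp_all add: crossed_product_def C_def csmult_def)

lemma cocycle_simps:
  "g \<in> carrier \<Gamma> \<Longrightarrow> h \<in> carrier \<Gamma> \<Longrightarrow> k \<in> carrier \<Gamma> \<Longrightarrow> \<alpha> g h * \<alpha> (g \<otimes> h) k = \<alpha> h k * \<alpha> g (h \<otimes> k)"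
  "g \<in> carrier \<Gamma> \<Longrightarrow> \<alpha> \<one> g = 1" "g \<in> carrier \<Gamma> \<Longrightarrow> \<alpha> g \<one> = 1"
  using cocycle by (auto simp: normalized_cocycle_def)

text \<open>By additivity only single terms matter. For these the scalars agree by the cocycle
  identity, and the remaining factors agree because each \<open>act g\<close> is an algebra map and
  \<open>act\<close> is compatible with the group product.\<close>

lemma cmul_assoc:
  assumes "x \<in> C" "y \<in> C" "z \<in> C"
  shows "cmul (cmul x y) z = cmul x (cmul y z)"
  using assms(1)
proof (induction x rule: C_induct)
  case (single g k c)
  note g = this
  show ?case using assms(2)
  proof (induction y rule: C_induct)
    case (single h l d)
    note h = this
    show ?case using assms(3)
    proof (induction z rule: C_induct)
      case (single i m e)
      let ?p = "Poly_Mapping.single k c" and ?q = "Poly_Mapping.single l d" and ?r = "Poly_Mapping.single m e"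
      have "cmul (cmul (Poly_Mapping.single g ?p) (Poly_Mapping.single h ?q)) (Poly_Mapping.single i ?r) =
        Poly_Mapping.single (g \<otimes> h \<otimes> i) (Poly_Mapping.single 0 (\<alpha> g h * \<alpha> (g \<otimes> h) i) * (?p * (act g ?q * act g (act h ?r))))"
        using g h single
        by (simp add: cmul_single act_mult const_mult_const mult.assoc mult.commute[of "\<alpha> (g \<otimes> h) i"])
      also have "\<dots> = cmul (Poly_Mapping.single g ?p) (cmul (Poly_Mapping.single h ?q) (Poly_Mapping.single i ?r))"
        using g h single
        by (simp add: cmul_single cocycle_simps alg_map_mult[OF alg_map_act] alg_map_const[OF alg_map_act]
            const_left_commute[of ?p] const_mult_const m_assoc mult.commute[of "\<alpha> g (h \<otimes> i)"])
      finally show ?case .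
    qed (simp_all add: cmul_add_right)
  qed (simp_all add: cmul_add_left cmul_add_right)
qed (simp_all add: cmul_add_left)

text \<open>The cocycle is normalized, so c times the identity of the group multiplies as the scalar
  c; the same holds from the right. The case c = 1 gives the unit.\<close>

lemma cmul_const_left:
  assumes "x \<in> C"
  shows "cmul (Poly_Mapping.single \<one> (Poly_Mapping.single 0 c)) x = csmult c x"
  using assms
  by (induction x rule: C_induct)
    (simp_all add: cmul_add_right csmult_add cmul_single cocycle_simps act_one)

lemma cmul_const_right:
  assumes "x \<in> C"
  shows "cmul x (Poly_Mapping.single \<one> (Poly_Mapping.single 0 c)) = csmult c x"
  using assms
  by (induction x rule: C_induct)
    (simp_all add: cmul_add_left csmult_add cmul_single cocycle_simps alg_map_const[OF alg_map_act]
      const_central)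

lemma cmul_one:
  assumes "x \<in> C"
  shows "cmul (Poly_Mapping.single \<one> 1) x = x" "cmul x (Poly_Mapping.single \<one> 1) = x"
  using cmul_const_left[OF assms, of 1] cmul_const_right[OF assms, of 1] by simp_all

text \<open>Scalars are products with a central element, so both claims are instances of
  associativity.\<close>

lemma cmul_csmult:
  assumes "x \<in> C" "y \<in> C"
  shows "cmul (csmult c x) y = csmult c (cmul x y)" "cmul x (csmult c y) = csmult c (cmul x y)"
  using assms C_single[OF one_closed] cmul_closed
  by (metis cmul_assoc cmul_const_left, metis cmul_assoc cmul_const_left cmul_const_right)

lemma ring_crossed: "ring R"
proof (rule ringI)
  show "abelian_group R"
    by (rule abelian_groupI) (auto simp: C_add add_ac intro: bexI[OF _ C_minus])
  show "Group.monoid R"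
    by (rule monoidI) (auto simp: crossed_mult cmul_closed C_single cmul_one cmul_assoc)
qed (auto simp: crossed_mult C_add cmul_add_left cmul_add_right)

lemma finsum_crossed: "(\<And>a. a \<in> A \<Longrightarrow> f a \<in> C) \<Longrightarrow> finsum R f A = (\<Sum>a\<in>A. f a)"
proof (induction A rule: infinite_finite_induct)
  case (insert a A)
  interpret R: ring R by (rule ring_crossed)
  show ?case using insert by (subst R.finsum_insert) auto
next
  case (infinite A)
  interpret R: ring R by (rule ring_crossed)
  show ?case using infinite by (simp add: R.finsum_infinite)
next
  case empty
  interpret R: ring R by (rule ring_crossed)
  show ?case by simp
qed

section \<open>The polynomial ring over the crossed product\<close>

abbreviation P :: "(complex poly, nat \<Rightarrow> ('g, 'm) crossed) module" where
  "P \<equiv> poly_ext R"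

definition pmul :: "(nat \<Rightarrow> ('g, 'm) crossed) \<Rightarrow> (nat \<Rightarrow> ('g, 'm) crossed) \<Rightarrow> nat \<Rightarrow> ('g, 'm) crossed" where
  "pmul f g = (\<lambda>n. \<Sum>i\<le>n. cmul (f i) (g (n - i)))"

lemma up_crossed: "up R = pset C"
  by (auto simp: up_def pset_def bound_def Pi_def)

lemma pset_C_closed [simp, intro]:
  "0 \<in> pset C" "x \<in> C \<Longrightarrow> mon i x \<in> pset C" "f \<in> pset C \<Longrightarrow> tshift k f \<in> pset C"
  "f \<in> pset C \<Longrightarrow> g \<in> pset C \<Longrightarrow> f + g \<in> pset C"
  by (auto intro: pset_zero pset_mon pset_tshift pset_add C_add)

lemma pset_C_induct [consumes 1, case_names zero add mon]:
  assumes "f \<in> pset C" "Q 0"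
    and "\<And>f g. f \<in> pset C \<Longrightarrow> g \<in> pset C \<Longrightarrow> Q f \<Longrightarrow> Q g \<Longrightarrow> Q (f + g)"
    and "\<And>i x. x \<in> C \<Longrightarrow> Q (mon i x)"
  shows "Q f"
  using pset_induct[OF assms(1) C_zero] assms(2-) by blast

lemma pset_C_psc [simp, intro]: "f \<in> pset C \<Longrightarrow> psc c f \<in> pset C"
  by (fastforce simp: pset_def psc_def C_csmult)

lemma pset_C_minus [simp, intro]: "f \<in> pset C \<Longrightarrow> - f \<in> pset C"
  by (auto simp: pset_def C_minus uminus_apply)

lemma pset_C_diff [simp, intro]: "f \<in> pset C \<Longrightarrow> g \<in> pset C \<Longrightarrow> f - g \<in> pset C"
  using pset_C_closed(4)[of f "- g"] by simp

lemma pset_C_sum: "(\<And>a. a \<in> A \<Longrightarrow> f a \<in> pset C) \<Longrightarrow> (\<Sum>a\<in>A. f a) \<in> pset C"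
  by (induction A rule: infinite_finite_induct) auto

lemma pset_C_psmult: "f \<in> pset C \<Longrightarrow> psmult p f \<in> pset C"
  by (rule psmult_closed) auto

lemma pset_CD: "f \<in> pset C \<Longrightarrow> f i \<in> C"
  by (simp add: pset_def)

lemma pmul_add_left: "pmul (f + g) h = pmul f h + pmul g h"
  by (auto simp: pmul_def cmul_add_left sum.distrib pointwise)

lemma pmul_add_right: "pmul f (g + h) = pmul f g + pmul f h"
  by (auto simp: pmul_def cmul_add_right sum.distrib pointwise)

lemma pmul_zero [simp]: "pmul 0 f = 0" "pmul f 0 = 0"
  by (auto simp: pmul_def pointwise)

lemma pmul_diff_left: "pmul (f - g) h = pmul f h - pmul g h"
  by (metis pmul_add_left diff_add_cancel eq_diff_eq)

lemma pmul_diff_right: "pmul f (g - h) = pmul f g - pmul f h"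
  by (metis pmul_add_right diff_add_cancel eq_diff_eq)

lemma pmul_mon: "pmul (mon i x) (mon j y) = mon (i + j) (cmul x y)"
proof
  fix n
  have "pmul (mon i x) (mon j y) n = (\<Sum>k\<le>n. if k = i then (if n = i + j then cmul x y else 0) else 0)"
    unfolding pmul_def by (intro sum.cong refl) (auto simp: mon_def)
  then show "pmul (mon i x) (mon j y) n = mon (i + j) (cmul x y) n"
    by (auto simp: mon_def pointwise)
qed

lemma pmul_closed [simp, intro]:
  assumes "f \<in> pset C" "g \<in> pset C"
  shows "pmul f g \<in> pset C"
  using assms(1)
proof (induction f rule: pset_C_induct)
  case (mon i x)
  show ?case using assms(2)
    by (induction g rule: pset_C_induct)
      (auto simp: pmul_add_right pmul_mon cmul_closed)
qed (auto simp: pmul_add_left)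

lemma P_simps [simp]:
  "carrier P = pset C" "\<zero>\<^bsub>P\<^esub> = 0" "\<one>\<^bsub>P\<^esub> = mon 0 (Poly_Mapping.single \<one> 1)"
  by (auto simp: poly_ext_def UP_def up_crossed mon_def pointwise)

lemma P_add: "f \<in> pset C \<Longrightarrow> g \<in> pset C \<Longrightarrow> f \<oplus>\<^bsub>P\<^esub> g = f + g"
  by (auto simp: poly_ext_def UP_def up_crossed pointwise)

lemma P_mult: "f \<in> pset C \<Longrightarrow> g \<in> pset C \<Longrightarrow> f \<otimes>\<^bsub>P\<^esub> g = pmul f g"
  by (simp add: poly_ext_def UP_def up_crossed pmul_def crossed_mult pset_CD finsum_crossed cmul_closed)

lemma P_smult: "f \<in> pset C \<Longrightarrow> p \<odot>\<^bsub>P\<^esub> f = psmult p f"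
  by (simp add: poly_ext_def psmult_def finsum_crossed pset_CD C_csmult)

lemma monom_UP: "x \<in> C \<Longrightarrow> monom (UP R) x i = mon i x"
  by (simp add: UP_def mon_def cong: if_cong)

lemma ring_UP: "ring (UP R)"
  by (intro UP_ring.UP_ring UP_ring.intro ring_crossed)

text \<open>\<open>poly_ext R\<close> has the ring operations of \<open>UP R\<close> and differs in
  the scalars only, so the ring axioms are carried over one by one.\<close>

lemma ring_P: "ring P"
proof -
  interpret U: ring "UP R" by (rule ring_UP)
  have eq: "carrier P = carrier (UP R)" "add P = add (UP R)" "mult P = mult (UP R)" "one P = one (UP R)"
    "zero P = zero (UP R)"
    by (simp_all add: poly_ext_def)
  show ?thesis
  proof (rule ringI)
    show "abelian_group P"
      by (rule abelian_groupI) (unfold eq, auto simp: U.a_ac intro: bexI[OF _ U.a_inv_closed] U.l_neg)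
    show "Group.monoid P"
      by (rule monoidI) (unfold eq, auto simp: U.m_assoc)
  qed (unfold eq, auto simp: U.l_distr U.r_distr)
qed

lemma UP_minus:
  assumes "f \<in> pset C" "g \<in> pset C"
  shows "f \<ominus>\<^bsub>UP R\<^esub> g = f - g"
proof -
  interpret U: ring "UP R" by (rule ring_UP)
  have c: "carrier (UP R) = pset C" by (simp add: UP_def up_crossed)
  have a: "x \<oplus>\<^bsub>UP R\<^esub> y = x + y" if "x \<in> pset C" "y \<in> pset C" for x y
    using that by (auto simp: UP_def up_crossed pointwise)
  have "\<ominus>\<^bsub>UP R\<^esub> g = - g"
    using assms by (intro U.minus_equality) (auto simp: c a, simp add: UP_def zero_fun_def)
  then show ?thesis using assms by (simp add: a_minus_def a)
qed

section \<open>Ideals of the polynomial ring and their quotients\<close>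

lemma pmul_tscalar:
  assumes "f \<in> pset C"
  shows "pmul (mon k (Poly_Mapping.single \<one> (Poly_Mapping.single 0 c))) f = tshift k (psc c f)"
    and "pmul f (mon k (Poly_Mapping.single \<one> (Poly_Mapping.single 0 c))) = tshift k (psc c f)"
  using assms
  by (induction f rule: pset_C_induct)
   (auto simp: pmul_add_left pmul_add_right pmul_mon tshift_add psc_add cmul_const_left cmul_const_right add.commute)

text \<open>c t^k is itself an element of the ring and acts as that scalar from both sides. An ideal
  is therefore automatically a C[t]-submodule; negation is the case c = -1.\<close>

lemma ideal_closed:
  assumes "ideal I P"
  shows "I \<subseteq> pset C" "0 \<in> I" "f \<in> I \<Longrightarrow> g \<in> I \<Longrightarrow> f + g \<in> I" "f \<in> I \<Longrightarrow> g \<in> I \<Longrightarrow> f - g \<in> I" "f \<in> I \<Longrightarrow> - f \<in> I"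
    "f \<in> I \<Longrightarrow> g \<in> pset C \<Longrightarrow> pmul f g \<in> I" "f \<in> I \<Longrightarrow> g \<in> pset C \<Longrightarrow> pmul g f \<in> I"
    "f \<in> I \<Longrightarrow> psc c f \<in> I" "f \<in> I \<Longrightarrow> tshift k f \<in> I" "f \<in> I \<Longrightarrow> psmult p f \<in> I"
proof -
  interpret I: ideal I P by fact
  show sub: "I \<subseteq> pset C" using I.a_subset by simp
  show zero: "0 \<in> I" using additive_subgroup.zero_closed[OF ideal.axioms(1)[OF assms]] by simp
  show add: "f + g \<in> I" if "f \<in> I" "g \<in> I" for f g
    using additive_subgroup.a_closed[OF ideal.axioms(1)[OF assms] that] that sub by (simp add: P_add subsetD)
  show l: "pmul f g \<in> I" if "f \<in> I" "g \<in> pset C" for f g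
    using I.I_r_closed[of f g] that sub by (simp add: P_mult subsetD)
  show "pmul g f \<in> I" if "f \<in> I" "g \<in> pset C" for f g
    using I.I_l_closed[of f g] that sub by (simp add: P_mult subsetD)
  have sc: "tshift k (psc c f) \<in> I" if "f \<in> I" for f k c
    using l[OF that, of "mon k (Poly_Mapping.single \<one> (Poly_Mapping.single 0 c))"] that sub
    by (simp add: pmul_tscalar subsetD C_single)
  show psc: "psc c f \<in> I" if "f \<in> I" for f c using sc[OF that, of 0] by simp
  show tsh: "tshift k f \<in> I" if "f \<in> I" for f k using sc[OF that, of k 1] by simp
  show neg: "- f \<in> I" if "f \<in> I" for f
  proof -
    have "psc (- 1) f = - f" by (auto simp: psc_def csmult_minus_one pointwise)
    then show ?thesis using psc[OF that, of "- 1"] by simp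
  qed
  show "f - g \<in> I" if "f \<in> I" "g \<in> I" for f g
    using add[OF that(1) neg[OF that(2)]] by simp
  show "psmult p f \<in> I" if "f \<in> I" for f
    using that zero add psc tsh by (intro psmult_closed) auto
qed

lemma ideal_P_I:
  assumes "I \<subseteq> pset C" "0 \<in> I" "\<And>f g. f \<in> I \<Longrightarrow> g \<in> I \<Longrightarrow> f + g \<in> I" "\<And>f. f \<in> I \<Longrightarrow> - f \<in> I"
    "\<And>f g. f \<in> I \<Longrightarrow> g \<in> pset C \<Longrightarrow> pmul f g \<in> I" "\<And>f g. f \<in> I \<Longrightarrow> g \<in> pset C \<Longrightarrow> pmul g f \<in> I"
  shows "ideal I P"
proof -
  interpret P: ring P by (rule ring_P)
  have neg: "\<ominus>\<^bsub>P\<^esub> f = - f" if "f \<in> pset C" for f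
    using that by (intro P.minus_equality) (auto simp: P_add)
  show ?thesis
  proof (rule idealI[OF ring_P])
    show "subgroup I (add_monoid P)"
      using assms by (intro P.add.subgroupI) (auto simp: P_add neg subsetD simp flip: a_inv_def)
  qed (use assms in \<open>auto simp: P_mult subsetD\<close>)
qed

lemma coset_P: "I \<subseteq> pset C \<Longrightarrow> f \<in> pset C \<Longrightarrow> I +>\<^bsub>P\<^esub> f = (\<lambda>i. i + f) ` I"
  by (auto simp: a_r_coset_def' P_add subsetD)

lemma coset_eq_iff:
  assumes "ideal I P" "f \<in> pset C" "g \<in> pset C"
  shows "I +>\<^bsub>P\<^esub> f = I +>\<^bsub>P\<^esub> g \<longleftrightarrow> f - g \<in> I"
proof -
  note I = ideal_closed[OF assms(1)]
  show ?thesis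
    unfolding coset_P[OF I(1) assms(2)] coset_P[OF I(1) assms(3)]
  proof
    assume *: "(\<lambda>i. i + f) ` I = (\<lambda>i. i + g) ` I"
    have "f \<in> (\<lambda>i. i + f) ` I" using I(2) by force
    then show "f - g \<in> I" unfolding * by auto
  next
    assume d: "f - g \<in> I"
    have "i + f \<in> (\<lambda>i. i + g) ` I" if "i \<in> I" for i
      using I(3)[OF that d] by (intro image_eqI[of _ _ "i + (f - g)"]) (simp_all add: algebra_simps)
    moreover have "i + g \<in> (\<lambda>i. i + f) ` I" if "i \<in> I" for i
      using I(4)[OF that d] by (intro image_eqI[of _ _ "i - (f - g)"]) (simp_all add: algebra_simps)
    ultimately show "(\<lambda>i. i + f) ` I = (\<lambda>i. i + g) ` I" by blast
  qed
qed

lemma quot_alg_simps: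
  assumes "ideal I P"
  shows "carrier (quot_alg P I) = (\<lambda>f. I +>\<^bsub>P\<^esub> f) ` pset C"
    and "\<one>\<^bsub>quot_alg P I\<^esub> = I +>\<^bsub>P\<^esub> mon 0 (Poly_Mapping.single \<one> 1)"
    and "f \<in> pset C \<Longrightarrow> g \<in> pset C \<Longrightarrow> (I +>\<^bsub>P\<^esub> f) \<oplus>\<^bsub>quot_alg P I\<^esub> (I +>\<^bsub>P\<^esub> g) = I +>\<^bsub>P\<^esub> (f + g)"
    and "f \<in> pset C \<Longrightarrow> g \<in> pset C \<Longrightarrow> (I +>\<^bsub>P\<^esub> f) \<otimes>\<^bsub>quot_alg P I\<^esub> (I +>\<^bsub>P\<^esub> g) = I +>\<^bsub>P\<^esub> (pmul f g)"
    and "f \<in> pset C \<Longrightarrow> p \<odot>\<^bsub>quot_alg P I\<^esub> (I +>\<^bsub>P\<^esub> f) = I +>\<^bsub>P\<^esub> psmult p f"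
proof -
  interpret I: ideal I P by fact
  note cl = ideal_closed[OF assms]
  show "carrier (quot_alg P I) = (\<lambda>f. I +>\<^bsub>P\<^esub> f) ` pset C"
    by (auto simp: quot_alg_def FactRing_def A_RCOSETS_def')
  show "\<one>\<^bsub>quot_alg P I\<^esub> = I +>\<^bsub>P\<^esub> mon 0 (Poly_Mapping.single \<one> 1)"
    by (simp add: quot_alg_def FactRing_def)
  show "(I +>\<^bsub>P\<^esub> f) \<oplus>\<^bsub>quot_alg P I\<^esub> (I +>\<^bsub>P\<^esub> g) = I +>\<^bsub>P\<^esub> (f + g)" if "f \<in> pset C" "g \<in> pset C"
    using I.a_rcos_sum[of f g] that by (simp add: quot_alg_def FactRing_simps P_add)
  show "(I +>\<^bsub>P\<^esub> f) \<otimes>\<^bsub>quot_alg P I\<^esub> (I +>\<^bsub>P\<^esub> g) = I +>\<^bsub>P\<^esub> (pmul f g)" if "f \<in> pset C" "g \<in> pset C"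
    using I.rcoset_mult_add[of f g] that by (simp add: quot_alg_def FactRing_simps P_mult)
  show "p \<odot>\<^bsub>quot_alg P I\<^esub> (I +>\<^bsub>P\<^esub> f) = I +>\<^bsub>P\<^esub> psmult p f" if f: "f \<in> pset C"
  proof -
    \<comment> \<open>All representatives yield the same coset, so the union in the scalar
      multiplication of \<open>quot_alg\<close> collapses to a single coset.\<close>
    have "I +>\<^bsub>P\<^esub> (p \<odot>\<^bsub>P\<^esub> x) = I +>\<^bsub>P\<^esub> psmult p f" if "x \<in> I +>\<^bsub>P\<^esub> f" for x
    proof -
      from that obtain i where i: "i \<in> I" "x = i + f" using f cl(1) by (auto simp: coset_P)
      then have ip: "i \<in> pset C" using cl by blast
      have "psmult p (i + f) = psmult p i + psmult p f"
        by (auto simp: psmult_def csmult_add sum.distrib pointwise)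
      then show ?thesis
        using i ip f cl(10)[OF i(1)] by (simp add: P_smult coset_eq_iff[OF assms] pset_C_psmult)
    qed
    moreover have "f \<in> I +>\<^bsub>P\<^esub> f" using f cl(1,2) by (force simp: coset_P)
    ultimately show ?thesis by (auto simp: quot_alg_def)
  qed
qed

end

context twisted_action
begin

lemma finsum_UP:
  assumes "finite A" "\<And>a. a \<in> A \<Longrightarrow> f a \<in> pset C"
  shows "finsum (UP R) f A = (\<Sum>a\<in>A. f a)"
  using assms
proof (induction A rule: finite_induct)
  case (insert a A)
  interpret U: ring "UP R" by (rule ring_UP)
  have "carrier (UP R) = pset C" by (simp add: UP_def up_crossed)
  moreover have "x \<oplus>\<^bsub>UP R\<^esub> y = x + y" if "x \<in> pset C" "y \<in> pset C" for x y
    using that by (auto simp: UP_def up_crossed pointwise)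
  moreover have "(\<Sum>a\<in>A. f a) \<in> pset C" by (rule pset_C_sum) (simp add: insert)
  ultimately show ?case using insert by (subst U.finsum_insert) auto
next
  case empty
  interpret U: ring "UP R" by (rule ring_UP)
  show ?case by (simp add: U.finsum_empty) (simp add: UP_def zero_fun_def)
qed

lemma UP_mult: "f \<in> pset C \<Longrightarrow> g \<in> pset C \<Longrightarrow> f \<otimes>\<^bsub>UP R\<^esub> g = pmul f g"
  using P_mult by (simp add: poly_ext_def)

end

lemma lookup_poly_mapping_map: "F 0 = 0 \<Longrightarrow> Poly_Mapping.lookup (Poly_Mapping.map F x) g = F (Poly_Mapping.lookup x g)"
  by (simp add: Poly_Mapping.map.rep_eq when_def)

lemma poly_mapping_map_zero [simp]: "Poly_Mapping.map F 0 = 0"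
  by (rule poly_mapping_eqI) (simp add: Poly_Mapping.map.rep_eq)

lemma poly_mapping_map_add:
  assumes "F 0 = 0" "\<And>p q. F (p + q) = F p + F q"
  shows "Poly_Mapping.map F (x + y) = Poly_Mapping.map F x + Poly_Mapping.map F y"
  by (rule poly_mapping_eqI) (simp add: lookup_poly_mapping_map assms lookup_add)

lemma keys_poly_mapping_map: "Poly_Mapping.keys (Poly_Mapping.map F x) \<subseteq> Poly_Mapping.keys x"
  by (auto simp: in_keys_iff Poly_Mapping.map.rep_eq when_def)

section \<open>The Hecke quotient\<close>

lemma group_GL: "group GL"
proof (rule groupI)
  fix x :: "complex^'n^'n" assume "x \<in> carrier GL"
  then obtain y where "x ** y = mat 1" "y ** x = mat 1"
    by (auto simp: GL_def invertible_def)
  then show "\<exists>y\<in>carrier GL. y \<otimes>\<^bsub>GL\<^esub> x = \<one>\<^bsub>GL\<^esub>"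
    by (auto simp: GL_def invertible_def)
next
  show "\<one>\<^bsub>GL\<^esub> \<in> carrier (GL :: (complex^'n^'n) monoid)"
    by (auto simp: GL_def invertible_def intro!: exI[of _ "mat 1"])
qed (auto simp: GL_def invertible_mult matrix_mul_assoc)

locale hecke_setup =
  fixes G :: "(complex^'n^'n) set"
    and \<alpha> :: "complex^'n^'n \<Rightarrow> complex^'n^'n \<Rightarrow> complex"
  assumes subgroup_G: "subgroup G GL" and finite_G: "finite G"
    and cocycle_G: "normalized_cocycle (GL\<lparr>carrier := G\<rparr>) \<alpha>"
begin

lemma group_G: "group (GL\<lparr>carrier := G\<rparr>)"
  using subgroup.subgroup_is_group[OF subgroup_G group_GL] .

sublocale T: twisted_action "GL\<lparr>carrier := G\<rparr>" \<alpha> tens_act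
  rewrites "carrier (GL\<lparr>carrier := G\<rparr>) = G"
    and "mult (GL\<lparr>carrier := G\<rparr>) = (**)"
    and "one (GL\<lparr>carrier := G\<rparr>) = mat 1"
    and "crossed_product (GL\<lparr>carrier := G\<rparr>) \<alpha> tens_act = tens_crossed G \<alpha>"
proof -
  show "twisted_action (GL\<lparr>carrier := G\<rparr>) \<alpha> tens_act"
    by (intro twisted_action.intro twisted_action_axioms.intro group_G cocycle_G)
      (simp_all add: finite_G alg_map_tens_act GL_def tens_act_mult tens_act_one)
qed (simp_all add: GL_def tens_crossed_def)

sublocale S: twisted_action "GL\<lparr>carrier := G\<rparr>" \<alpha> symm_act
  rewrites "carrier (GL\<lparr>carrier := G\<rparr>) = G"
    and "mult (GL\<lparr>carrier := G\<rparr>) = (**)"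
    and "one (GL\<lparr>carrier := G\<rparr>) = mat 1"
    and "crossed_product (GL\<lparr>carrier := G\<rparr>) \<alpha> symm_act = symm_crossed G \<alpha>"
proof -
  show "twisted_action (GL\<lparr>carrier := G\<rparr>) \<alpha> symm_act"
    by (intro twisted_action.intro twisted_action_axioms.intro group_G cocycle_G)
      (simp_all add: finite_G alg_map_symm_act GL_def symm_act_mult symm_act_one)
qed (simp_all add: GL_def symm_crossed_def)

section \<open>Gradings of the two crossed products\<close>

abbreviation S_comp :: "int \<Rightarrow> (complex^'n^'n \<Rightarrow>\<^sub>0 'n symm) set" where
  "S_comp \<equiv> symm_crossed_component G"

text \<open>Degrees are integers because corrections lower them by 2. A component of negative degree
  is zero (\<open>T_comp_neg\<close>), which is what ends the reductions.\<close>

definition T_comp :: "int \<Rightarrow> (complex^'n^'n \<Rightarrow>\<^sub>0 'n tens) set" where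
  "T_comp m = {x\<in>T.C. \<forall>g. tens_homogeneous m (Poly_Mapping.lookup x g)}"

lemma T_comp_zero [simp]: "0 \<in> T_comp m"
  by (simp add: T_comp_def)

lemma T_comp_add: "x \<in> T_comp m \<Longrightarrow> y \<in> T_comp m \<Longrightarrow> x + y \<in> T_comp m"
  by (simp add: T_comp_def T.C_add lookup_add tens_homogeneous_add)

lemma T_comp_minus: "x \<in> T_comp m \<Longrightarrow> - x \<in> T_comp m"
  by (auto simp: T_comp_def T.C_minus tens_homogeneous_def in_keys_iff)

lemma T_comp_sum: "(\<And>a. a \<in> A \<Longrightarrow> f a \<in> T_comp m) \<Longrightarrow> (\<Sum>a\<in>A. f a) \<in> T_comp m"
  by (induction A rule: infinite_finite_induct) (simp_all add: T_comp_add)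

lemma T_comp_single: "g \<in> G \<Longrightarrow> tens_homogeneous m p \<Longrightarrow> Poly_Mapping.single g p \<in> T_comp m"
  by (simp add: T_comp_def T.C_single lookup_single when_def)

lemma T_compD: "x \<in> T_comp m \<Longrightarrow> x \<in> T.C"
  by (simp add: T_comp_def)

lemma T_comp_neg:
  assumes "x \<in> T_comp m" "m < 0"
  shows "x = 0"
proof (rule poly_mapping_eqI)
  fix g
  show "Poly_Mapping.lookup (x :: _ \<Rightarrow>\<^sub>0 'n tens) g = Poly_Mapping.lookup 0 g"
    using assms by (intro poly_mapping_eqI) (fastforce simp: T_comp_def tens_homogeneous_def in_keys_iff)
qed

lemma T_comp_induct [consumes 1, case_names zero add single]:
  assumes "x \<in> T_comp m" "Q 0"
    and "\<And>x y. x \<in> T_comp m \<Longrightarrow> y \<in> T_comp m \<Longrightarrow> Q x \<Longrightarrow> Q y \<Longrightarrow> Q (x + y)"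
    and "\<And>g w c. g \<in> G \<Longrightarrow> int (word_degree w) = m \<Longrightarrow> Q (Poly_Mapping.single g (Poly_Mapping.single w c))"
  shows "Q x"
proof -
  have s: "Poly_Mapping.single g p \<in> T_comp m \<and> Q (Poly_Mapping.single g p)"
    if "g \<in> G" "tens_homogeneous m p" for g p
  proof -
    from that have "Poly_Mapping.keys p \<subseteq> {w. int (word_degree w) = m}"
      by (auto simp: tens_homogeneous_def)
    then show ?thesis
      by (induction p rule: poly_mapping_single_induct)
        (use that assms in \<open>simp_all add: single_add T_comp_add T_comp_single tens_homogeneous_single\<close>)
  qed
  have "(\<Sum>g\<in>A. Poly_Mapping.single g (Poly_Mapping.lookup x g)) \<in> T_comp m \<and>
      Q (\<Sum>g\<in>A. Poly_Mapping.single g (Poly_Mapping.lookup x g))" if "finite A" "A \<subseteq> G" for A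
    using that
  proof (induction A rule: finite_induct)
    case (insert g A)
    have "Poly_Mapping.single g (Poly_Mapping.lookup x g) \<in> T_comp m \<and> Q (Poly_Mapping.single g (Poly_Mapping.lookup x g))"
      using insert assms(1) by (intro s) (auto simp: T_comp_def)
    then show ?case using insert assms(3) by (simp add: T_comp_add)
  qed (use assms in auto)
  from this[of G] show ?thesis
    using assms(1) by (simp add: finite_G poly_mapping_sum_single T_comp_def T.C_def)
qed

lemma T_comp_cmul:
  assumes "x \<in> T_comp m" "y \<in> T_comp k"
  shows "T.cmul x y \<in> T_comp (m + k)"
  using assms(1)
proof (induction x rule: T_comp_induct)
  case (single g w c)
  show ?case using assms(2)
  proof (induction y rule: T_comp_induct)
    case (single h u d)
    have "g ** h \<in> G" using \<open>g \<in> G\<close> \<open>h \<in> G\<close> T.m_closed by simp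
    then show ?case using \<open>g \<in> G\<close> single \<open>int (word_degree w) = m\<close>
      by (auto simp: T.cmul_single simp del: mult_single intro!: T_comp_single tens_homogeneous_const_mult
          tens_homogeneous_mult tens_homogeneous_act tens_homogeneous_single)
  qed (simp_all add: T.cmul_add_right T_comp_add)
qed (simp_all add: T.cmul_add_left T_comp_add)

lemma S_compD: "r \<in> S_comp m \<Longrightarrow> r \<in> S.C"
  by (simp add: symm_crossed_component_def S.C_def)

lemma S_comp_zero [simp]: "0 \<in> S_comp m"
  by (simp add: symm_crossed_component_def)

lemma S_comp_add: "r \<in> S_comp m \<Longrightarrow> s \<in> S_comp m \<Longrightarrow> r + s \<in> S_comp m"
  unfolding symm_crossed_component_def
  by (auto simp: lookup_add dest!: subsetD[OF keys_add])

lemma S_comp_minus: "r \<in> S_comp m \<Longrightarrow> - r \<in> S_comp m"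
  unfolding symm_crossed_component_def by (auto simp: in_keys_iff)

lemma S_comp_sum: "(\<And>a. a \<in> A \<Longrightarrow> f a \<in> S_comp m) \<Longrightarrow> (\<Sum>a\<in>A. f a) \<in> S_comp m"
  by (induction A rule: infinite_finite_induct) (simp_all add: S_comp_add)

lemma S_comp_csmult: "r \<in> S_comp m \<Longrightarrow> csmult c r \<in> S_comp m"
  using keys_csmult[of c r] keys_const_mult[of c] unfolding symm_crossed_component_def by fastforce

lemma S_comp_neg:
  assumes "r \<in> S_comp m" "m < 0"
  shows "r = 0"
proof (rule poly_mapping_eqI)
  fix g
  show "Poly_Mapping.lookup (r :: _ \<Rightarrow>\<^sub>0 'n symm) g = Poly_Mapping.lookup 0 g"
    using assms by (intro poly_mapping_eqI) (fastforce simp: symm_crossed_component_def in_keys_iff)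
qed

section \<open>The projection between the crossed products of T(V) and S(V)\<close>

definition proj :: "(complex^'n^'n \<Rightarrow>\<^sub>0 'n tens) \<Rightarrow> (complex^'n^'n \<Rightarrow>\<^sub>0 'n symm)" where
  "proj = Poly_Mapping.map tens_to_symm"

lemma tens_to_symm_0 [simp]: "tens_to_symm 0 = 0"
  by (rule alg_map_zero[OF alg_map_tens_to_symm])

lemma proj_add: "proj (x + y) = proj x + proj y"
  unfolding proj_def by (rule poly_mapping_map_add) (simp_all add: alg_map_add[OF alg_map_tens_to_symm])

lemma proj_zero [simp]: "proj 0 = 0"
  by (simp add: proj_def)

lemma proj_diff: "proj (x - y) = proj x - proj y"
  by (metis proj_add diff_add_cancel eq_diff_eq)

lemma proj_single [simp]: "proj (Poly_Mapping.single g p) = Poly_Mapping.single g (tens_to_symm p)"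
  by (rule poly_mapping_eqI) (simp add: proj_def lookup_poly_mapping_map lookup_single when_def)

text \<open>The map from T(V) to S(V) is multiplicative and G-equivariant, and both crossed products
  are twisted by the same \<alpha>.\<close>

lemma proj_cmul:
  assumes "x \<in> T.C" "y \<in> T.C"
  shows "proj (T.cmul x y) = S.cmul (proj x) (proj y)"
  using assms(1)
proof (induction x rule: T.C_induct)
  case (single g k c)
  show ?case using assms(2)
  proof (induction y rule: T.C_induct)
    case (single h l d)
    show ?case using \<open>g \<in> G\<close> \<open>h \<in> G\<close>
      by (simp add: T.cmul_single S.cmul_single alg_map_mult[OF alg_map_tens_to_symm]
          alg_map_const[OF alg_map_tens_to_symm] tens_to_symm_act del: tens_to_symm_single)
  qed (simp_all add: T.cmul_add_right S.cmul_add_right proj_add)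
qed (simp_all add: T.cmul_add_left S.cmul_add_left proj_add)

lemma proj_T_comp: "x \<in> T_comp m \<Longrightarrow> proj x \<in> S_comp m"
proof (induction x rule: T_comp_induct)
  case (single g w c)
  then show ?case
    by (auto simp: symm_crossed_component_def lookup_single when_def mono_degree_mono_of_word)
qed (simp_all add: proj_add S_comp_add)

end

section \<open>Exchanging letters modulo the Hecke ideal\<close>

locale hecke = hecke_setup G \<alpha>
  for G :: "(complex^'n^'n) set" and \<alpha> :: "complex^'n^'n \<Rightarrow> complex^'n^'n \<Rightarrow> complex" +
  fixes a :: "complex^'n^'n \<Rightarrow> complex^'n \<Rightarrow> complex^'n \<Rightarrow> complex"
begin

abbreviation I where "I \<equiv> hecke_ideal G \<alpha> a"

lemma hecke_relation_eq:
  "hecke_relation G \<alpha> a v w =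
    mon 0 (Poly_Mapping.single (mat 1) (tens_vec v * tens_vec w - tens_vec w * tens_vec v)) -
    mon 1 (\<Sum>g\<in>G. Poly_Mapping.single g (Poly_Mapping.single 0 (a g v w)))"
proof -
  let ?x = "\<lambda>u. Poly_Mapping.single (mat 1) (tens_vec u) :: complex^'n^'n \<Rightarrow>\<^sub>0 'n tens"
  have x: "?x u \<in> T.C" for u using T.one_closed by (simp add: T.C_single)
  have xx: "T.cmul (?x u) (?x u') = Poly_Mapping.single (mat 1) (tens_vec u * tens_vec u')" for u u'
    using T.one_closed by (simp add: T.cmul_single T.cocycle_simps T.act_one)
  have s: "Poly_Mapping.single g (Poly_Mapping.single 0 (a g v w)) \<in> T.C" if "g \<in> G" for g
    using that by (simp add: T.C_single)
  show ?thesis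
    by (simp add: hecke_relation_def Let_def T.monom_UP x T.UP_mult T.pmul_mon xx T.UP_minus
      T.finsum_UP[OF finite_G] s T.pset_C_sum T.C_single T.one_closed cong: sum.cong)
      (simp add: single_diff mon_diff mon_sum T.monom_UP s cong: sum.cong)
qed

lemma hecke_relation_closed: "hecke_relation G \<alpha> a v w \<in> pset T.C"
  unfolding hecke_relation_eq using T.one_closed
  by (intro T.pset_C_diff T.pset_C_closed T.C_sum T.C_single) auto

lemma ideal_I: "ideal I (poly_ext (tens_crossed G \<alpha>))"
  unfolding hecke_ideal_def
  by (rule ring.genideal_ideal[OF T.ring_P]) (auto simp: hecke_relation_closed)

lemma relation_in_I: "hecke_relation G \<alpha> a v w \<in> I"
proof -
  have "{hecke_relation G \<alpha> a v w | v w. True} \<subseteq> I"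
    unfolding hecke_ideal_def
    by (rule ring.genideal_self[OF T.ring_P]) (auto simp: hecke_relation_closed)
  then show ?thesis by blast
qed

lemma I_minimal: "ideal J (poly_ext (tens_crossed G \<alpha>)) \<Longrightarrow> (\<And>v w. hecke_relation G \<alpha> a v w \<in> J) \<Longrightarrow> I \<subseteq> J"
  unfolding hecke_ideal_def by (rule ring.genideal_minimal[OF T.ring_P]) auto

lemmas I_closed = T.ideal_closed[OF ideal_I]

text \<open>The two words agree in the quotient up to t times an element two degrees lower. The
  definition ranges over right factors g and coefficients c because an element of the crossed
  product is a sum of such terms. Equal lengths make the degree bound the same for both words, as
  transitivity demands.\<close>

definition word_equiv :: "'n list \<Rightarrow> 'n list \<Rightarrow> bool" where
  "word_equiv xs ys \<longleftrightarrow> length xs = length ys \<and> (\<forall>g\<in>G. \<forall>c. \<exists>y\<in>T_comp (int (length xs) - 2).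
     mon 0 (Poly_Mapping.single g (Poly_Mapping.single (Word xs) c)) -
     mon 0 (Poly_Mapping.single g (Poly_Mapping.single (Word ys) c)) - mon 1 y \<in> I)"

lemma word_equiv_refl: "word_equiv xs xs"
  unfolding word_equiv_def using I_closed(2) by (force intro: bexI[of _ 0])

lemma word_equiv_trans:
  assumes "word_equiv xs ys" "word_equiv ys zs"
  shows "word_equiv xs zs"
  unfolding word_equiv_def
proof (intro conjI ballI allI)
  show "length xs = length zs" using assms by (simp add: word_equiv_def)
  fix g c assume g: "g \<in> G"
  let ?m = "\<lambda>xs. mon 0 (Poly_Mapping.single g (Poly_Mapping.single (Word xs) c)) :: nat \<Rightarrow> complex^'n^'n \<Rightarrow>\<^sub>0 'n tens"
  from assms g obtain y z where yz: "y \<in> T_comp (int (length xs) - 2)" "z \<in> T_comp (int (length xs) - 2)"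
    "?m xs - ?m ys - mon 1 y \<in> I" "?m ys - ?m zs - mon 1 z \<in> I"
    unfolding word_equiv_def by metis
  have "(?m xs - ?m ys - mon 1 y) + (?m ys - ?m zs - mon 1 z) \<in> I"
    using yz I_closed(3) by blast
  also have "(?m xs - ?m ys - mon 1 y) + (?m ys - ?m zs - mon 1 z) = ?m xs - ?m zs - mon 1 (y + z)"
    by (simp add: mon_add algebra_simps)
  finally show "\<exists>y\<in>T_comp (int (length xs) - 2). ?m xs - ?m zs - mon 1 y \<in> I"
    using yz T_comp_add by blast
qed

lemma word_equiv_Cons:
  assumes "word_equiv xs ys"
  shows "word_equiv (i # xs) (i # ys)"
  unfolding word_equiv_def
proof (intro conjI ballI allI)
  show "length (i # xs) = length (i # ys)" using assms by (simp add: word_equiv_def)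
  fix g c assume g: "g \<in> G"
  let ?m = "\<lambda>xs. mon 0 (Poly_Mapping.single g (Poly_Mapping.single (Word xs) c)) :: nat \<Rightarrow> complex^'n^'n \<Rightarrow>\<^sub>0 'n tens"
  let ?e = "Poly_Mapping.single (mat 1) (gen i) :: complex^'n^'n \<Rightarrow>\<^sub>0 'n tens"
  from assms g obtain y where y: "y \<in> T_comp (int (length xs) - 2)" "?m xs - ?m ys - mon 1 y \<in> I"
    unfolding word_equiv_def by metis
  have e: "?e \<in> T_comp 1"
    using T.one_closed by (intro T_comp_single tens_homogeneous_single) (simp_all add: word_degree_def)
  have "T.pmul (mon 0 ?e) (?m xs - ?m ys - mon 1 y) \<in> I"
    using y e by (intro I_closed(7)) (auto dest: T_compD)
  also have "T.pmul (mon 0 ?e) (?m xs - ?m ys - mon 1 y) = ?m (i # xs) - ?m (i # ys) - mon 1 (T.cmul ?e y)"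
    using g T.one_closed
    by (simp add: T.pmul_diff_right T.pmul_mon T.cmul_single T.cocycle_simps T.act_one mult_single plus_free_word_def)
  finally show "\<exists>y\<in>T_comp (int (length (i # xs)) - 2). ?m (i # xs) - ?m (i # ys) - mon 1 y \<in> I"
    using T_comp_cmul[OF e y(1)] by (intro bexI[of _ "T.cmul ?e y"]) simp_all
qed

text \<open>Multiply the relation for the basis vectors i and j on the right by the term with word
  \<open>xs\<close>, group element \<open>g\<close> and coefficient \<open>c\<close>. The t-part
  becomes a group algebra element times this term, of degree \<open>length xs\<close>, two less than
  the whole word.\<close>

lemma word_equiv_swap: "word_equiv (i # j # xs) (j # i # xs)"
  unfolding word_equiv_def
proof (intro conjI ballI allI)
  fix g c assume g: "g \<in> G"
  let ?m = "\<lambda>xs. mon 0 (Poly_Mapping.single g (Poly_Mapping.single (Word xs) c)) :: nat \<Rightarrow> complex^'n^'n \<Rightarrow>\<^sub>0 'n tens"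
  let ?s = "\<Sum>h\<in>G. Poly_Mapping.single h (Poly_Mapping.single 0 (a h (axis i 1) (axis j 1))) :: complex^'n^'n \<Rightarrow>\<^sub>0 'n tens"
  let ?w = "Poly_Mapping.single g (Poly_Mapping.single (Word xs) c) :: complex^'n^'n \<Rightarrow>\<^sub>0 'n tens"
  have w: "?w \<in> T_comp (int (length xs))"
    using g by (intro T_comp_single tens_homogeneous_single) (simp_all add: word_degree_def)
  have s: "?s \<in> T_comp 0"
    by (intro T_comp_sum T_comp_single tens_homogeneous_const)
  have "T.pmul (hecke_relation G \<alpha> a (axis i 1) (axis j 1)) (mon 0 ?w) \<in> I"
    using relation_in_I w by (intro I_closed(6)) (auto dest: T_compD)
  also have "T.pmul (hecke_relation G \<alpha> a (axis i 1) (axis j 1)) (mon 0 ?w) =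
     ?m (i # j # xs) - ?m (j # i # xs) - mon 1 (T.cmul ?s ?w)"
    using g T.one_closed
    by (simp add: hecke_relation_eq T.pmul_diff_left T.pmul_mon T.cmul_single T.cocycle_simps T.act_one
       tens_vec_axis mult_single plus_free_word_def single_diff left_diff_distrib mon_diff)
  finally show "\<exists>y\<in>T_comp (int (length (i # j # xs)) - 2). ?m (i # j # xs) - ?m (j # i # xs) - mon 1 y \<in> I"
    using T_comp_cmul[OF s w] by (intro bexI[of _ "T.cmul ?s ?w"]) simp_all
qed simp

text \<open>Insertion: an occurrence of the head \<open>i\<close> in \<open>ys\<close> is moved to
  the front by adjacent swaps, and the tails are again rearrangements of each other.\<close>

lemma word_equiv_mset: "mset xs = mset ys \<Longrightarrow> word_equiv xs ys"
proof (induction xs arbitrary: ys)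
  case Nil
  then show ?case by (simp add: word_equiv_refl)
next
  case (Cons i xs)
  then have "i \<in> set ys" by (metis list.set_intros(1) mset_eq_setD)
  then obtain us vs where ys: "ys = us @ i # vs" by (meson split_list)
  have "word_equiv (i # us @ vs) (us @ i # vs)"
  proof (induction us)
    case (Cons j us)
    then show ?case
      using word_equiv_trans[OF word_equiv_swap word_equiv_Cons] by simp
  qed (simp add: word_equiv_refl)
  moreover have "word_equiv (i # xs) (i # us @ vs)"
    using Cons ys by (intro word_equiv_Cons Cons.IH) simp
  ultimately show ?case using word_equiv_trans ys by blast
qed

lemma ordered_section_reduction:
  assumes "x \<in> T_comp m"
  shows "\<exists>y\<in>T_comp (m - 2). mon 0 x - mon 0 (Poly_Mapping.map ordered_section (proj x)) - mon 1 y \<in> I"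
  using assms
proof (induction x rule: T_comp_induct)
  case zero
  show ?case using I_closed(2) by (intro bexI[of _ 0]) auto
next
  case (add x z)
  from add.IH obtain y y' where y: "y \<in> T_comp (m - 2)" "y' \<in> T_comp (m - 2)"
    "mon 0 x - mon 0 (Poly_Mapping.map ordered_section (proj x)) - mon 1 y \<in> I"
    "mon 0 z - mon 0 (Poly_Mapping.map ordered_section (proj z)) - mon 1 y' \<in> I" by blast
  have "mon 0 (x + z) - mon 0 (Poly_Mapping.map ordered_section (proj (x + z))) - mon 1 (y + y') =
    (mon 0 x - mon 0 (Poly_Mapping.map ordered_section (proj x)) - mon 1 y) +
    (mon 0 z - mon 0 (Poly_Mapping.map ordered_section (proj z)) - mon 1 y')"
    by (simp add: proj_add poly_mapping_map_add ordered_section_add mon_add algebra_simps)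
  then show ?case using y I_closed(3) T_comp_add by metis
next
  case (single g w c)
  have "mset (letters w) = mset (letters (word_of_mono (mono_of_word w)))"
    by (simp flip: mono_of_word_eq_iff)
  from word_equiv_mset[OF this] single(1)
  have "\<exists>y\<in>T_comp (int (length (letters w)) - 2).
     mon 0 (Poly_Mapping.single g (Poly_Mapping.single (Word (letters w)) c)) -
     mon 0 (Poly_Mapping.single g (Poly_Mapping.single (Word (letters (word_of_mono (mono_of_word w)))) c)) -
     mon 1 y \<in> I"
    unfolding word_equiv_def by blast
  then show ?case
    using single(2) by (simp add: word_degree_def map_single)
qed

end

section \<open>Reduction to the image of a graded section\<close>

locale hecke_section = hecke G \<alpha> a
  for G :: "(complex^'n^'n) set" and \<alpha> :: "complex^'n^'n \<Rightarrow> complex^'n^'n \<Rightarrow> complex"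
    and a :: "complex^'n^'n \<Rightarrow> complex^'n \<Rightarrow> complex^'n \<Rightarrow> complex" +
  fixes \<sigma> :: "'n symm \<Rightarrow> 'n tens"
  assumes \<sigma>: "graded_section \<sigma>"
begin

definition sec :: "(complex^'n^'n \<Rightarrow>\<^sub>0 'n symm) \<Rightarrow> (complex^'n^'n \<Rightarrow>\<^sub>0 'n tens)" where
  "sec = Poly_Mapping.map \<sigma>"

definition psec :: "(nat \<Rightarrow> complex^'n^'n \<Rightarrow>\<^sub>0 'n symm) \<Rightarrow> nat \<Rightarrow> (complex^'n^'n \<Rightarrow>\<^sub>0 'n tens)" where
  "psec f = (\<lambda>i. sec (f i))"

lemma \<sigma>_simps:
  "\<sigma> (p + q) = \<sigma> p + \<sigma> q" "\<sigma> (Poly_Mapping.single 0 c * p) = Poly_Mapping.single 0 c * \<sigma> p"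
  "tens_to_symm (\<sigma> p) = p" "\<sigma> 0 = 0"
proof -
  show *: "\<sigma> (p + q) = \<sigma> p + \<sigma> q" for p q using \<sigma> by (simp add: graded_section_def)
  show "\<sigma> (Poly_Mapping.single 0 c * p) = Poly_Mapping.single 0 c * \<sigma> p" "tens_to_symm (\<sigma> p) = p"
    using \<sigma> by (auto simp: graded_section_def)
  show "\<sigma> 0 = 0" using *[of 0 0] by simp
qed

lemma sec_add: "sec (r + s) = sec r + sec s"
  unfolding sec_def by (rule poly_mapping_map_add) (simp_all add: \<sigma>_simps)

lemma sec_zero [simp]: "sec 0 = 0"
  by (simp add: sec_def)

lemma sec_csmult: "sec (csmult c r) = csmult c (sec r)"
  by (rule poly_mapping_eqI) (simp add: sec_def lookup_poly_mapping_map \<sigma>_simps)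

lemma proj_sec: "proj (sec r) = r"
  by (rule poly_mapping_eqI) (simp add: sec_def proj_def lookup_poly_mapping_map \<sigma>_simps)

lemma sec_C: "r \<in> S.C \<Longrightarrow> sec r \<in> T.C"
  using keys_poly_mapping_map unfolding sec_def T.C_def S.C_def by fastforce

lemma sec_S_comp:
  assumes "r \<in> S_comp (int m)"
  shows "sec r \<in> T_comp (int m)"
proof -
  have "tens_homogeneous (int m) (Poly_Mapping.lookup (sec r) g)" for g
  proof -
    have "\<forall>k\<in>Poly_Mapping.keys (Poly_Mapping.lookup r g). mono_degree k = m"
      using assms by (auto simp: symm_crossed_component_def)
    then have "\<forall>w\<in>Poly_Mapping.keys (\<sigma> (Poly_Mapping.lookup r g)). word_degree w = m"
      using \<sigma> unfolding graded_section_def by blast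
    then show ?thesis
      by (simp add: sec_def lookup_poly_mapping_map \<sigma>_simps tens_homogeneous_def)
  qed
  then show ?thesis using sec_C[OF S_compD[OF assms]] by (simp add: T_comp_def)
qed

lemma psec_add: "psec (f + g) = psec f + psec g"
  by (simp add: psec_def sec_add pointwise)

lemma psec_zero [simp]: "psec 0 = 0"
  by (simp add: psec_def pointwise)

lemma psec_mon [simp]: "psec (mon i r) = mon i (sec r)"
  by (simp add: psec_def mon_def pointwise)

lemma psec_tshift: "psec (tshift k f) = tshift k (psec f)"
  by (simp add: psec_def tshift_def pointwise)

lemma psec_psc: "psec (psc c f) = psc c (psec f)"
  by (simp add: psec_def psc_def sec_csmult)

lemma psec_closed [simp, intro]: "f \<in> pset S.C \<Longrightarrow> psec f \<in> pset T.C"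
  by (fastforce simp: pset_def psec_def sec_C)

lemma psec_psmult: "f \<in> pset S.C \<Longrightarrow> psec (psmult p f) = psmult p (psec f)"
  by (rule psmult_commute[where J = "pset S.C"]) (auto simp: psec_add psec_psc psec_tshift)

text \<open>The control of degrees here makes it unnecessary to show that the ideal is homogeneous.\<close>

lemma section_reduction_graded:
  assumes "x \<in> T_comp (int m)"
  shows "\<exists>y\<in>pset S.C. (\<forall>i. y i \<in> S_comp (int m - 2 * int i)) \<and> y 0 = proj x \<and> mon 0 x - psec y \<in> I"
  using assms
proof (induction m arbitrary: x rule: less_induct)
  case (less m)
  define z where "z = x - sec (proj x)"
  have px: "proj x \<in> S_comp (int m)" using less.prems by (rule proj_T_comp)
  have "z \<in> T_comp (int m)"
    using T_comp_add[OF less.prems T_comp_minus[OF sec_S_comp[OF px]]] by (simp add: z_def)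
  \<comment> \<open>The projection of \<open>z\<close> is 0, so the \<open>ordered_section\<close>
    term vanishes. Subtracting \<open>sec (proj x)\<close> thus transfers the reduction from the
    chosen words to an arbitrary graded section.\<close>
  from ordered_section_reduction[OF this] obtain y' where y': "y' \<in> T_comp (int m - 2)" "mon 0 z - mon 1 y' \<in> I"
    by (auto simp: z_def proj_diff proj_sec)
  show ?case
  proof (cases "m < 2")
    case True
    \<comment> \<open>Here m - 2 is negative, which is the base of the descent.\<close>
    then have "y' = 0" using y' T_comp_neg by force
    then have "mon 0 x - psec (mon 0 (proj x)) \<in> I"
      using y' by (simp add: z_def mon_diff)
    moreover have "mon 0 (proj x) i \<in> S_comp (int m - 2 * int i)" for i
      using px by (simp add: mon_def)
    ultimately show ?thesis
      using S_compD[OF px] by (intro bexI[of _ "mon 0 (proj x)"]) auto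
  next
    case False
    then have "int (m - 2) = int m - 2" by simp
    then have "y' \<in> T_comp (int (m - 2))" using y'(1) by (simp only:)
    moreover have "m - 2 < m" using False by simp
    ultimately obtain y where y: "y \<in> pset S.C"
      "\<forall>i. y i \<in> S_comp (int (m - 2) - 2 * int i)" "mon 0 y' - psec y \<in> I" using less.IH by blast
    \<comment> \<open>\<open>y'\<close> enters with a factor t, hence the shift of its
      representative by 1.\<close>
    let ?y = "mon 0 (proj x) + tshift 1 y"
    have "mon 0 x - psec ?y = (mon 0 z - mon 1 y') + tshift 1 (mon 0 y' - psec y)"
      by (simp add: z_def mon_diff psec_add psec_tshift tshift_diff)
    also have "\<dots> \<in> I" using y y' I_closed(3,9) by blast
    finally have *: "mon 0 x - psec ?y \<in> I" .
    have 1: "?y \<in> pset S.C" using y px S_compD by blast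
    have 2: "?y i \<in> S_comp (int m - 2 * int i)" for i
    proof (cases i)
      case 0
      then show ?thesis using px by (simp add: pointwise tshift_def)
    next
      case (Suc j)
      have "int (m - 2) - 2 * int j = int m - 2 * int i" using Suc False by simp
      moreover have "?y i = y j" using Suc by (simp add: pointwise tshift_def mon_def)
      ultimately show ?thesis using y(2) by metis
    qed
    have "?y 0 = proj x" by (simp add: plus_fun_apply tshift_def)
    then show ?thesis using * 1 2 by blast
  qed
qed

lemma section_reduction:
  assumes "x \<in> T.C"
  shows "\<exists>y\<in>pset S.C. y 0 = proj x \<and> mon 0 x - psec y \<in> I"
  using assms
proof (induction x rule: T.C_induct)
  case zero
  show ?case using I_closed(2) zero_fun_apply[of "0::nat"] by (intro bexI[of _ 0]) simp_all
next
  case (add x z)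
  then obtain y y' where y: "y \<in> pset S.C" "y' \<in> pset S.C" "y 0 = proj x" "y' 0 = proj z"
    "mon 0 x - psec y \<in> I" "mon 0 z - psec y' \<in> I" by blast
  have "mon 0 (x + z) - psec (y + y') = (mon 0 x - psec y) + (mon 0 z - psec y')"
    by (simp add: mon_add psec_add)
  then have "mon 0 (x + z) - psec (y + y') \<in> I" using y I_closed(3) by metis
  moreover have "(y + y') 0 = proj (x + z)" using y by (simp add: plus_fun_apply proj_add)
  ultimately show ?case using y by blast
next
  case (single g w c)
  then have "Poly_Mapping.single g (Poly_Mapping.single w c) \<in> T_comp (int (word_degree w))"
    by (intro T_comp_single tens_homogeneous_single) auto
  from section_reduction_graded[OF this] show ?case by blast
qed

text \<open>Each power of t is handled separately, by shifting the reduction of its coefficient. The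
  section map is thus onto for every family of forms, and only its injectivity is a condition on
  them.\<close>

lemma section_surj:
  assumes "f \<in> pset T.C"
  shows "\<exists>y\<in>pset S.C. f - psec y \<in> I"
  using assms
proof (induction f rule: T.pset_C_induct)
  case zero
  show ?case using I_closed(2) by (intro bexI[of _ 0]) auto
next
  case (add f g)
  then obtain y y' where y: "y \<in> pset S.C" "y' \<in> pset S.C" "f - psec y \<in> I" "g - psec y' \<in> I" by blast
  have "(f + g) - psec (y + y') = (f - psec y) + (g - psec y')"
    by (simp add: psec_add)
  then have "(f + g) - psec (y + y') \<in> I" using y I_closed(3) by metis
  then show ?case using y by blast
next
  case (mon i x)
  from section_reduction[OF mon] obtain y where y: "y \<in> pset S.C" "mon 0 x - psec y \<in> I" by blast
  have "mon i x - psec (tshift i y) = tshift i (mon 0 x - psec y)"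
    by (simp add: psec_tshift tshift_diff)
  then show ?case using y I_closed(9) by (intro bexI[of _ "tshift i y"]) auto
qed

end

section \<open>Products on \<open>R[t]\<close> given by bilinear maps\<close>

text \<open>The section map leads from R[t] to the quotient, whereas the theorem also asks for the
  opposite direction. Closure of \<open>A\<close> is a hypothesis because \<open>A\<close> and
  \<open>B\<close> are arbitrary records here, not rings.\<close>

lemma alg_isomorphic_sym:
  assumes h: "h \<in> ring_iso A B" and smult: "\<And>c x. x \<in> carrier A \<Longrightarrow> h (c \<odot>\<^bsub>A\<^esub> x) = c \<odot>\<^bsub>B\<^esub> h x"
    and cl: "\<And>x y. x \<in> carrier A \<Longrightarrow> y \<in> carrier A \<Longrightarrow> x \<oplus>\<^bsub>A\<^esub> y \<in> carrier A"
    "\<And>x y. x \<in> carrier A \<Longrightarrow> y \<in> carrier A \<Longrightarrow> x \<otimes>\<^bsub>A\<^esub> y \<in> carrier A"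
    "\<And>c x. x \<in> carrier A \<Longrightarrow> c \<odot>\<^bsub>A\<^esub> x \<in> carrier A" "\<one>\<^bsub>A\<^esub> \<in> carrier A"
  shows "alg_isomorphic B A"
proof -
  from h have hom: "h \<in> ring_hom A B" and bij: "bij_betw h (carrier A) (carrier B)"
    by (auto simp: ring_iso_def)
  define k where "k = inv_into (carrier A) h"
  have k: "k y \<in> carrier A" "h (k y) = y" if "y \<in> carrier B" for y
    using that bij unfolding k_def by (auto simp: bij_betw_def inv_into_into f_inv_into_f)
  have kh: "k (h x) = x" if "x \<in> carrier A" for x
    using that bij unfolding k_def by (simp add: bij_betw_def inv_into_f_f)
  have "k \<in> ring_hom B A"
  proof (rule ring_hom_memI)
    show "k (x \<otimes>\<^bsub>B\<^esub> y) = k x \<otimes>\<^bsub>A\<^esub> k y" if "x \<in> carrier B" "y \<in> carrier B" for x y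
      using that kh[OF cl(2)[OF k(1) k(1)], of x y] ring_hom_mult[OF hom k(1) k(1), of x y] by (simp add: k)
    show "k (x \<oplus>\<^bsub>B\<^esub> y) = k x \<oplus>\<^bsub>A\<^esub> k y" if "x \<in> carrier B" "y \<in> carrier B" for x y
      using that kh[OF cl(1)[OF k(1) k(1)], of x y] ring_hom_add[OF hom k(1) k(1), of x y] by (simp add: k)
    show "k \<one>\<^bsub>B\<^esub> = \<one>\<^bsub>A\<^esub>"
      using kh[OF cl(4)] ring_hom_one[OF hom] by simp
  qed (rule k)
  moreover have "bij_betw k (carrier B) (carrier A)"
    unfolding k_def using bij by (rule bij_betw_inv_into)
  moreover have "k (c \<odot>\<^bsub>B\<^esub> y) = c \<odot>\<^bsub>A\<^esub> k y" if "y \<in> carrier B" for c y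
    using that kh[OF cl(3)[OF k(1)], of y c] smult[OF k(1), of y c] by (simp add: k)
  ultimately show ?thesis
    unfolding alg_isomorphic_def ring_iso_def by blast
qed

context hecke_setup
begin

lemma symm_crossed_simps [simp]:
  "carrier (symm_crossed G \<alpha>) = S.C" "\<zero>\<^bsub>symm_crossed G \<alpha>\<^esub> = 0" "x \<oplus>\<^bsub>symm_crossed G \<alpha>\<^esub> y = x + y"
  "c \<odot>\<^bsub>symm_crossed G \<alpha>\<^esub> x = csmult c x"
  using S.crossed_simps by simp_all

lemma symm_crossed_mult: "x \<in> S.C \<Longrightarrow> y \<in> S.C \<Longrightarrow> x \<otimes>\<^bsub>symm_crossed G \<alpha>\<^esub> y = S.cmul x y"
  using S.crossed_mult by simp

lemma deformed_simps [simp]: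
  "carrier (deformed_algebra (symm_crossed G \<alpha>) \<mu>) = pset S.C"
  "\<one>\<^bsub>deformed_algebra (symm_crossed G \<alpha>) \<mu>\<^esub> = mon 0 (Poly_Mapping.single (mat 1) 1)"
  using S.P_simps by (simp_all add: deformed_algebra_def)

lemma deformed_add:
  "f \<in> pset S.C \<Longrightarrow> g \<in> pset S.C \<Longrightarrow> f \<oplus>\<^bsub>deformed_algebra (symm_crossed G \<alpha>) \<mu>\<^esub> g = f + g"
  using S.P_add by (simp add: deformed_algebra_def)

lemma deformed_smult:
  "f \<in> pset S.C \<Longrightarrow> p \<odot>\<^bsub>deformed_algebra (symm_crossed G \<alpha>) \<mu>\<^esub> f = psmult p f"
  using S.P_smult by (simp add: deformed_algebra_def)

end

text \<open>Common ground of both directions: a C[t]-bilinear product on R[t], with associativity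
  left open. For a Hecke algebra associativity is derived from the quotient; for a deformation it is
  given.\<close>

locale bilinear_family = hecke_setup G \<alpha>
  for G :: "(complex^'n^'n) set" and \<alpha> :: "complex^'n^'n \<Rightarrow> complex^'n^'n \<Rightarrow> complex" +
  fixes \<mu> :: "nat \<Rightarrow> (complex^'n^'n \<Rightarrow>\<^sub>0 'n symm) \<Rightarrow> (complex^'n^'n \<Rightarrow>\<^sub>0 'n symm) \<Rightarrow> (complex^'n^'n \<Rightarrow>\<^sub>0 'n symm)"
  assumes mu_closed: "\<And>i r s. r \<in> S.C \<Longrightarrow> s \<in> S.C \<Longrightarrow> \<mu> i r s \<in> S.C"
    and mu_add_left: "\<And>i r r' s. r \<in> S.C \<Longrightarrow> r' \<in> S.C \<Longrightarrow> s \<in> S.C \<Longrightarrow> \<mu> i (r + r') s = \<mu> i r s + \<mu> i r' s"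
    and mu_add_right: "\<And>i r s s'. r \<in> S.C \<Longrightarrow> s \<in> S.C \<Longrightarrow> s' \<in> S.C \<Longrightarrow> \<mu> i r (s + s') = \<mu> i r s + \<mu> i r s'"
    and mu_csmult_left: "\<And>i c r s. r \<in> S.C \<Longrightarrow> s \<in> S.C \<Longrightarrow> \<mu> i (csmult c r) s = csmult c (\<mu> i r s)"
    and mu_csmult_right: "\<And>i c r s. r \<in> S.C \<Longrightarrow> s \<in> S.C \<Longrightarrow> \<mu> i r (csmult c s) = csmult c (\<mu> i r s)"
    and mu_finite: "\<And>r s. r \<in> S.C \<Longrightarrow> s \<in> S.C \<Longrightarrow> \<exists>p. \<forall>i>p. \<mu> i r s = 0"
begin

abbreviation D where "D \<equiv> deformed_algebra (symm_crossed G \<alpha>) \<mu>"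

definition dmul :: "(nat \<Rightarrow> complex^'n^'n \<Rightarrow>\<^sub>0 'n symm) \<Rightarrow> (nat \<Rightarrow> complex^'n^'n \<Rightarrow>\<^sub>0 'n symm) \<Rightarrow> nat \<Rightarrow> complex^'n^'n \<Rightarrow>\<^sub>0 'n symm" where
  "dmul f g = (\<lambda>n. \<Sum>i\<le>n. \<Sum>j\<le>n-i. \<mu> i (f j) (g (n - i - j)))"

lemma mu_zero [simp]: "s \<in> S.C \<Longrightarrow> \<mu> i 0 s = 0" "s \<in> S.C \<Longrightarrow> \<mu> i s 0 = 0"
  using mu_csmult_left[of 0 s i 0] mu_csmult_right[of s 0 i 0] by simp_all

lemma D_mult:
  assumes "f \<in> pset S.C" "g \<in> pset S.C"
  shows "f \<otimes>\<^bsub>D\<^esub> g = dmul f g"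
proof -
  have "\<mu> i (f j) (g k) \<in> S.C" for i j k
    using assms by (intro mu_closed S.pset_CD)
  then show ?thesis
    by (simp add: deformed_algebra_def dmul_def S.finsum_crossed S.C_sum)
qed

lemma dmul_add_left:
  assumes "f \<in> pset S.C" "f' \<in> pset S.C" "g \<in> pset S.C"
  shows "dmul (f + f') g = dmul f g + dmul f' g"
  using assms by (simp add: dmul_def pointwise mu_add_left S.pset_CD sum.distrib)

lemma dmul_add_right:
  assumes "f \<in> pset S.C" "g \<in> pset S.C" "g' \<in> pset S.C"
  shows "dmul f (g + g') = dmul f g + dmul f g'"
  using assms by (simp add: dmul_def pointwise mu_add_right S.pset_CD sum.distrib)

lemma dmul_zero [simp]: "f \<in> pset S.C \<Longrightarrow> dmul 0 f = 0" "f \<in> pset S.C \<Longrightarrow> dmul f 0 = 0"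
  by (simp_all add: dmul_def pointwise S.pset_CD)

lemma dmul_psc_left: "f \<in> pset S.C \<Longrightarrow> g \<in> pset S.C \<Longrightarrow> dmul (psc c f) g = psc c (dmul f g)"
  by (simp add: dmul_def psc_def mu_csmult_left S.pset_CD csmult_sum)

lemma dmul_psc_right: "f \<in> pset S.C \<Longrightarrow> g \<in> pset S.C \<Longrightarrow> dmul f (psc c g) = psc c (dmul f g)"
  by (simp add: dmul_def psc_def mu_csmult_right S.pset_CD csmult_sum)

lemma dmul_sum_left:
  "(\<And>a. a \<in> A \<Longrightarrow> f a \<in> pset S.C) \<Longrightarrow> g \<in> pset S.C \<Longrightarrow> dmul (\<Sum>a\<in>A. f a) g = (\<Sum>a\<in>A. dmul (f a) g)"
  by (induction A rule: infinite_finite_induct) (simp_all add: dmul_add_left S.pset_C_sum)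

lemma dmul_mon:
  assumes "r \<in> S.C" "s \<in> S.C"
  shows "dmul (mon j r) (mon k s) = tshift (j + k) (\<lambda>i. \<mu> i r s)"
proof
  fix n
  have inner: "(\<Sum>l\<le>n-i. \<mu> i (mon j r l) (mon k s (n - i - l))) = (if i + j + k = n then \<mu> i r s else 0)"
    if "i \<le> n" for i
  proof -
    have "(\<Sum>l\<le>n-i. \<mu> i (mon j r l) (mon k s (n - i - l))) =
        (\<Sum>l\<le>n-i. if l = j then (if i + j + k = n then \<mu> i r s else 0) else 0)"
      using that assms by (intro sum.cong refl) (auto simp: mon_def)
    then show ?thesis using that by auto
  qed
  \<comment> \<open>When n < j + k, truncated subtraction would select i = 0, hence the inner
    condition.\<close>
  have "dmul (mon j r) (mon k s) n = (\<Sum>i\<le>n. if i = n - (j + k) then (if j + k \<le> n then \<mu> i r s else 0) else 0)"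
    unfolding dmul_def
  proof (rule sum.cong[OF refl])
    fix i assume "i \<in> {..n}"
    then show "(\<Sum>l\<le>n-i. \<mu> i (mon j r l) (mon k s (n - i - l))) =
        (if i = n - (j + k) then (if j + k \<le> n then \<mu> i r s else 0) else 0)"
      by (subst inner) auto
  qed
  then show "dmul (mon j r) (mon k s) n = tshift (j + k) (\<lambda>i. \<mu> i r s) n"
    by (auto simp: tshift_def)
qed

lemma mu_pset: "r \<in> S.C \<Longrightarrow> s \<in> S.C \<Longrightarrow> (\<lambda>i. \<mu> i r s) \<in> pset S.C"
  using mu_finite[of r s] by (auto simp: pset_def mu_closed)

lemma dmul_closed [simp, intro]:
  assumes "f \<in> pset S.C" "g \<in> pset S.C"
  shows "dmul f g \<in> pset S.C"
  using assms(1)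
proof (induction f rule: S.pset_C_induct)
  case (mon i x)
  show ?case using assms(2)
  proof (induction g rule: S.pset_C_induct)
    case (mon j y)
    then show ?case using \<open>x \<in> S.C\<close> by (auto simp: dmul_mon intro: mu_pset)
  qed (use mon in \<open>simp_all add: dmul_add_right\<close>)
qed (use assms(2) in \<open>simp_all add: dmul_add_left\<close>)

lemma dmul_tshift:
  assumes "f \<in> pset S.C" "g \<in> pset S.C"
  shows "dmul (tshift k f) g = tshift k (dmul f g)" "dmul f (tshift k g) = tshift k (dmul f g)"
proof -
  have "dmul (tshift k f) g = tshift k (dmul f g) \<and> dmul f (tshift k g) = tshift k (dmul f g)"
    using assms(1)
  proof (induction f rule: S.pset_C_induct)
    case (mon i x)
    show ?case using assms(2)
    proof (induction g rule: S.pset_C_induct)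
      case (mon j y)
      then show ?case using \<open>x \<in> S.C\<close> by (simp add: dmul_mon tshift_tshift add_ac)
    qed (use mon in \<open>simp_all add: dmul_add_right tshift_add\<close>)
  qed (use assms(2) in \<open>simp_all add: dmul_add_left tshift_add\<close>)
  then show "dmul (tshift k f) g = tshift k (dmul f g)" "dmul f (tshift k g) = tshift k (dmul f g)"
    by auto
qed

end

section \<open>Hecke algebras are deformations\<close>

locale hecke_iso = hecke_section G \<alpha> a \<sigma>
  for G :: "(complex^'n^'n) set" and \<alpha> :: "complex^'n^'n \<Rightarrow> complex^'n^'n \<Rightarrow> complex"
    and a :: "complex^'n^'n \<Rightarrow> complex^'n \<Rightarrow> complex^'n \<Rightarrow> complex" and \<sigma> :: "'n symm \<Rightarrow> 'n tens" +
  assumes section_inj: "\<And>y. y \<in> pset S.C \<Longrightarrow> psec y \<in> I \<Longrightarrow> y = 0"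
begin

lemma psec_minus: "psec (- f) = - psec f"
  using psec_add[of f "- f"] by (simp add: add_eq_0_iff)

lemma psec_diff: "psec (f - g) = psec f - psec g"
  using psec_add[of f "- g"] by (simp add: psec_minus)

text \<open>The normal form of a class modulo the ideal. It exists by \<open>section_surj\<close>
  and is unique by \<open>section_inj\<close>, so the choice is immaterial and linearity can be read
  off from any representative.\<close>

definition N :: "(nat \<Rightarrow> complex^'n^'n \<Rightarrow>\<^sub>0 'n tens) \<Rightarrow> nat \<Rightarrow> complex^'n^'n \<Rightarrow>\<^sub>0 'n symm" where
  "N f = (SOME y. y \<in> pset S.C \<and> f - psec y \<in> I)"

lemma N: "f \<in> pset T.C \<Longrightarrow> N f \<in> pset S.C" "f \<in> pset T.C \<Longrightarrow> f - psec (N f) \<in> I"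
  unfolding N_def using someI_ex[of "\<lambda>y. y \<in> pset S.C \<and> f - psec y \<in> I"] section_surj by blast+

lemma N_eqI:
  assumes "f \<in> pset T.C" "y \<in> pset S.C" "f - psec y \<in> I"
  shows "N f = y"
proof -
  have "(f - psec y) - (f - psec (N f)) \<in> I" using N[OF assms(1)] assms I_closed(4) by blast
  then have "psec (N f - y) \<in> I" by (simp add: psec_diff)
  then show ?thesis using section_inj[of "N f - y"] N assms by simp
qed

lemma N_psec: "y \<in> pset S.C \<Longrightarrow> N (psec y) = y"
  using I_closed(2) by (intro N_eqI) auto

lemma N_cong: "f \<in> pset T.C \<Longrightarrow> g \<in> pset T.C \<Longrightarrow> f - g \<in> I \<Longrightarrow> N f = N g"
  using N[of g] I_closed(3)[of "f - g" "g - psec (N g)"] by (intro N_eqI) auto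

lemma N_add: "f \<in> pset T.C \<Longrightarrow> g \<in> pset T.C \<Longrightarrow> N (f + g) = N f + N g"
  using I_closed(3)[OF N(2)[of f] N(2)[of g]] N
  by (intro N_eqI) (auto simp: psec_add algebra_simps)

lemma N_zero [simp]: "N 0 = 0"
  using N_psec[of 0] by simp

lemma N_psc:
  assumes "f \<in> pset T.C"
  shows "N (psc c f) = psc c (N f)"
proof (rule N_eqI)
  have "psc c (f - psec (N f)) \<in> I" using N[OF assms] I_closed(8) by blast
  also have "psc c (f - psec (N f)) = psc c f - psec (psc c (N f))"
    using psc_add[of c "f - psec (N f)" "psec (N f)"] by (simp add: psec_psc algebra_simps)
  finally show "psc c f - psec (psc c (N f)) \<in> I" .
qed (use assms N in auto)

lemma N_tshift:
  assumes "f \<in> pset T.C"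
  shows "N (tshift k f) = tshift k (N f)"
proof (rule N_eqI)
  have "tshift k (f - psec (N f)) \<in> I" using N[OF assms] I_closed(9) by blast
  then show "tshift k f - psec (tshift k (N f)) \<in> I" by (simp add: psec_tshift tshift_diff)
qed (use assms N in auto)

text \<open>The coefficient of t^i in the product of the quotient, transported to R[t] along the
  section map.\<close>

definition \<mu> where "\<mu> i r s = N (mon 0 (T.cmul (sec r) (sec s))) i"

lemma mu_eq: "(\<lambda>i. \<mu> i r s) = N (mon 0 (T.cmul (sec r) (sec s)))"
  by (simp add: \<mu>_def)

lemma sec_cmul_closed: "mon 0 (T.cmul (sec r) (sec s)) \<in> pset T.C"
  by (simp add: T.cmul_closed)

lemma bilinear_family_mu: "bilinear_family G \<alpha> \<mu>"
proof (intro bilinear_family.intro bilinear_family_axioms.intro)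
  show "hecke_setup G \<alpha>" by (rule hecke_setup_axioms)
  show "\<exists>p. \<forall>i>p. \<mu> i r s = 0" for r s
    using N(1)[OF sec_cmul_closed, of r s] by (auto simp: pset_def \<mu>_def)
  show "\<mu> i (r + r') s = \<mu> i r s + \<mu> i r' s" "\<mu> i s (r + r') = \<mu> i s r + \<mu> i s r'" for i r r' s
    by (simp_all add: \<mu>_def sec_add T.cmul_add_left T.cmul_add_right mon_add N_add sec_cmul_closed plus_fun_apply)
  fix i c r s assume rs: "r \<in> S.C" "s \<in> S.C"
  show "\<mu> i r s \<in> S.C"
    using N(1)[OF sec_cmul_closed, of r s] by (auto simp: pset_def \<mu>_def)
  have "N (mon 0 (csmult c (T.cmul (sec r) (sec s)))) = psc c (N (mon 0 (T.cmul (sec r) (sec s))))"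
    using N_psc[OF sec_cmul_closed, of c r s] by simp
  then show "\<mu> i (csmult c r) s = csmult c (\<mu> i r s)" "\<mu> i r (csmult c s) = csmult c (\<mu> i r s)"
    using rs by (simp_all add: \<mu>_def sec_csmult T.cmul_csmult sec_C psc_def)
qed

sublocale bilinear_family G \<alpha> \<mu>
  by (rule bilinear_family_mu)

text \<open>Both sides are additive in each argument and compatible with powers of t, and on
  elements of R they agree by the definition of \<open>\<mu>\<close>.\<close>

lemma dmul_eq_N:
  assumes "f \<in> pset S.C" "g \<in> pset S.C"
  shows "dmul f g = N (T.pmul (psec f) (psec g))"
  using assms(1)
proof (induction f rule: S.pset_C_induct)
  case (mon i x)
  show ?case using assms(2)
  proof (induction g rule: S.pset_C_induct)
    case (mon j y)
    have "N (mon (i + j) (T.cmul (sec x) (sec y))) = tshift (i + j) (N (mon 0 (T.cmul (sec x) (sec y))))"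
      using N_tshift[OF sec_cmul_closed, of "i + j" x y] by simp
    then show ?case using mon \<open>x \<in> S.C\<close>
      by (simp add: dmul_mon mu_eq T.pmul_mon)
  qed (use mon in \<open>simp_all add: dmul_add_right psec_add T.pmul_add_right N_add sec_C\<close>)
qed (use assms(2) in \<open>simp_all add: dmul_add_left psec_add T.pmul_add_left N_add\<close>)

text \<open>Replacing a factor by its normal form changes a product by an element of the ideal, so
  associativity descends from the polynomial ring over the crossed product of T(V).\<close>

lemma dmul_assoc:
  assumes "f \<in> pset S.C" "g \<in> pset S.C" "h \<in> pset S.C"
  shows "dmul (dmul f g) h = dmul f (dmul g h)"
proof -
  have fg: "T.pmul (psec f) (psec g) \<in> pset T.C" and gh: "T.pmul (psec g) (psec h) \<in> pset T.C"
    using assms by auto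
  have "dmul (dmul f g) h = N (T.pmul (psec (N (T.pmul (psec f) (psec g)))) (psec h))"
    using assms N fg by (simp add: dmul_eq_N)
  also have "\<dots> = N (T.pmul (T.pmul (psec f) (psec g)) (psec h))"
  proof (rule N_cong[symmetric])
    show "T.pmul (T.pmul (psec f) (psec g)) (psec h) - T.pmul (psec (N (T.pmul (psec f) (psec g)))) (psec h) \<in> I"
      using I_closed(6)[OF N(2)[OF fg], of "psec h"] assms by (simp add: T.pmul_diff_left)
  qed (use assms N fg in auto)
  also have "T.pmul (T.pmul (psec f) (psec g)) (psec h) = T.pmul (psec f) (T.pmul (psec g) (psec h))"
    using monoid.m_assoc[OF ring.is_monoid[OF T.ring_P], of "psec f" "psec g" "psec h"] assms
    by (simp add: T.P_mult T.P_simps)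
  also have "N \<dots> = N (T.pmul (psec f) (psec (N (T.pmul (psec g) (psec h)))))"
  proof (rule N_cong)
    show "T.pmul (psec f) (T.pmul (psec g) (psec h)) - T.pmul (psec f) (psec (N (T.pmul (psec g) (psec h)))) \<in> I"
      using I_closed(7)[OF N(2)[OF gh], of "psec f"] assms by (simp add: T.pmul_diff_right)
  qed (use assms N gh in auto)
  also have "\<dots> = dmul f (dmul g h)"
    using assms N gh by (simp add: dmul_eq_N)
  finally show ?thesis .
qed

text \<open>The reduction prescribes the coefficient of t^0 as the projection, and
  \<open>proj\<close> is multiplicative with \<open>proj (sec r) = r\<close>.\<close>

lemma mu_0:
  assumes "r \<in> S.C" "s \<in> S.C"
  shows "\<mu> 0 r s = S.cmul r s"
proof -
  obtain y where y: "y \<in> pset S.C" "y 0 = proj (T.cmul (sec r) (sec s))" "mon 0 (T.cmul (sec r) (sec s)) - psec y \<in> I"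
    using section_reduction[OF T.cmul_closed] by blast
  have "N (mon 0 (T.cmul (sec r) (sec s))) = y" using y by (intro N_eqI sec_cmul_closed)
  then show ?thesis using y assms by (simp add: \<mu>_def proj_cmul sec_C proj_sec)
qed

text \<open>By uniqueness the normal form is the representative that
  \<open>section_reduction_graded\<close> provides, whose coefficients have the right
  degrees.\<close>

lemma mu_graded:
  assumes "r \<in> S_comp (int m)" "s \<in> S_comp (int k)"
  shows "\<mu> i r s \<in> S_comp (int m + int k - 2 * int i)"
proof -
  have "T.cmul (sec r) (sec s) \<in> T_comp (int (m + k))"
    using T_comp_cmul[OF sec_S_comp[OF assms(1)] sec_S_comp[OF assms(2)]] by simp
  then obtain y where y: "y \<in> pset S.C" "\<forall>i. y i \<in> S_comp (int (m + k) - 2 * int i)"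
      "mon 0 (T.cmul (sec r) (sec s)) - psec y \<in> I"
    using section_reduction_graded by blast
  have "N (mon 0 (T.cmul (sec r) (sec s))) = y" using y by (intro N_eqI sec_cmul_closed)
  then show ?thesis using y(2)[rule_format, of i] by (simp add: \<mu>_def)
qed

lemma is_deformation_mu: "is_deformation (symm_crossed G \<alpha>) \<mu>"
  unfolding is_deformation_def
  by (simp add: alg_bilinear_def symm_crossed_mult mu_0 mu_closed mu_add_left mu_add_right
      mu_csmult_left mu_csmult_right mu_finite D_mult dmul_assoc)

text \<open>Preservation of degree leaves only the empty word in \<open>\<sigma> 1\<close>, and the
  projection to S(V) determines its coefficient. This makes the section map respect units.\<close>

lemma sec_one: "sec (Poly_Mapping.single (mat 1) 1) = Poly_Mapping.single (mat 1) 1"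
proof -
  have "\<forall>k\<in>Poly_Mapping.keys (1 :: 'n symm). mono_degree k = 0" by (simp add: mono_degree_def)
  then have deg: "\<forall>w\<in>Poly_Mapping.keys (\<sigma> 1). word_degree w = 0"
    using \<sigma> unfolding graded_section_def by blast
  then have "Poly_Mapping.keys (\<sigma> 1) \<subseteq> {0}"
    by (auto simp: word_degree_def zero_free_word_def free_word.expand)
  then have c: "\<sigma> 1 = Poly_Mapping.single 0 (Poly_Mapping.lookup (\<sigma> 1) 0)"
    using poly_mapping_sum_single[of "{0}" "\<sigma> 1"] by simp
  have "mono_of_word 0 = 0" by (simp add: mono_of_word_def)
  then have "Poly_Mapping.single 0 (Poly_Mapping.lookup (\<sigma> 1) 0) = (1 :: 'n symm)"
    using \<sigma>_simps(3)[of 1] c tens_to_symm_single by metis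
  then have "Poly_Mapping.lookup (\<sigma> 1) 0 = 1"
    by (metis lookup_one_zero lookup_single_eq)
  then have "\<sigma> 1 = 1" using c by simp
  then show ?thesis by (simp add: sec_def map_single \<sigma>_simps)
qed

lemma alg_isomorphic_mu: "alg_isomorphic (hecke_quotient G \<alpha> a) D"
proof -
  let ?h = "\<lambda>f. I +>\<^bsub>poly_ext (tens_crossed G \<alpha>)\<^esub> psec f"
  note q = T.quot_alg_simps[OF ideal_I] T.coset_eq_iff[OF ideal_I]
  have hom: "?h \<in> ring_hom D (hecke_quotient G \<alpha> a)"
  proof (rule ring_hom_memI)
    fix f g assume "f \<in> carrier D" "g \<in> carrier D"
    then have fg: "f \<in> pset S.C" "g \<in> pset S.C" by simp_all
    have "T.pmul (psec f) (psec g) - psec (dmul f g) \<in> I"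
      using fg by (simp add: dmul_eq_N N)
    then have "psec (dmul f g) - T.pmul (psec f) (psec g) \<in> I"
      using I_closed(5) by force
    then show "?h (f \<otimes>\<^bsub>D\<^esub> g) = ?h f \<otimes>\<^bsub>hecke_quotient G \<alpha> a\<^esub> ?h g"
      using fg by (simp add: D_mult hecke_quotient_def q)
    show "?h (f \<oplus>\<^bsub>D\<^esub> g) = ?h f \<oplus>\<^bsub>hecke_quotient G \<alpha> a\<^esub> ?h g"
      using fg by (simp add: deformed_add hecke_quotient_def q psec_add)
  qed (auto simp: hecke_quotient_def q sec_one)
  have inj: "inj_on ?h (pset S.C)"
  proof (rule inj_onI)
    fix f g assume *: "f \<in> pset S.C" "g \<in> pset S.C" "?h f = ?h g"
    then have "psec (f - g) \<in> I" by (simp add: q psec_diff)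
    then show "f = g" using section_inj[of "f - g"] * by simp
  qed
  have surj: "?h ` pset S.C = carrier (hecke_quotient G \<alpha> a)"
  proof -
    have "\<exists>y\<in>pset S.C. I +>\<^bsub>poly_ext (tens_crossed G \<alpha>)\<^esub> f = ?h y" if "f \<in> pset T.C" for f
      using section_surj[OF that] that by (auto simp: q)
    then show ?thesis by (auto simp: hecke_quotient_def q(1))
  qed
  show ?thesis
  proof (rule alg_isomorphic_sym)
    show "?h \<in> ring_iso D (hecke_quotient G \<alpha> a)"
      using hom inj surj by (simp add: ring_iso_def bij_betw_def)
    have "\<one>\<^bsub>D\<^esub> \<in> pset S.C" using T.one_closed by (simp add: S.C_single)
    then show "\<one>\<^bsub>D\<^esub> \<in> carrier D" by simp
  qed (auto simp: deformed_smult deformed_add D_mult S.pset_C_psmult hecke_quotient_def q psec_psmult)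
qed

end

context hecke_setup
begin

lemma hecke_algebra_is_deformation:
  assumes "twisted_graded_Hecke G \<alpha> a"
  shows "\<exists>\<mu>. is_deformation (symm_crossed G \<alpha>) \<mu> \<and> deg_neg_two (symm_crossed_component G) \<mu> \<and>
    alg_isomorphic (hecke_quotient G \<alpha> a) (deformed_algebra (symm_crossed G \<alpha>) \<mu>)"
proof -
  from assms obtain \<sigma> where sg: "graded_section \<sigma>"
    "section_map G \<alpha> a \<sigma> \<in> mod_iso (poly_ext (symm_crossed G \<alpha>)) (hecke_quotient G \<alpha> a)"
    by (auto simp: twisted_graded_Hecke_def)
  interpret hecke_section G \<alpha> a \<sigma>
    by unfold_locales (rule sg)
  have map: "section_map G \<alpha> a \<sigma> f = I +>\<^bsub>poly_ext (tens_crossed G \<alpha>)\<^esub> psec f" for f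
    by (simp add: section_map_def psec_def sec_def)
  have inj: "inj_on (section_map G \<alpha> a \<sigma>) (pset S.C)"
    using sg(2) S.P_simps(1) by (simp add: mod_iso_def bij_betw_def)
  interpret hecke_iso G \<alpha> a \<sigma>
  proof
    fix y assume y: "y \<in> pset S.C" "psec y \<in> I"
    then have "section_map G \<alpha> a \<sigma> y = section_map G \<alpha> a \<sigma> 0"
      by (simp add: map T.coset_eq_iff[OF ideal_I])
    then show "y = 0" using inj y by (auto dest: inj_onD)
  qed
  have "deg_neg_two (symm_crossed_component G) \<mu>"
    using mu_graded by (simp add: deg_neg_two_def)
  then show ?thesis using is_deformation_mu alg_isomorphic_mu by blast
qed

end

section \<open>Deformations are Hecke algebras\<close>

declare One_nat_def [simp del]

lemma psc_apply: "psc c f n = csmult c (f n)"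
  by (simp add: psc_def)

lemma mono_degree_add: "mono_degree (k + l) = mono_degree k + mono_degree l"
  by (simp add: mono_degree_def lookup_add sum.distrib)

lemma mono_degree_single [simp]: "mono_degree (Poly_Mapping.single i n) = n"
proof -
  have "mono_degree (Poly_Mapping.single i n) = (\<Sum>j\<in>UNIV. if j = i then n else 0)"
    unfolding mono_degree_def by (intro sum.cong) (auto simp: lookup_single)
  then show ?thesis by simp
qed

lemma mono_degree_eq_0_iff: "mono_degree k = 0 \<longleftrightarrow> k = 0"
  by (auto simp: mono_degree_def poly_mapping_eq_iff fun_eq_iff)

lemma pset_sum_mon:
  assumes "f \<in> pset C"
  obtains n where "f = (\<Sum>i<n. mon i (f i))" "\<And>i. i \<ge> n \<Longrightarrow> f i = 0"
proof -
  from assms obtain N where N: "\<forall>i>N. f i = 0" by (auto simp: pset_def)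
  have "f = (\<Sum>i<Suc N. mon i (f i))"
  proof
    fix n
    have "(\<Sum>i<Suc N. mon i (f i)) n = (\<Sum>i<Suc N. if i = n then f n else 0)"
      unfolding sum_apply by (intro sum.cong) (auto simp: mon_def)
    then show "f n = (\<Sum>i<Suc N. mon i (f i)) n" using N by auto
  qed
  then show ?thesis using that[of "Suc N"] N by auto
qed

locale deformation = hecke_setup G \<alpha>
  for G :: "(complex^'n^'n) set" and \<alpha> :: "complex^'n^'n \<Rightarrow> complex^'n^'n \<Rightarrow> complex" +
  fixes \<mu> :: "nat \<Rightarrow> (complex^'n^'n \<Rightarrow>\<^sub>0 'n symm) \<Rightarrow> (complex^'n^'n \<Rightarrow>\<^sub>0 'n symm) \<Rightarrow> (complex^'n^'n \<Rightarrow>\<^sub>0 'n symm)"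
  assumes deformation: "is_deformation (symm_crossed G \<alpha>) \<mu>"
    and deg: "deg_neg_two (symm_crossed_component G) \<mu>"
begin

lemma mu_0: "r \<in> S.C \<Longrightarrow> s \<in> S.C \<Longrightarrow> \<mu> 0 r s = S.cmul r s"
  using deformation by (simp add: is_deformation_def symm_crossed_mult)

sublocale bilinear_family G \<alpha> \<mu>
proof
  have bil: "i \<ge> 1 \<Longrightarrow> alg_bilinear (symm_crossed G \<alpha>) (\<mu> i)" for i
    using deformation by (simp add: is_deformation_def)
  fix i c r r' s s' assume "r \<in> S.C" "s \<in> S.C"
  note rs = this
  show "\<mu> i r s \<in> S.C" "\<mu> i (csmult c r) s = csmult c (\<mu> i r s)" "\<mu> i r (csmult c s) = csmult c (\<mu> i r s)"
    using rs bil[of i] by (cases i; simp add: alg_bilinear_def mu_0 S.cmul_closed S.cmul_csmult S.C_csmult)+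
  show "\<mu> i (r + r') s = \<mu> i r s + \<mu> i r' s" if "r' \<in> S.C"
    using that rs bil[of i] by (cases i; simp add: alg_bilinear_def mu_0 S.C_add S.cmul_add_left)
  show "\<mu> i r (s + s') = \<mu> i r s + \<mu> i r s'" if "s' \<in> S.C"
    using that rs bil[of i] by (cases i; simp add: alg_bilinear_def mu_0 S.C_add S.cmul_add_right)
  show "\<exists>p. \<forall>i>p. \<mu> i r s = 0"
    using rs deformation by (simp add: is_deformation_def)
qed

lemma dmul_assoc:
  assumes "f \<in> pset S.C" "g \<in> pset S.C" "h \<in> pset S.C"
  shows "dmul (dmul f g) h = dmul f (dmul g h)"
  using deformation assms by (simp add: is_deformation_def D_mult)

lemma mu_graded:
  assumes "r \<in> S_comp (int m)" "s \<in> S_comp (int k)" "i \<ge> 1"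
  shows "\<mu> i r s \<in> S_comp (int m + int k - 2 * int i)"
  using deg assms by (simp add: deg_neg_two_def)

section \<open>Degrees of products in a deformation\<close>

abbreviation gb :: "complex^'n^'n \<Rightarrow> nat \<Rightarrow> complex^'n^'n \<Rightarrow>\<^sub>0 'n symm" where
  "gb g \<equiv> mon 0 (Poly_Mapping.single g 1)"

abbreviation vc :: "complex^'n \<Rightarrow> complex^'n^'n \<Rightarrow>\<^sub>0 'n symm" where
  "vc v \<equiv> Poly_Mapping.single (mat 1) (symm_vec v)"

abbreviation ec :: "'n \<Rightarrow> complex^'n^'n \<Rightarrow>\<^sub>0 'n symm" where
  "ec i \<equiv> Poly_Mapping.single (mat 1) (sgen i)"

lemma one_in_G: "mat 1 \<in> G"
  using T.one_closed .

lemma gb_comp: "g \<in> G \<Longrightarrow> Poly_Mapping.single g 1 \<in> S_comp (int 0)"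
  by (auto simp: symm_crossed_component_def lookup_single when_def mono_degree_def)

lemma vc_comp: "vc v \<in> S_comp (int 1)"
  using one_in_G by (auto simp: symm_crossed_component_def lookup_single when_def symm_vec_def
    simp del: One_nat_def dest!: subsetD[OF keys_sum] split: if_splits)

lemma ec_comp: "ec i \<in> S_comp (int 1)"
  using vc_comp[of "axis i 1"] by (simp only: symm_vec_axis)

lemma gb_closed [simp, intro]: "g \<in> G \<Longrightarrow> gb g \<in> pset S.C"
  using gb_comp S_compD by blast

lemma vc_closed [simp, intro]: "mon 0 (vc v) \<in> pset S.C"
  using vc_comp S_compD by blast

lemma ec_closed [simp, intro]: "mon 0 (ec i) \<in> pset S.C"
  using ec_comp S_compD by blast

lemma lookup_cmul_one:
  assumes "x \<in> S.C"
  shows "Poly_Mapping.lookup (S.cmul (Poly_Mapping.single (mat 1) p) x) h = p * Poly_Mapping.lookup x h"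
  using assms
proof (induction x rule: S.C_induct)
  case (single g k c)
  then show ?case using one_in_G
    by (simp add: S.cmul_single S.cocycle_simps S.act_one lookup_single when_def)
qed (simp_all add: S.cmul_add_right lookup_add distrib_left)

text \<open>\<open>deg_neg_two\<close> concerns i >= 1 only. This supplies the degree of the
  undeformed product, for a generator as left factor.\<close>

lemma ec_cmul_comp:
  assumes "x \<in> S_comp k"
  shows "S.cmul (ec i) x \<in> S_comp (k + 1)"
proof -
  have "int (mono_degree l) = k + 1"
    if l: "l \<in> Poly_Mapping.keys (Poly_Mapping.lookup (S.cmul (ec i) x) g)" for g l
  proof -
    from l obtain b where b: "b \<in> Poly_Mapping.keys (Poly_Mapping.lookup x g)" "l = Poly_Mapping.single i 1 + b"
      using keys_mult[of "sgen i" "Poly_Mapping.lookup x g"]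
      by (auto simp: lookup_cmul_one[OF S_compD[OF assms]])
    then show ?thesis using assms by (auto simp: symm_crossed_component_def mono_degree_add)
  qed
  then show ?thesis using S.cmul_closed[of "ec i" x] by (auto simp: symm_crossed_component_def S.C_def)
qed

text \<open>Homogeneity of degree k in R[t] when t has degree 2.\<close>

definition graded :: "int \<Rightarrow> (nat \<Rightarrow> complex^'n^'n \<Rightarrow>\<^sub>0 'n symm) \<Rightarrow> bool" where
  "graded k f \<longleftrightarrow> f \<in> pset S.C \<and> (\<forall>i. f i \<in> S_comp (k - 2 * int i))"

lemma graded_add: "graded k f \<Longrightarrow> graded k f' \<Longrightarrow> graded k (f + f')"
  unfolding graded_def by (intro conjI allI) (use S_comp_add in \<open>auto simp: plus_fun_apply\<close>)

lemma graded_zero: "graded k 0"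
  unfolding graded_def by (simp add: zero_fun_apply[of "_ :: nat"])

lemma graded_psc: "graded k f \<Longrightarrow> graded k (psc c f)"
  using S.pset_C_psc[of f c] by (simp add: graded_def psc_apply[of c f] S_comp_csmult)

lemma dmul_const_left:
  assumes "r \<in> S.C" "f \<in> pset S.C"
  shows "dmul (mon 0 r) f n = (\<Sum>i\<le>n. \<mu> i r (f (n - i)))"
  unfolding dmul_def
proof (rule sum.cong[OF refl])
  fix i assume "i \<in> {..n}"
  have "(\<Sum>j\<le>n - i. \<mu> i (mon 0 r j) (f (n - i - j))) = (\<Sum>j\<le>n - i. if j = 0 then \<mu> i r (f (n - i)) else 0)"
    using assms by (intro sum.cong) (auto simp: mon_def S.pset_CD)
  then show "(\<Sum>j\<le>n - i. \<mu> i (mon 0 r j) (f (n - i - j))) = \<mu> i r (f (n - i))" by simp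
qed

lemma graded_dmul_ec:
  assumes "graded k f"
  shows "graded (k + 1) (dmul (mon 0 (ec i)) f)"
  unfolding graded_def
proof (intro conjI allI)
  have f: "f \<in> pset S.C" using assms by (simp add: graded_def)
  then show "dmul (mon 0 (ec i)) f \<in> pset S.C" by auto
  fix n
  have "\<mu> j (ec i) (f (n - j)) \<in> S_comp (k + 1 - 2 * int n)" if "j \<le> n" for j
  \<comment> \<open>\<open>mu_graded\<close> speaks of natural degrees, so coefficients of negative
    degree, which vanish, are treated apart.\<close>
  proof (cases "k - 2 * int (n - j) < 0")
    case True
    then have "f (n - j) = 0"
      using assms by (intro S_comp_neg[of "f (n - j)" "k - 2 * int (n - j)"]) (auto simp: graded_def)
    then show ?thesis using S_compD[OF ec_comp] by simp
  next
    case False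
    then obtain m where m: "int m = k - 2 * int (n - j)" by (metis nonneg_int_cases not_less)
    then have fm: "f (n - j) \<in> S_comp (int m)" using assms by (simp add: graded_def)
    show ?thesis
    proof (cases "j = 0")
      case True
      then show ?thesis
        using ec_cmul_comp[OF fm, of i] m S_compD[OF ec_comp] S_compD[OF fm] by (simp add: mu_0 algebra_simps)
    next
      case False
      \<comment> \<open>A larger j lowers the degree by more but starts from a coefficient of higher
        degree; the two effects cancel, and the result depends on n alone.\<close>
      have "int 1 + int m - 2 * int j = k + 1 - 2 * int n" using m that by (simp add: of_nat_diff)
      then show ?thesis using mu_graded[OF ec_comp fm, of j i] False by (metis One_nat_def less_one not_le)
    qed
  qed
  then show "dmul (mon 0 (ec i)) f n \<in> S_comp (k + 1 - 2 * int n)"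
    unfolding dmul_const_left[OF S_compD[OF ec_comp] f] by (intro S_comp_sum) auto
qed

lemma dmul_low_degree:
  assumes "r \<in> S_comp (int m)" "s \<in> S_comp (int k)" "m + k < 2"
  shows "dmul (mon 0 r) (mon 0 s) = mon 0 (S.cmul r s)"
proof
  fix i
  note rs = S_compD[OF assms(1)] S_compD[OF assms(2)]
  have "\<mu> i r s = 0" if "i \<ge> 1"
    using mu_graded[OF assms(1,2) that] assms(3) that by (intro S_comp_neg) auto
  then show "dmul (mon 0 r) (mon 0 s) i = mon 0 (S.cmul r s) i"
    using rs by (cases "i = 0") (simp_all add: dmul_mon mu_0, simp add: mon_def)
qed

text \<open>
  \<open>T(V)\<close> acts on \<open>R[t]\<close>, the generators by left multiplication in the deformed algebra. Working with this action instead
  of an algebra map from \<open>T(V)\<close> avoids the unit of the deformed algebra, which is not part of the hypotheses.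
\<close>

definition wact :: "'n list \<Rightarrow> (nat \<Rightarrow> complex^'n^'n \<Rightarrow>\<^sub>0 'n symm) \<Rightarrow> nat \<Rightarrow> complex^'n^'n \<Rightarrow>\<^sub>0 'n symm" where
  "wact xs f = foldr (\<lambda>i. dmul (mon 0 (ec i))) xs f"

definition tact :: "'n tens \<Rightarrow> (nat \<Rightarrow> complex^'n^'n \<Rightarrow>\<^sub>0 'n symm) \<Rightarrow> nat \<Rightarrow> complex^'n^'n \<Rightarrow>\<^sub>0 'n symm" where
  "tact p f = (\<Sum>w\<in>Poly_Mapping.keys p. psc (Poly_Mapping.lookup p w) (wact (letters w) f))"

lemma wact_simps [simp]: "wact [] f = f" "wact (i # xs) f = dmul (mon 0 (ec i)) (wact xs f)"
  "wact (xs @ ys) f = wact xs (wact ys f)"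
  by (simp_all add: wact_def)

lemma wact_closed [simp, intro]: "f \<in> pset S.C \<Longrightarrow> wact xs f \<in> pset S.C"
  by (induction xs) auto

lemma wact_add: "f \<in> pset S.C \<Longrightarrow> g \<in> pset S.C \<Longrightarrow> wact xs (f + g) = wact xs f + wact xs g"
  by (induction xs) (simp_all add: dmul_add_right)

lemma wact_zero [simp]: "wact xs 0 = 0"
  by (induction xs) simp_all

lemma wact_psc: "f \<in> pset S.C \<Longrightarrow> wact xs (psc c f) = psc c (wact xs f)"
  by (induction xs) (simp_all add: dmul_psc_right)

lemma wact_dmul: "f \<in> pset S.C \<Longrightarrow> g \<in> pset S.C \<Longrightarrow> wact xs (dmul f g) = dmul (wact xs f) g"
  by (induction xs) (simp_all add: dmul_assoc)

lemma wact_graded: "graded k f \<Longrightarrow> graded (k + int (length xs)) (wact xs f)"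
proof (induction xs)
  case (Cons i xs)
  then show ?case using graded_dmul_ec[of "k + int (length xs)" "wact xs f" i] by (simp add: add_ac)
qed simp

lemma tact_single [simp]: "tact (Poly_Mapping.single w c) f = psc c (wact (letters w) f)"
  by (simp add: tact_def)

lemma tact_zero [simp]: "tact 0 f = 0"
  by (simp add: tact_def)

lemma tact_add_left: "tact (p + q) f = tact p f + tact q f"
  unfolding tact_def by (rule setsum_keys_plus_distrib) (simp_all add: psc_add_left)

lemma tact_sum_left: "tact (\<Sum>a\<in>A. p a) f = (\<Sum>a\<in>A. tact (p a) f)"
  by (induction A rule: infinite_finite_induct) (simp_all add: tact_add_left)

lemma tact_closed [simp, intro]: "f \<in> pset S.C \<Longrightarrow> tact p f \<in> pset S.C"
  by (induction p rule: poly_mapping_single_induct_UNIV) (simp_all add: tact_add_left)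

lemma tact_psc: "f \<in> pset S.C \<Longrightarrow> tact p (psc c f) = psc c (tact p f)"
  by (induction p rule: poly_mapping_single_induct_UNIV)
    (simp_all add: tact_add_left wact_psc psc_add psc_psc mult.commute)

text \<open>T(V) acts by left multiplications, and these commute with right multiplications by
  associativity.\<close>

lemma tact_dmul: "f \<in> pset S.C \<Longrightarrow> g \<in> pset S.C \<Longrightarrow> tact p (dmul f g) = dmul (tact p f) g"
  by (induction p rule: poly_mapping_single_induct_UNIV)
    (simp_all add: tact_add_left wact_dmul dmul_add_left dmul_psc_left)

lemma tact_mult:
  assumes "f \<in> pset S.C"
  shows "tact (p * q) f = tact p (tact q f)"
proof (induction p rule: poly_mapping_single_induct_UNIV)
  case (single w c)
  show ?case using assms
    by (induction q rule: poly_mapping_single_induct_UNIV)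
      (simp_all add: distrib_left tact_add_left wact_add wact_psc psc_add mult_single psc_psc)
qed (simp_all add: distrib_right tact_add_left)

lemma tact_const: "tact (Poly_Mapping.single 0 c) f = psc c f"
  by simp

lemma tact_const_mult: "f \<in> pset S.C \<Longrightarrow> tact (Poly_Mapping.single 0 c * p) f = psc c (tact p f)"
  by (simp add: tact_mult)

lemma tact_vec:
  assumes "f \<in> pset S.C"
  shows "tact (tens_vec v) f = dmul (mon 0 (vc v)) f"
proof -
  have e: "psc (v $ i) (mon 0 (ec i)) = mon 0 (Poly_Mapping.single (mat 1) (Poly_Mapping.single (Poly_Mapping.single i 1) (v $ i)))" for i
    by (simp add: const_mult_single)
  have "mon 0 (vc v) = (\<Sum>i\<in>UNIV. psc (v $ i) (mon 0 (ec i)))"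
    unfolding e by (simp add: symm_vec_def single_sum mon_sum)
  then show ?thesis using assms
    by (simp add: tens_vec_def tact_sum_left dmul_sum_left dmul_psc_left del: psc_mon)
qed

text \<open>Both products have total degree 1, so neither is deformed, and the commutation rule of
  the crossed product survives.\<close>

lemma gb_vec:
  assumes "g \<in> G"
  shows "dmul (gb g) (mon 0 (ec i)) = dmul (mon 0 (vc (g *v axis i 1))) (gb g)"
proof -
  have "dmul (gb g) (mon 0 (ec i)) = mon 0 (S.cmul (Poly_Mapping.single g 1) (ec i))"
    by (rule dmul_low_degree[OF gb_comp[OF assms] ec_comp]) simp
  moreover have "dmul (mon 0 (vc (g *v axis i 1))) (gb g) = mon 0 (S.cmul (vc (g *v axis i 1)) (Poly_Mapping.single g 1))"
    by (rule dmul_low_degree[OF vc_comp gb_comp[OF assms]]) simp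
  moreover have "S.cmul (Poly_Mapping.single g 1) (ec i) = S.cmul (vc (g *v axis i 1)) (Poly_Mapping.single g 1)"
    using assms one_in_G
    by (simp add: S.cmul_single S.cocycle_simps S.act_one symm_act_gen del: One_nat_def)
  ultimately show ?thesis by simp
qed

text \<open>Moving g past one letter after the other by \<open>gb_vec\<close> turns each letter into
  its image under g.\<close>

lemma gb_tact:
  assumes "g \<in> G" "f \<in> pset S.C"
  shows "dmul (gb g) (tact q f) = tact (tens_act g q) (dmul (gb g) f)"
proof (induction q rule: poly_mapping_single_induct_UNIV)
  case (single w c)
  have *: "dmul (gb g) (wact xs f) = tact (tens_act g (Poly_Mapping.single (Word xs) 1)) (dmul (gb g) f)" for xs
  proof (induction xs)
    case Nil
    have "Poly_Mapping.single (Word []) 1 = (1 :: 'n tens)" by (simp add: single_Word_Nil)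
    then show ?case
      using tact_single[of 0 1 "dmul (gb g) f"] by (simp add: alg_map_one[OF alg_map_tens_act])
  next
    case (Cons i xs)
    let ?q = "tens_act g (Poly_Mapping.single (Word xs) 1)"
    have "dmul (gb g) (wact (i # xs) f) = dmul (dmul (mon 0 (vc (g *v axis i 1))) (gb g)) (wact xs f)"
      using assms by (simp add: dmul_assoc flip: gb_vec)
    also have "\<dots> = tact (tens_vec (g *v axis i 1)) (tact ?q (dmul (gb g) f))"
      using assms by (simp add: dmul_assoc Cons tact_vec)
    also have "\<dots> = tact (tens_act g (gen i * Poly_Mapping.single (Word xs) 1)) (dmul (gb g) f)"
      using assms by (simp add: tact_mult alg_map_mult[OF alg_map_tens_act] tens_act_gen del: mult_single)
    finally show ?case by (simp only: single_Word_Cons[of i xs])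
  qed
  have "Poly_Mapping.single w c = Poly_Mapping.single 0 c * Poly_Mapping.single (Word (letters w)) 1"
    by (simp add: const_mult_single)
  then have "tens_act g (Poly_Mapping.single w c) = Poly_Mapping.single 0 c * tens_act g (Poly_Mapping.single (Word (letters w)) 1)"
    by (simp only: alg_map_mult[OF alg_map_tens_act] alg_map_const[OF alg_map_tens_act])
  then show ?case
    using assms *[of "letters w"] by (simp add: tact_const_mult dmul_psc_right)
qed (use assms in \<open>simp_all add: dmul_add_right tact_add_left alg_map_add[OF alg_map_tens_act]
    alg_map_zero[OF alg_map_tens_act]\<close>)

section \<open>The homomorphism to the deformed algebra\<close>

definition phi0 :: "(complex^'n^'n \<Rightarrow>\<^sub>0 'n tens) \<Rightarrow> nat \<Rightarrow> complex^'n^'n \<Rightarrow>\<^sub>0 'n symm" where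
  "phi0 x = (\<Sum>g\<in>G. tact (Poly_Mapping.lookup x g) (gb g))"

lemma phi0_closed [simp, intro]: "phi0 x \<in> pset S.C"
  unfolding phi0_def by (intro S.pset_C_sum) auto

lemma phi0_add: "phi0 (x + y) = phi0 x + phi0 y"
  by (simp add: phi0_def lookup_add tact_add_left sum.distrib)

lemma phi0_zero [simp]: "phi0 0 = 0"
  by (simp add: phi0_def)

lemma phi0_sum: "phi0 (\<Sum>a\<in>A. x a) = (\<Sum>a\<in>A. phi0 (x a))"
  by (induction A rule: infinite_finite_induct) (simp_all add: phi0_add)

lemma phi0_csmult: "phi0 (csmult c x) = psc c (phi0 x)"
  by (simp add: phi0_def psc_sum tact_const_mult cong: sum.cong)

lemma phi0_single:
  assumes "g \<in> G"
  shows "phi0 (Poly_Mapping.single g p) = tact p (gb g)"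
proof -
  have "phi0 (Poly_Mapping.single g p) = (\<Sum>h\<in>G. if h = g then tact p (gb g) else 0)"
    unfolding phi0_def by (intro sum.cong) (auto simp: lookup_single when_def)
  then show ?thesis using assms finite_G by simp
qed

lemma gb_mult:
  assumes "g \<in> G" "h \<in> G"
  shows "dmul (gb g) (gb h) = psc (\<alpha> g h) (gb (g ** h))"
proof -
  have "dmul (gb g) (gb h) = mon 0 (S.cmul (Poly_Mapping.single g 1) (Poly_Mapping.single h 1))"
    by (rule dmul_low_degree[OF gb_comp[OF assms(1)] gb_comp[OF assms(2)]]) simp
  then show ?thesis using assms by (simp add: S.cmul_single alg_map_one[OF S.alg_map_act])
qed

text \<open>On terms p g and q h, \<open>gb_tact\<close> moves g past q, \<open>gb_mult\<close>
  turns the product of g and h into \<alpha>(g,h) times gh, and \<open>tact_dmul\<close> moves the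
  action of p across the product.\<close>

lemma phi0_cmul:
  assumes "x \<in> T.C" "y \<in> T.C"
  shows "phi0 (T.cmul x y) = dmul (phi0 x) (phi0 y)"
  using assms(1)
proof (induction x rule: T.C_induct)
  case (single g k c)
  note g = this
  show ?case using assms(2)
  proof (induction y rule: T.C_induct)
    case (single h l d)
    let ?p = "Poly_Mapping.single k c" and ?q = "Poly_Mapping.single l d"
    have gh: "g ** h \<in> G" using g single T.m_closed by simp
    have "phi0 (T.cmul (Poly_Mapping.single g ?p) (Poly_Mapping.single h ?q)) =
        psc (\<alpha> g h) (tact ?p (tact (tens_act g ?q) (gb (g ** h))))"
      using g single gh
      by (simp add: T.cmul_single phi0_single tact_const tact_mult del: mult_single tact_single)
    also have "\<dots> = tact ?p (tact (tens_act g ?q) (dmul (gb g) (gb h)))"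
      using g single gh by (simp add: gb_mult tact_psc del: tact_single psc_mon)
    also have "\<dots> = tact ?p (dmul (gb g) (tact ?q (gb h)))"
      using g single by (simp add: gb_tact del: tact_single)
    also have "\<dots> = dmul (tact ?p (gb g)) (tact ?q (gb h))"
      using g single by (simp add: tact_dmul del: tact_single)
    finally show ?case using g single by (simp add: phi0_single del: tact_single)
  qed (simp_all add: T.cmul_add_right phi0_add dmul_add_right)
qed (simp_all add: T.cmul_add_left phi0_add dmul_add_left)

lemma phi0_comp:
  assumes "x \<in> T_comp m"
  shows "graded m (phi0 x)"
  using assms
proof (induction x rule: T_comp_induct)
  case (single g w c)
  have "graded 0 (gb g)"
    unfolding graded_def
  proof (intro conjI allI)
    show "gb g i \<in> S_comp (0 - 2 * int i)" for i
      using single gb_comp[of g] by (simp add: mon_def)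
  qed (use single in auto)
  from wact_graded[OF this, of "letters w"] have "graded m (wact (letters w) (gb g))"
    using single by (simp add: word_degree_def)
  then show ?case
    using single by (simp add: phi0_single graded_psc)
next
  case (add x y)
  then show ?case
    by (simp add: phi0_add graded_add)
qed (simp add: graded_zero)

text \<open>At t = 0 a generator multiplies by \<open>S.cmul\<close>, so a word becomes the product
  of its letters in S(V).\<close>

lemma phi0_const:
  assumes "x \<in> T.C"
  shows "phi0 x 0 = proj x"
  using assms
proof (induction x rule: T.C_induct)
  case (single g w c)
  have "wact xs (gb g) 0 = Poly_Mapping.single g (tens_to_symm (Poly_Mapping.single (Word xs) 1))" for xs
  proof (induction xs)
    case Nil
    show ?case by (simp add: single_Word_Nil alg_map_one[OF alg_map_tens_to_symm] del: tens_to_symm_single)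
  next
    case (Cons i xs)
    have "wact (i # xs) (gb g) 0 = S.cmul (ec i) (wact xs (gb g) 0)"
      using single S_compD[OF ec_comp] by (simp add: dmul_const_left mu_0 S.pset_CD)
    also have "\<dots> = Poly_Mapping.single g (sgen i * tens_to_symm (Poly_Mapping.single (Word xs) 1))"
      using single one_in_G by (simp add: Cons S.cmul_single S.cocycle_simps S.act_one)
    also have "sgen i * tens_to_symm (Poly_Mapping.single (Word xs) 1) = tens_to_symm (Poly_Mapping.single (Word (i # xs)) 1)"
      by (simp only: single_Word_Cons[of i xs] alg_map_mult[OF alg_map_tens_to_symm] tens_to_symm_gen)
    finally show ?case .
  qed
  from this[of "letters w"] show ?case
    using single by (simp add: phi0_single psc_def const_mult_single)
qed (simp_all add: phi0_add proj_add plus_fun_apply zero_fun_apply)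

text \<open>The C[t]-linear extension of \<open>phi0\<close>.\<close>

definition phi :: "(nat \<Rightarrow> complex^'n^'n \<Rightarrow>\<^sub>0 'n tens) \<Rightarrow> nat \<Rightarrow> complex^'n^'n \<Rightarrow>\<^sub>0 'n symm" where
  "phi f = (\<lambda>n. \<Sum>i\<le>n. phi0 (f i) (n - i))"

lemma phi_mon [simp]: "phi (mon i x) = tshift i (phi0 x)"
proof
  fix n
  have "phi (mon i x) n = (\<Sum>j\<le>n. if j = i then phi0 x (n - i) else 0)"
    unfolding phi_def by (intro sum.cong) (auto simp: mon_def zero_fun_apply)
  then show "phi (mon i x) n = tshift i (phi0 x) n" by (auto simp: tshift_def)
qed

lemma phi_add: "phi (f + g) = phi f + phi g"
  by (simp add: phi_def pointwise phi0_add sum.distrib)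

lemma phi_zero [simp]: "phi 0 = 0"
  by (simp add: phi_def pointwise)

lemma phi_diff: "phi (f - g) = phi f - phi g"
  using phi_add[of "f - g" g] by (simp add: eq_diff_eq)

lemma phi_closed [simp, intro]: "f \<in> pset T.C \<Longrightarrow> phi f \<in> pset S.C"
  by (induction f rule: T.pset_C_induct) (simp_all add: phi_add)

lemma phi_psc: "f \<in> pset T.C \<Longrightarrow> phi (psc c f) = psc c (phi f)"
  by (induction f rule: T.pset_C_induct) (simp_all add: phi_add psc_add phi0_csmult psc_tshift)

lemma phi_tshift: "f \<in> pset T.C \<Longrightarrow> phi (tshift k f) = tshift k (phi f)"
  by (induction f rule: T.pset_C_induct) (simp_all add: phi_add tshift_add tshift_tshift)

lemma phi_psmult: "f \<in> pset T.C \<Longrightarrow> phi (psmult p f) = psmult p (phi f)"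
  by (rule psmult_commute[where J = "pset T.C"]) (auto simp: phi_add phi_psc phi_tshift)

lemma phi_mult:
  assumes "f \<in> pset T.C" "g \<in> pset T.C"
  shows "phi (T.pmul f g) = dmul (phi f) (phi g)"
  using assms(1)
proof (induction f rule: T.pset_C_induct)
  case (mon i x)
  show ?case using assms(2)
  proof (induction g rule: T.pset_C_induct)
    case (mon j y)
    then show ?case using \<open>x \<in> T.C\<close>
      by (simp add: T.pmul_mon phi0_cmul dmul_tshift tshift_tshift add.commute)
  qed (use mon in \<open>simp_all add: T.pmul_add_right phi_add dmul_add_right\<close>)
qed (use assms(2) in \<open>simp_all add: T.pmul_add_left phi_add dmul_add_left\<close>)

text \<open>The antisymmetrized \<open>\<mu> 1\<close> has degree 1 + 1 - 2 = 0 on V, so its values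
  lie in the group algebra; the form is the coefficient there of g.\<close>

definition form :: "complex^'n^'n \<Rightarrow> complex^'n \<Rightarrow> complex^'n \<Rightarrow> complex" where
  "form g v w = Poly_Mapping.lookup (Poly_Mapping.lookup (\<mu> 1 (vc v) (vc w) - \<mu> 1 (vc w) (vc v)) g) 0"

lemma vc_C: "vc v \<in> S.C"
  using S_compD[OF vc_comp] .

lemma vc_add: "vc (v + w) = vc v + vc w"
  by (simp add: symm_vec_def single_add sum.distrib)

lemma vc_scale: "vc (c *s v) = csmult c (vc v)"
  by (simp add: symm_vec_def sum_distrib_left const_mult_single)

lemma skew_bilinear_form: "skew_bilinear (form g)"
proof -
  have "form g (v + v') w = form g v w + form g v' w" "form g v (w + w') = form g v w + form g v w'" for v v' w w'
    using vc_C by (simp_all only: form_def vc_add mu_add_left mu_add_right lookup_minus lookup_add) simp_all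
  moreover have "form g (c *s v) w = c * form g v w" "form g v (c *s w) = c * form g v w" for c v w
    using vc_C by (simp_all only: form_def vc_scale mu_csmult_left mu_csmult_right lookup_minus lookup_csmult
        lookup_const_mult) (simp_all add: right_diff_distrib)
  ultimately have "\<forall>w. Vector_Spaces.linear (*s) (*) (\<lambda>v. form g v w)" "\<forall>v. Vector_Spaces.linear (*s) (*) (form g v)"
    by (simp_all add: Vector_Spaces.linear_iff vec.vector_space_axioms vector_space_over_itself.vector_space_axioms)
  moreover have "form g v w = - form g w v" for v w
    by (simp add: form_def lookup_minus)
  ultimately show ?thesis
    unfolding skew_bilinear_def by blast
qed

lemma S_comp_0_expand:
  assumes "r \<in> S_comp 0"
  shows "r = (\<Sum>g\<in>G. Poly_Mapping.single g (Poly_Mapping.single 0 (Poly_Mapping.lookup (Poly_Mapping.lookup r g) 0)))"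
proof -
  have "Poly_Mapping.keys (Poly_Mapping.lookup r g) \<subseteq> {0}" for g
    using assms by (auto simp: symm_crossed_component_def mono_degree_eq_0_iff)
  then have "Poly_Mapping.single 0 (Poly_Mapping.lookup (Poly_Mapping.lookup r g) 0) = Poly_Mapping.lookup r g" for g
    using poly_mapping_sum_single[of "{0}" "Poly_Mapping.lookup r g"] by simp
  then show ?thesis
    using poly_mapping_sum_single[OF finite_G, of r] assms by (simp add: symm_crossed_component_def)
qed

text \<open>On two vectors \<open>\<mu> i\<close> has degree 2 - 2 i, hence vanishes for i >=
  2.\<close>

lemma vec_mult:
  "phi0 (Poly_Mapping.single (mat 1) (tens_vec v * tens_vec w)) = mon 0 (S.cmul (vc v) (vc w)) + mon 1 (\<mu> 1 (vc v) (vc w))"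
proof -
  \<comment> \<open>That the identity of G is a right unit for a vector is again a matter of
    degree.\<close>
  have "dmul (mon 0 (vc w)) (gb (mat 1)) = mon 0 (S.cmul (vc w) (Poly_Mapping.single (mat 1) 1))"
    by (rule dmul_low_degree[OF vc_comp gb_comp[OF one_in_G]]) simp
  then have "phi0 (Poly_Mapping.single (mat 1) (tens_vec v * tens_vec w)) = dmul (mon 0 (vc v)) (mon 0 (vc w))"
    using one_in_G by (simp add: phi0_single tact_mult tact_vec S.cmul_one vc_C)
  also have "\<dots> = (\<lambda>i. \<mu> i (vc v) (vc w))" using vc_C by (simp add: dmul_mon)
  also have "\<dots> = mon 0 (S.cmul (vc v) (vc w)) + mon 1 (\<mu> 1 (vc v) (vc w))"
  proof
    fix i
    have "\<mu> i (vc v) (vc w) = 0" if "i \<ge> 2"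
      using mu_graded[OF vc_comp vc_comp, of i v w] that by (intro S_comp_neg) auto
    moreover have "i = 0 \<or> i = 1 \<or> i \<ge> 2" by auto
    ultimately show "\<mu> i (vc v) (vc w) = (mon 0 (S.cmul (vc v) (vc w)) + mon 1 (\<mu> 1 (vc v) (vc w))) i"
      using vc_C by (auto simp: mu_0 mon_def plus_fun_apply)
  qed
  finally show ?thesis .
qed

section \<open>The kernel of the homomorphism\<close>

sublocale hecke_section G \<alpha> form ordered_section
  by unfold_locales (rule graded_section_ordered_section)

text \<open>The parts without t cancel because S(V) is commutative, and the remaining multiple of t
  is the one from which \<open>form\<close> was read off.\<close>

lemma phi_relation: "phi (hecke_relation G \<alpha> form v w) = 0"
proof -
  let ?d = "\<mu> 1 (vc v) (vc w) - \<mu> 1 (vc w) (vc v)"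
  have "?d \<in> S_comp 0"
    using S_comp_add[OF mu_graded[OF vc_comp vc_comp, of 1 v w] S_comp_minus[OF mu_graded[OF vc_comp vc_comp, of 1 w v]]]
    by simp
  then have d: "?d = (\<Sum>g\<in>G. Poly_Mapping.single g (Poly_Mapping.single 0 (form g v w)))"
    unfolding form_def by (rule S_comp_0_expand)
  have comm: "S.cmul (vc v) (vc w) = S.cmul (vc w) (vc v)"
    using one_in_G by (simp add: S.cmul_single S.cocycle_simps S.act_one mult.commute)
  have "phi0 (\<Sum>g\<in>G. Poly_Mapping.single g (Poly_Mapping.single 0 (form g v w))) =
      (\<Sum>g\<in>G. mon 0 (Poly_Mapping.single g (Poly_Mapping.single 0 (form g v w))))"
    by (simp add: phi0_sum phi0_single cong: sum.cong)
  also have "\<dots> = mon 0 ?d" by (simp only: d mon_sum)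
  finally have 1: "phi0 (\<Sum>g\<in>G. Poly_Mapping.single g (Poly_Mapping.single 0 (form g v w))) = mon 0 ?d" .
  have "phi (mon 0 (Poly_Mapping.single (mat 1) (tens_vec v * tens_vec w - tens_vec w * tens_vec v))) = mon 1 ?d"
    by (simp only: single_diff mon_diff phi_diff phi_mon tshift_0 vec_mult comm) simp
  then show ?thesis
    by (simp only: hecke_relation_eq phi_diff phi_mon 1 tshift_mon) simp
qed

lemma I_kernel: "I \<subseteq> {f\<in>pset T.C. phi f = 0}"
proof (rule I_minimal)
  show "ideal {f\<in>pset T.C. phi f = 0} (poly_ext (tens_crossed G \<alpha>))"
    by (rule T.ideal_P_I) (auto simp: phi_add phi_mult phi_diff[of 0, simplified])
qed (simp add: phi_relation hecke_relation_closed)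

text \<open>\<open>phi\<close> after \<open>psec\<close> is triangular in the powers of t with the
  identity on the diagonal: coefficient n is \<open>y n\<close> plus contributions of
  \<open>y i\<close> with i < n, which vanish by induction.\<close>

lemma phi_psec_inj:
  assumes y: "y \<in> pset S.C" and 0: "phi (psec y) = 0"
  shows "y = 0"
proof -
  have "y n = 0" for n
  proof (induction n rule: less_induct)
    case (less n)
    have "phi (psec y) n = (\<Sum>i\<le>n. if i = n then y n else 0)"
      unfolding phi_def
    proof (rule sum.cong[OF refl])
      fix i assume i: "i \<in> {..n}"
      show "phi0 (psec y i) (n - i) = (if i = n then y n else 0)"
      proof (cases "i = n")
        case True
        then show ?thesis using y sec_C[OF S.pset_CD[OF y(1), of n]]
          by (simp add: psec_def phi0_const proj_sec)
      next
        case False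
        then have "y i = 0" using i less by simp
        then show ?thesis using False by (simp add: psec_def zero_fun_apply)
      qed
    qed
    then show ?case using 0 by (simp add: zero_fun_apply)
  qed
  then show "y = 0" by (simp add: pointwise)
qed

text \<open>The ideal lies in the kernel of \<open>phi\<close>, so \<open>phi_psec_inj\<close> gives
  injectivity of the section map. From here on the normal form \<open>H.N\<close> is
  available.\<close>

sublocale H: hecke_iso G \<alpha> form ordered_section
proof
  fix y assume y: "y \<in> pset S.C" "psec y \<in> I"
  show "y = 0" using subsetD[OF I_kernel y(2)] y(1) by (simp add: phi_psec_inj)
qed

text \<open>Modulo the ideal \<open>f\<close> is the section of its normal form, and on sections
  \<open>phi\<close> is injective.\<close>

lemma phi_kernel:
  assumes "f \<in> pset T.C" "phi f = 0"
  shows "f \<in> I"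
proof -
  have "phi (f - psec (H.N f)) = 0" using subsetD[OF I_kernel H.N(2)[OF assms(1)]] by simp
  then have "H.N f = 0" using assms H.N(1)[OF assms(1)] by (simp add: phi_psec_inj phi_diff)
  then show ?thesis using H.N(2)[OF assms(1)] by simp
qed

section \<open>Surjectivity of the homomorphism\<close>

lemma phi_surj_of_mon:
  assumes "f \<in> pset S.C" "\<And>i. \<exists>x\<in>pset T.C. phi x = mon i (f i)"
  shows "\<exists>x\<in>pset T.C. phi x = f"
proof -
  from assms(2) obtain x where x: "\<And>i. x i \<in> pset T.C" "\<And>i. phi (x i) = mon i (f i)" by metis
  obtain n where n: "f = (\<Sum>i<n. mon i (f i))" using pset_sum_mon[OF assms(1)] by blast
  have "phi (\<Sum>i<n. x i) = (\<Sum>i<n. mon i (f i))" for n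
    by (induction n) (simp_all add: phi_add x)
  then have "phi (\<Sum>i<n. x i) = f" using n by simp
  then show ?thesis using T.pset_C_sum[of "{..<n}" x] x(1) by blast
qed

text \<open>The image of \<open>sec r\<close> is r plus terms in t^i with i >= 1, whose coefficients
  have degree m - 2 i < m. These terms lie in the image by induction and can be subtracted.\<close>

lemma phi_surj_graded:
  assumes "r \<in> S_comp (int m)"
  shows "\<exists>x\<in>pset T.C. phi x = mon 0 r"
  using assms
proof (induction m arbitrary: r rule: less_induct)
  case (less m)
  let ?F = "phi0 (sec r)"
  have s: "sec r \<in> T_comp (int m)" using less.prems by (rule sec_S_comp)
  have F: "?F i \<in> S_comp (int m - 2 * int i)" for i
    using phi0_comp[OF s] by (simp add: graded_def)
  have F0: "?F 0 = r" using phi0_const[OF T_compD[OF s]] by (simp add: proj_sec)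
  have rC: "mon 0 r \<in> pset S.C" using S_compD[OF less.prems] by blast
  have "\<exists>x\<in>pset T.C. phi x = mon i ((?F - mon 0 r) i)" for i
  \<comment> \<open>For i = 0 the difference cancels, and for 2 i > m the degree is negative; in
    both cases the coefficient is 0.\<close>
  proof (cases "i = 0 \<or> m < 2 * i")
    case True
    have "(?F - mon 0 r) i = 0"
    proof (cases "i = 0")
      case False
      then have "?F i = 0" using True by (intro S_comp_neg[OF F]) auto
      then show ?thesis using False by (simp add: minus_apply mon_def)
    qed (simp add: minus_apply F0)
    then show ?thesis by (intro bexI[of _ 0]) simp_all
  next
    case False
    have *: "int (m - 2 * i) = int m - 2 * int i" using False by simp
    have "?F i \<in> S_comp (int (m - 2 * i))" unfolding * by (rule F)
    then obtain x where x: "x \<in> pset T.C" "phi x = mon 0 (?F i)"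
      using less.IH[of "m - 2 * i"] False by auto
    have "(?F - mon 0 r) i = ?F i" using False by (simp add: minus_apply mon_def)
    then have "phi (tshift i x) = mon i ((?F - mon 0 r) i)" using x by (simp add: phi_tshift)
    then show ?thesis using x by blast
  qed
  from phi_surj_of_mon[OF _ this] rC obtain x where x: "x \<in> pset T.C" "phi x = ?F - mon 0 r" by blast
  then have "phi (mon 0 (sec r) - x) = mon 0 r" by (simp add: phi_diff)
  moreover have "mon 0 (sec r) - x \<in> pset T.C" using x T_compD[OF s] by blast
  ultimately show ?case by blast
qed

lemma phi_surj:
  assumes "f \<in> pset S.C"
  shows "\<exists>x\<in>pset T.C. phi x = f"
  using assms
proof (rule phi_surj_of_mon)
  fix i
  have "\<exists>x\<in>pset T.C. phi x = mon 0 r" if "r \<in> S.C" for r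
    using that
  proof (induction r rule: S.C_induct)
    case zero
    show ?case by (intro bexI[of _ 0]) simp_all
  next
    case (add r s)
    then obtain x y where "x \<in> pset T.C" "y \<in> pset T.C" "phi x = mon 0 r" "phi y = mon 0 s" by blast
    then show ?case by (intro bexI[of _ "x + y"]) (simp_all add: phi_add mon_add)
  next
    case (single g k c)
    then have "Poly_Mapping.single g (Poly_Mapping.single k c) \<in> S_comp (int (mono_degree k))"
      by (auto simp: symm_crossed_component_def lookup_single when_def)
    then show ?case by (rule phi_surj_graded)
  qed
  from this[of "f i"] obtain x where x: "x \<in> pset T.C" "phi x = mon 0 (f i)"
    using S.pset_CD[OF assms] by blast
  then have "phi (tshift i x) = mon i (f i)" by (simp add: phi_tshift)
  then show "\<exists>x\<in>pset T.C. phi x = mon i (f i)" using x by blast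
qed

section \<open>Isomorphisms with the Hecke quotient\<close>

abbreviation coset :: "(nat \<Rightarrow> complex^'n^'n \<Rightarrow>\<^sub>0 'n tens) \<Rightarrow> (nat \<Rightarrow> complex^'n^'n \<Rightarrow>\<^sub>0 'n tens) set" where
  "coset f \<equiv> I +>\<^bsub>poly_ext (tens_crossed G \<alpha>)\<^esub> f"

lemma coset_eq_iff_phi: "f \<in> pset T.C \<Longrightarrow> g \<in> pset T.C \<Longrightarrow> coset f = coset g \<longleftrightarrow> phi f = phi g"
  using I_kernel phi_kernel[of "f - g"] by (auto simp: T.coset_eq_iff[OF ideal_I] phi_diff)

lemma twisted_graded_Hecke_form: "twisted_graded_Hecke G \<alpha> form"
proof -
  note q = T.quot_alg_simps[OF ideal_I]
  have map: "section_map G \<alpha> form ordered_section = (\<lambda>f. coset (psec f))"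
    by (simp add: fun_eq_iff section_map_def psec_def sec_def)
  have "inj_on (\<lambda>f. coset (psec f)) (pset S.C)"
  proof (rule inj_onI)
    fix f g assume *: "f \<in> pset S.C" "g \<in> pset S.C" "coset (psec f) = coset (psec g)"
    then have "phi (psec (f - g)) = 0" by (simp add: coset_eq_iff_phi H.psec_diff phi_diff)
    then show "f = g" using phi_psec_inj[of "f - g"] * by simp
  qed
  moreover have "(\<lambda>f. coset (psec f)) ` pset S.C = carrier (hecke_quotient G \<alpha> form)"
  proof -
    have "\<exists>y\<in>pset S.C. coset f = coset (psec y)" if "f \<in> pset T.C" for f
      using section_surj[OF that] that by (auto simp: T.coset_eq_iff[OF ideal_I])
    then show ?thesis by (auto simp: hecke_quotient_def q(1))
  qed
  ultimately have "section_map G \<alpha> form ordered_section \<in> mod_iso (poly_ext (symm_crossed G \<alpha>)) (hecke_quotient G \<alpha> form)"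
    using S.P_add S.P_smult S.P_simps(1)
    by (simp add: mod_iso_def bij_betw_def map hecke_quotient_def q psec_add psec_psmult)
  then show ?thesis
    using skew_bilinear_form graded_section_ordered_section by (auto simp: twisted_graded_Hecke_def)
qed

lemma alg_isomorphic_form: "alg_isomorphic D (hecke_quotient G \<alpha> form)"
proof -
  note q = T.quot_alg_simps[OF ideal_I]
  \<comment> \<open>\<open>h\<close> will invert the map that \<open>phi\<close> induces on cosets.
    Any preimage under \<open>phi\<close> serves, because two of them differ by an element of the
    ideal.\<close>
  define k where "k y = (SOME x. x \<in> pset T.C \<and> phi x = y)" for y
  have k: "k y \<in> pset T.C" "phi (k y) = y" if "y \<in> pset S.C" for y
    using someI_ex[of "\<lambda>x. x \<in> pset T.C \<and> phi x = y"] phi_surj[OF that] unfolding k_def by blast+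
  define h where "h y = coset (k y)" for y
  have h: "h (phi f) = coset f" if "f \<in> pset T.C" for f
    using that k[OF phi_closed[OF that]] by (simp add: h_def coset_eq_iff_phi)
  have surj: "\<exists>f\<in>pset T.C. y = phi f" if "y \<in> pset S.C" for y
    using phi_surj[OF that] by metis
  \<comment> \<open>\<open>ring_hom\<close> includes the preservation of units, which holds because
    \<open>phi\<close> fixes the identity of G.\<close>
  have one: "phi (mon 0 (Poly_Mapping.single (mat 1) 1)) = mon 0 (Poly_Mapping.single (mat 1) 1)"
    using tact_single[of 0 1 "gb (mat 1)"] one_in_G by (simp add: phi0_single)
  have one_closed: "mon 0 (Poly_Mapping.single (mat 1) 1) \<in> pset T.C"
    using one_in_G by (simp add: T.C_single)
  have "h \<in> ring_hom D (hecke_quotient G \<alpha> form)"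
  proof (rule ring_hom_memI)
    fix y z assume "y \<in> carrier D" "z \<in> carrier D"
    then obtain f g where "f \<in> pset T.C" "y = phi f" "g \<in> pset T.C" "z = phi g"
      using surj by (metis deformed_simps(1))
    then show "h (y \<otimes>\<^bsub>D\<^esub> z) = h y \<otimes>\<^bsub>hecke_quotient G \<alpha> form\<^esub> h z"
      "h (y \<oplus>\<^bsub>D\<^esub> z) = h y \<oplus>\<^bsub>hecke_quotient G \<alpha> form\<^esub> h z"
      by (simp_all add: D_mult deformed_add h hecke_quotient_def q flip: phi_mult phi_add)
  qed (use h[OF one_closed] one in \<open>auto simp: hecke_quotient_def q h_def k\<close>)
  moreover have "bij_betw h (carrier D) (carrier (hecke_quotient G \<alpha> form))"
    unfolding bij_betw_def
  proof
    show "inj_on h (carrier D)"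
    proof (rule inj_onI)
      fix y z assume *: "y \<in> carrier D" "z \<in> carrier D" "h y = h z"
      then obtain f g where "f \<in> pset T.C" "y = phi f" "g \<in> pset T.C" "z = phi g"
        using surj by (metis deformed_simps(1))
      then show "y = z" using * by (simp add: h coset_eq_iff_phi)
    qed
    show "h ` carrier D = carrier (hecke_quotient G \<alpha> form)"
    proof
      show "h ` carrier D \<subseteq> carrier (hecke_quotient G \<alpha> form)"
        using k by (auto simp: hecke_quotient_def q(1) h_def)
      have "coset f \<in> h ` pset S.C" if "f \<in> pset T.C" for f
        using h[OF that] phi_closed[OF that] by (metis imageI)
      then show "carrier (hecke_quotient G \<alpha> form) \<subseteq> h ` carrier D"
        by (auto simp: hecke_quotient_def q(1))
    qed
  qed
  moreover have "h (c \<odot>\<^bsub>D\<^esub> y) = c \<odot>\<^bsub>hecke_quotient G \<alpha> form\<^esub> h y" if y: "y \<in> carrier D" for c y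
  proof -
    obtain f where "f \<in> pset T.C" "y = phi f" using surj y by (metis deformed_simps(1))
    then show ?thesis
      by (simp add: deformed_smult h hecke_quotient_def q T.pset_C_psmult flip: phi_psmult)
  qed
  ultimately show ?thesis by (auto simp: alg_isomorphic_def ring_iso_def)
qed

end

theorem theorem3p2:
  fixes G :: "(complex^'n^'n) set"
    and \<alpha> :: "complex^'n^'n \<Rightarrow> complex^'n^'n \<Rightarrow> complex"
  assumes "subgroup G GL" and "finite G"
    and "normalized_cocycle (GL\<lparr>carrier := G\<rparr>) \<alpha>"
  shows "(\<forall>a. twisted_graded_Hecke G \<alpha> a \<longrightarrow>
            (\<exists>\<mu>. is_deformation (symm_crossed G \<alpha>) \<mu> \<and>
                 deg_neg_two (symm_crossed_component G) \<mu> \<and>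
                 alg_isomorphic (hecke_quotient G \<alpha> a)
                   (deformed_algebra (symm_crossed G \<alpha>) \<mu>))) \<and>
         (\<forall>\<mu>. is_deformation (symm_crossed G \<alpha>) \<mu> \<and>
              deg_neg_two (symm_crossed_component G) \<mu> \<longrightarrow>
            (\<exists>a. twisted_graded_Hecke G \<alpha> a \<and>
                 alg_isomorphic (deformed_algebra (symm_crossed G \<alpha>) \<mu>)
                   (hecke_quotient G \<alpha> a)))"
proof -
  interpret hecke_setup G \<alpha>
    using assms by (rule hecke_setup.intro)
  have "\<exists>a. twisted_graded_Hecke G \<alpha> a \<and>
      alg_isomorphic (deformed_algebra (symm_crossed G \<alpha>) \<mu>) (hecke_quotient G \<alpha> a)"
    if "is_deformation (symm_crossed G \<alpha>) \<mu>" "deg_neg_two (symm_crossed_component G) \<mu>" for \<mu>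
  proof -
    interpret deformation G \<alpha> \<mu>
      using that by (intro deformation.intro deformation_axioms.intro hecke_setup_axioms)
    show ?thesis
      using twisted_graded_Hecke_form alg_isomorphic_form by blast
  qed
  then show ?thesis using hecke_algebra_is_deformation by blast
qed

end
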